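(* Let $R$ be a polynomial ring over a field and let $I_1, I_2, \dots, I_d$ ($d\ge 1$) be non-zero ideals of $R$, each generated by linear forms. Then the product $I_1I_2\cdots I_d$ has a linear resolution, i.e. $$\operatorname{reg}(I_1I_2\cdots I_d)=d.$$
   Context: $K$ is a field and $R=K[x_1,\dots,x_n]$ is a polynomial ring with the standard grading ($\deg x_i=1$). For a finitely generated graded $R$-module $M$ and $i\ge 0$ let $t_i(M)=\max\{j : \operatorname{Tor}_i^R(M,K)_j\neq 0\}$, with $t_i(M)=-\infty$ if $\operatorname{Tor}_i^R(M,K)=0$. The Castelnuovo-Mumford regularity of $M$ is $\operatorname{reg}(M)=\sup\{t_i(M)-i : i\ge 0\}$. The initial degree of a non-zero graded module $M$ is the least $i$ with $M_i\ne 0$; $M$ has a linear resolution if $\operatorname{reg}(M)$ equals its initial degree. *)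

theory Defs
  imports Complex_Main "HOL-Library.Poly_Mapping" "HOL-Library.Extended_Real"
begin

section \<open>The standard graded polynomial ring\<close>

text \<open>
  The polynomial ring over the field \<open>'k\<close> in finitely many variables, indexed by \<open>'n\<close>, is the
  monoid algebra of the exponent vectors \<open>'n \<Rightarrow>\<^sub>0 nat\<close>; the library makes it a \<^class>\<open>comm_ring_1\<close>.
\<close>

type_synonym ('n, 'k) mpol = "('n \<Rightarrow>\<^sub>0 nat) \<Rightarrow>\<^sub>0 'k"

definition total_degree :: "('n::finite \<Rightarrow>\<^sub>0 nat) \<Rightarrow> nat" where
  "total_degree m = (\<Sum>v\<in>UNIV. Poly_Mapping.lookup m v)"

text \<open>Degrees are integers; the components of negative degree come out as \<open>{0}\<close>.\<close>

definition homogeneous_part :: "int \<Rightarrow> ('n::finite, 'k::field) mpol set" where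
  "homogeneous_part j = {p. \<forall>m \<in> Poly_Mapping.keys p. int (total_degree m) = j}"

abbreviation linear_forms :: "('n::finite, 'k::field) mpol set" where
  "linear_forms \<equiv> homogeneous_part 1"


section \<open>Ideals\<close>

lemma module_mult: "module ((*) :: 'a::comm_ring_1 \<Rightarrow> 'a \<Rightarrow> 'a)"
  by unfold_locales (simp_all add: algebra_simps)

definition ideal_generated :: "'a::comm_ring_1 set \<Rightarrow> 'a set" where
  "ideal_generated S = module.span (*) S"

definition ideal_product :: "'i set \<Rightarrow> ('i \<Rightarrow> 'a::comm_ring_1 set) \<Rightarrow> 'a set" where
  "ideal_product A I = ideal_generated {\<Prod>i\<in>A. a i | a. \<forall>i\<in>A. a i \<in> I i}"


section \<open>Graded free resolutions\<close>

text \<open>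
  A graded module is given by a scalar multiplication on an ambient abelian group together with
  the family \<open>M :: int \<Rightarrow> 'm set\<close> of its homogeneous components. Homogeneous ideals are graded
  modules in this sense:
\<close>

definition ideal_components :: "('n::finite, 'k::field) mpol set \<Rightarrow> int \<Rightarrow> ('n, 'k) mpol set" where
  "ideal_components I j = I \<inter> homogeneous_part j"

text \<open>Free modules consist of finitely supported coordinate vectors with entries in the ring.\<close>

definition free_scale :: "'r::comm_ring_1 \<Rightarrow> (nat \<Rightarrow>\<^sub>0 'r) \<Rightarrow> (nat \<Rightarrow>\<^sub>0 'r)" where
  "free_scale c = Poly_Mapping.map ((*) c)"

lemma lookup_free_scale:
  "Poly_Mapping.lookup (free_scale c u) k = c * Poly_Mapping.lookup u k"
  by (auto simp: free_scale_def Poly_Mapping.map.rep_eq when_def)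

lemma module_free_scale: "module (free_scale :: 'r::comm_ring_1 \<Rightarrow> _)"
  by unfold_locales
    (auto intro!: poly_mapping_eqI simp: lookup_free_scale lookup_add algebra_simps)

text \<open>
  The data of a complex \<open>\<dots> \<rightarrow> F\<^sub>2 \<rightarrow> F\<^sub>1 \<rightarrow> F\<^sub>0 \<rightarrow> M \<rightarrow> 0\<close> with \<open>F\<^sub>i\<close> free of finite rank on basis
  vectors \<open>e\<^sub>0, e\<^sub>1, \<dots>\<close>, where \<open>e\<^sub>k\<close> has degree \<open>shift i k\<close>. The map \<open>diff i\<close> is the
  differential \<open>F\<^bsub>i+1\<^esub> \<rightarrow> F\<^sub>i\<close>, and \<open>aug\<close> is \<open>F\<^sub>0 \<rightarrow> M\<close>. The maps are total on the free module of
  countable rank, but only their values on the \<open>F\<^sub>i\<close> matter.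
\<close>

record (overloaded) ('n, 'k, 'm) free_complex =
  rank :: "nat \<Rightarrow> nat"
  shift :: "nat \<Rightarrow> nat \<Rightarrow> int"
  diff :: "nat \<Rightarrow> (nat \<Rightarrow>\<^sub>0 (('n \<Rightarrow>\<^sub>0 nat) \<Rightarrow>\<^sub>0 'k::zero)) \<Rightarrow> (nat \<Rightarrow>\<^sub>0 (('n \<Rightarrow>\<^sub>0 nat) \<Rightarrow>\<^sub>0 'k))"
  aug :: "(nat \<Rightarrow>\<^sub>0 (('n \<Rightarrow>\<^sub>0 nat) \<Rightarrow>\<^sub>0 'k)) \<Rightarrow> 'm"

text \<open>The degree \<open>j\<close> component of \<open>F\<^sub>i = \<Oplus>\<^sub>k R(- shift i k)\<close>.\<close>

definition free_component ::
  "('n::finite, 'k::field, 'm) free_complex \<Rightarrow> nat \<Rightarrow> int \<Rightarrow> (nat \<Rightarrow>\<^sub>0 ('n, 'k) mpol) set" where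
  "free_component F i j =
    {u. Poly_Mapping.keys u \<subseteq> {..<rank F i} \<and>
        (\<forall>k<rank F i. Poly_Mapping.lookup u k \<in> homogeneous_part (j - shift F i k))}"

text \<open>
  A sequence of graded modules is exact iff it is exact in every degree; the equations below also
  say that all maps preserve degrees.
\<close>

definition graded_free_resolution ::
  "(('n::finite, 'k::field) mpol \<Rightarrow> 'm::ab_group_add \<Rightarrow> 'm) \<Rightarrow> (int \<Rightarrow> 'm set)
    \<Rightarrow> ('n, 'k, 'm) free_complex \<Rightarrow> bool" where
  "graded_free_resolution scale M F \<longleftrightarrow>
     module_hom free_scale scale (aug F) \<and>
     (\<forall>i. module_hom free_scale free_scale (diff F i)) \<and>
     (\<forall>j. aug F ` free_component F 0 j = M j) \<and>
     (\<forall>j. diff F 0 ` free_component F 1 j = {u \<in> free_component F 0 j. aug F u = 0}) \<and>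
     (\<forall>i j. diff F (Suc i) ` free_component F (Suc (Suc i)) j =
            {u \<in> free_component F (Suc i) j. diff F i u = 0})"


section \<open>Tor against the residue field\<close>

text \<open>
  With \<open>K = R / (x\<^sub>1, \<dots>, x\<^sub>n)\<close>, the module \<open>F\<^sub>i \<otimes> K\<close> is the vector space with basis
  \<open>e\<^sub>k \<otimes> 1\<close> in degree \<open>shift i k\<close>, and the matrix of \<open>diff i \<otimes> K\<close> consists of the
  constant coefficients of the entries of the matrix of \<open>diff i\<close>.
\<close>

definition tensor_component ::
  "('n::finite, 'k::field, 'm) free_complex \<Rightarrow> nat \<Rightarrow> int \<Rightarrow> (nat \<Rightarrow>\<^sub>0 'k) set" where
  "tensor_component F i j =
    {v. Poly_Mapping.keys v \<subseteq> {k. k < rank F i \<and> shift F i k = j}}"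

definition tensor_diff ::
  "('n::finite, 'k::field, 'm) free_complex \<Rightarrow> nat \<Rightarrow> (nat \<Rightarrow>\<^sub>0 'k) \<Rightarrow> (nat \<Rightarrow>\<^sub>0 'k)" where
  "tensor_diff F i v =
     Poly_Mapping.map (\<lambda>p. Poly_Mapping.lookup p 0)
       (diff F i (Poly_Mapping.map (Poly_Mapping.single 0) v))"

fun tensor_cycles ::
  "('n::finite, 'k::field, 'm) free_complex \<Rightarrow> nat \<Rightarrow> int \<Rightarrow> (nat \<Rightarrow>\<^sub>0 'k) set" where
  "tensor_cycles F 0 j = tensor_component F 0 j"
| "tensor_cycles F (Suc i) j = {v \<in> tensor_component F (Suc i) j. tensor_diff F i v = 0}"

definition tensor_boundaries ::
  "('n::finite, 'k::field, 'm) free_complex \<Rightarrow> nat \<Rightarrow> int \<Rightarrow> (nat \<Rightarrow>\<^sub>0 'k) set" where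
  "tensor_boundaries F i j = tensor_diff F i ` tensor_component F (Suc i) j"

definition homology ::
  "('n::finite, 'k::field, 'm) free_complex \<Rightarrow> nat \<Rightarrow> int \<Rightarrow> (nat \<Rightarrow>\<^sub>0 'k) set set" where
  "homology F i j =
     tensor_cycles F i j //
       {(u, v). u \<in> tensor_cycles F i j \<and> v \<in> tensor_cycles F i j \<and>
                u - v \<in> tensor_boundaries F i j}"

text \<open>
  As usual, Tor is computed from a chosen resolution; up to isomorphism the choice is irrelevant.
  The definitions from here on are meant for finitely generated graded modules \<open>M\<close>, which have
  a graded resolution by free modules of finite rank.
\<close>

definition Tor ::
  "(('n::finite, 'k::field) mpol \<Rightarrow> 'm::ab_group_add \<Rightarrow> 'm) \<Rightarrow> (int \<Rightarrow> 'm set)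
    \<Rightarrow> nat \<Rightarrow> int \<Rightarrow> (nat \<Rightarrow>\<^sub>0 'k) set set" where
  "Tor scale M i j = homology (SOME F. graded_free_resolution scale M F) i j"

text \<open>Tor is a set of cosets, so it is nonzero iff it has more than one element.\<close>

definition Tor_nonzero ::
  "(('n::finite, 'k::field) mpol \<Rightarrow> 'm::ab_group_add \<Rightarrow> 'm) \<Rightarrow> (int \<Rightarrow> 'm set)
    \<Rightarrow> nat \<Rightarrow> int \<Rightarrow> bool" where
  "Tor_nonzero scale M i j \<longleftrightarrow> \<not> is_singleton (Tor scale M i j)"


section \<open>Castelnuovo--Mumford regularity\<close>

text \<open>
  The set of degrees below is finite because the resolution has finite rank in each step, so the
  supremum is its maximum, and \<open>-\<infinity>\<close> if it is empty.
\<close>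

definition t_inv ::
  "(('n::finite, 'k::field) mpol \<Rightarrow> 'm::ab_group_add \<Rightarrow> 'm) \<Rightarrow> (int \<Rightarrow> 'm set)
    \<Rightarrow> nat \<Rightarrow> ereal" where
  "t_inv scale M i = (SUP j \<in> {j. Tor_nonzero scale M i j}. ereal (of_int j))"

definition reg ::
  "(('n::finite, 'k::field) mpol \<Rightarrow> 'm::ab_group_add \<Rightarrow> 'm) \<Rightarrow> (int \<Rightarrow> 'm set) \<Rightarrow> ereal" where
  "reg scale M = (SUP i. t_inv scale M i - ereal (real i))"

definition initial_degree :: "(int \<Rightarrow> 'm::zero set) \<Rightarrow> int" where
  "initial_degree M = (LEAST j. M j \<noteq> {0})"

definition has_linear_resolution ::
  "(('n::finite, 'k::field) mpol \<Rightarrow> 'm::ab_group_add \<Rightarrow> 'm) \<Rightarrow> (int \<Rightarrow> 'm set) \<Rightarrow> bool" where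
  "has_linear_resolution scale M \<longleftrightarrow>
     (\<exists>j. M j \<noteq> {0}) \<and> reg scale M = ereal (of_int (initial_degree M))"

end

theory Submission
  imports Defs "Jordan_Normal_Form.Determinant" "HOL-Computational_Algebra.Fraction_Field"
begin

text \<open>
  Call a sequence of vectors in a free module a sequence with linear quotients if each colon ideal
  \<open>(h\<^sub>1, \<dots>, h\<^sub>t) : h\<^bsub>t+1\<^esub>\<close> is generated by linear forms. Such a sequence behaves like a sequence of cyclic modules
  \<open>R/(L)\<close> with \<open>L\<close> a space of linear forms, glued together one by one: generators of the colon ideals lift to linear
  syzygies, and these again form a sequence with linear quotients, because ideals of linear forms are
  prime (\<open>syzygies_linear_quotients\<close>). Repeating this step, a module generated in degree \<open>d\<close> by a
  sequence with linear quotients acquires a free resolution whose \<open>i\<close>-th module is generated in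
  degree \<open>d + i\<close>.

  The product of the ideals generated by spaces \<open>V\<^sub>1, \<dots>, V\<^sub>d\<close> of linear forms has linear quotients if the
  field is infinite. Choose generic vectors \<open>f i 0, f i 1, \<dots>\<close> in \<open>V\<^sub>i\<close> and arrange the products
  \<open>f\<^sub>a = \<Prod>i. f i (a i)\<close> by the sum of the indices \<open>a i\<close>. Let \<open>L\<^sub>a\<close> consist of the forms \<open>f i j\<close> with \<open>j < a i\<close>.
  An earlier product has some index below that of \<open>a\<close>, so it lies in the prime ideal \<open>(L\<^sub>a)\<close>; and a form in \<open>L\<^sub>a\<close>
  times \<open>f\<^sub>a\<close> is a multiple of an earlier product, by an exchange of factors.
  If no factor of \<open>f\<^sub>a\<close> is in the span of \<open>L\<^sub>a\<close>, the colon ideal is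
  therefore exactly \<open>(L\<^sub>a)\<close> (\<open>generator_colon\<close>). If some factor is, genericity yields a set \<open>C\<close> of indices such
  that each \<open>V\<^sub>i\<close> with \<open>i \<in> C\<close> is contained in the sum of the spans of \<open>f j 0, \<dots>, f j (a j - 1)\<close> over
  \<open>j \<in> C\<close>. The resulting linear relations form a square matrix with vanishing determinant, whose expansion
  shows that \<open>f\<^sub>a\<close> is a combination of earlier products (\<open>prod_mem_of_relations\<close>, \<open>generator_redundant\<close>).

  A finite field leaves no room for generic choices, so the coefficient field is always extended to its field of
  rational functions in one variable, which is infinite. Vector space bases of
  the lowest homogeneous components of the ideal and of its successive syzygy modules remain bases after
  this extension, where a change of basis relates them to sequences with linear quotients; linear functionals
  on the larger field carry the statement that they generate back (\<open>descend_generators\<close>). This gives a linear resolution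
  over the original field. Finally, Tor is defined by an arbitrary resolution: it is
  compared with the linear one by chain maps and a homotopy (\<open>homology_trivial_of_resolution\<close>), so
  its \<open>i\<close>-th group lives in degree \<open>d + i\<close> only, and it is non-zero for \<open>i = 0\<close>.
\<close>


section \<open>Homogeneous polynomials\<close>

abbreviation lookup :: "('a \<Rightarrow>\<^sub>0 'b::zero) \<Rightarrow> 'a \<Rightarrow> 'b" where
  "lookup \<equiv> Poly_Mapping.lookup"

abbreviation single :: "'a \<Rightarrow> 'b \<Rightarrow> 'a \<Rightarrow>\<^sub>0 'b::zero" where
  "single \<equiv> Poly_Mapping.single"

abbreviation keys :: "('a \<Rightarrow>\<^sub>0 'b::zero) \<Rightarrow> 'a set" where
  "keys \<equiv> Poly_Mapping.keys"

interpretation vec: Modules.module free_scale by (rule module_free_scale)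

interpretation ring: Modules.module "(*)" by (rule module_mult)

lemma total_degree_zero [simp]: "total_degree 0 = 0"
  by (simp add: total_degree_def)

lemma total_degree_add: "total_degree (a + b) = total_degree a + total_degree b"
  by (simp add: total_degree_def lookup_add sum.distrib)

lemma total_degree_eq_0: "total_degree m = 0 \<longleftrightarrow> m = 0"
  by (auto simp: total_degree_def intro!: poly_mapping_eqI)

lemma total_degree_single: "total_degree (single v e) = e"
  by (simp add: total_degree_def lookup_single when_def sum.delta)

lemma sum_of_monomials:
  "(p :: _ \<Rightarrow>\<^sub>0 _ :: comm_monoid_add) = (\<Sum>m\<in>keys p. single m (lookup p m))"
  by (rule poly_mapping_eqI)
    (auto simp: lookup_sum lookup_single when_def sum.delta not_in_keys_iff_lookup_eq_zero)

lemma monomial_induct [case_names zero add]: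
  fixes p :: "'m \<Rightarrow>\<^sub>0 'b::comm_monoid_add"
  assumes "P 0" "\<And>m c q. P q \<Longrightarrow> P (single m c + q)"
  shows "P p"
proof -
  have "P (\<Sum>m\<in>A. single m (lookup p m))" if "finite A" for A
    using that by induction (auto intro: assms)
  from this[of "keys p"] show ?thesis
    by (simp flip: sum_of_monomials)
qed

lemma lookup_mult_keys:
  "lookup (f * g) k =
    (\<Sum>a\<in>keys f. \<Sum>b\<in>keys g.
      (lookup f a * lookup g b when a + b = k))"
proof -
  have "f * g = (\<Sum>a\<in>keys f. \<Sum>b\<in>keys g.
      single (a + b) (lookup f a * lookup g b))"
  proof -
    have "f * g = (\<Sum>a\<in>keys f. single a (lookup f a))
        * (\<Sum>b\<in>keys g. single b (lookup g b))"
      by (simp flip: sum_of_monomials)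
    then show ?thesis
      by (simp only: sum_product mult_single)
  qed
  then show ?thesis
    by (simp add: lookup_sum lookup_single)
qed

lemma lookup_mult_const [simp]:
  "lookup (single 0 c * p) m = c * lookup p m"
  by (cases "c = 0")
    (auto simp: lookup_mult_keys when_def sum.delta not_in_keys_iff_lookup_eq_zero)

lemma const_coeff_mult:
  fixes p q :: "('n::finite, 'k::field) mpol"
  shows "lookup (p * q) 0 = lookup p 0 * lookup q 0"
proof -
  have *: "a + b = 0 \<longleftrightarrow> a = 0 \<and> b = 0" for a b :: "'n \<Rightarrow>\<^sub>0 nat"
    by (metis add_cancel_right_left add_is_0 total_degree_add total_degree_eq_0)
  have "lookup (p * q) 0 = (\<Sum>a\<in>keys p. \<Sum>b\<in>keys q.
     if a = 0 then if b = 0 then lookup p a * lookup q b else 0 else 0)"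
    by (auto simp: lookup_mult_keys * when_def intro!: sum.cong)
  also have "\<dots> = (\<Sum>a\<in>keys p. if a = 0 then
      (\<Sum>b\<in>keys q. if b = 0 then lookup p a * lookup q b else 0) else 0)"
    by (intro sum.cong) auto
  also have "\<dots> = lookup p 0 * lookup q 0"
    by (auto simp: sum.delta not_in_keys_iff_lookup_eq_zero)
  finally show ?thesis .
qed

lemma homogeneous_part_iff:
  "p \<in> homogeneous_part j \<longleftrightarrow> (\<forall>m. lookup p m \<noteq> 0 \<longrightarrow> int (total_degree m) = j)"
  by (auto simp: homogeneous_part_def in_keys_iff)

lemma homogeneous_part_closed [simp, intro]:
  "0 \<in> homogeneous_part j"
  "p \<in> homogeneous_part j \<Longrightarrow> q \<in> homogeneous_part j \<Longrightarrow> p + q \<in> homogeneous_part j"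
  "p \<in> homogeneous_part j \<Longrightarrow> q \<in> homogeneous_part j \<Longrightarrow> p - q \<in> homogeneous_part j"
  "p \<in> homogeneous_part j \<Longrightarrow> - p \<in> homogeneous_part j"
  apply (auto simp: homogeneous_part_iff lookup_add lookup_minus)
  apply (metis add.right_neutral)
  by (metis diff_0_right)

lemma homogeneous_part_sum [intro]:
  "(\<And>i. i \<in> A \<Longrightarrow> f i \<in> homogeneous_part j) \<Longrightarrow> sum f A \<in> homogeneous_part j"
  by (induction A rule: infinite_finite_induct) auto

lemma homogeneous_part_mult [intro]:
  assumes "p \<in> homogeneous_part i" "q \<in> homogeneous_part j"
  shows "p * q \<in> homogeneous_part (i + j)"
proof -
  have "int (total_degree m) = i + j" if m: "m \<in> keys (p * q)" for m
  proof -
    obtain a b where "m = a + b" "a \<in> keys p" "b \<in> keys q"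
      using m keys_mult[of p q] by blast
    then show ?thesis
      using assms by (auto simp: homogeneous_part_def total_degree_add)
  qed
  then show ?thesis by (auto simp: homogeneous_part_def)
qed

lemma const_homogeneous [simp, intro]: "single 0 c \<in> homogeneous_part 0"
  by (auto simp: homogeneous_part_def)

lemma one_homogeneous [simp, intro]: "1 \<in> homogeneous_part 0"
  by (auto simp: homogeneous_part_def)

lemma var_linear: "single (single v 1) c \<in> linear_forms"
  by (auto simp: homogeneous_part_def total_degree_single)

lemma const_mult_homogeneous:
  "p \<in> homogeneous_part j \<Longrightarrow> single 0 c * p \<in> homogeneous_part j"
  using homogeneous_part_mult[OF const_homogeneous] by fastforce

lemma homogeneous_part_0: "p \<in> homogeneous_part 0 \<longleftrightarrow> p = single 0 (lookup p 0)"
proof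
  assume "p \<in> homogeneous_part 0"
  then show "p = single 0 (lookup p 0)"
    by (intro poly_mapping_eqI)
      (auto simp: homogeneous_part_iff total_degree_eq_0 lookup_single when_def)
qed (metis const_homogeneous)

lemma const_coeff_homogeneous:
  "p \<in> homogeneous_part j \<Longrightarrow> j \<noteq> 0 \<Longrightarrow> lookup p 0 = 0"
  by (auto simp: homogeneous_part_iff)

lemma homogeneous_part_neg: "j < 0 \<Longrightarrow> homogeneous_part j = {0}"
  by (auto simp: homogeneous_part_iff intro!: poly_mapping_eqI)

definition homogeneous_component :: "int \<Rightarrow> ('n::finite, 'k::field) mpol \<Rightarrow> ('n, 'k) mpol" where
  "homogeneous_component j p = Poly_Mapping.mapp (\<lambda>m c. c when int (total_degree m) = j) p"

lemma lookup_homogeneous_component: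
  "lookup (homogeneous_component j p) m
    = (lookup p m when int (total_degree m) = j)"
  by (auto simp: homogeneous_component_def lookup_mapp when_def in_keys_iff)

lemma homogeneous_component_simps [simp]:
  "homogeneous_component j 0 = 0"
  "homogeneous_component j (p + q) = homogeneous_component j p + homogeneous_component j q"
  "homogeneous_component j (p - q) = homogeneous_component j p - homogeneous_component j q"
  "homogeneous_component j p \<in> homogeneous_part j"
  by (auto intro!: poly_mapping_eqI
      simp: lookup_homogeneous_component lookup_add lookup_minus when_def homogeneous_part_iff)

lemma homogeneous_component_id:
  "p \<in> homogeneous_part i \<Longrightarrow> homogeneous_component j p = (p when i = j)"
  by (auto intro!: poly_mapping_eqI
      simp: lookup_homogeneous_component homogeneous_part_iff when_def)

lemma homogeneous_component_mult:
  assumes "q \<in> homogeneous_part e"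
  shows "homogeneous_component j (p * q) = homogeneous_component (j - e) p * q"
proof (induction p rule: monomial_induct)
  case (add m c p)
  have m: "single m c \<in> homogeneous_part (int (total_degree m))"
    by (auto simp: homogeneous_part_def)
  have "homogeneous_component j (single m c * q)
      = homogeneous_component (j - e) (single m c) * q"
    by (subst homogeneous_component_id[OF homogeneous_part_mult[OF m assms]],
        subst homogeneous_component_id[OF m]) (auto simp: when_def)
  then show ?case
    using add by (simp add: algebra_simps)
qed simp

section \<open>Ideals generated by linear forms are prime\<close>

text \<open>
  The coefficients are mapped by \<open>c\<close> and the variables by \<open>g\<close>, into an arbitrary commutative ring.
  Integrality of the polynomial ring and primality of linear ideals use two different targets.
\<close>

definition substitute :: "('k \<Rightarrow> 'a) \<Rightarrow> ('n::finite \<Rightarrow> 'a) \<Rightarrow> ('n, 'k::field) mpol \<Rightarrow> 'a::comm_ring_1" where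
  "substitute c g p =
     (\<Sum>m\<in>keys p. c (lookup p m) * (\<Prod>v\<in>UNIV. g v ^ lookup m v))"

locale coefficient_hom =
  fixes c :: "'k::field \<Rightarrow> 'a::comm_ring_1"
  assumes hom_zero: "c 0 = 0" and hom_one: "c 1 = 1"
    and hom_add: "c (x + y) = c x + c y" and hom_mult: "c (x * y) = c x * c y"
begin

lemma substitute_superset:
  assumes "finite A" "keys p \<subseteq> A"
  shows "substitute c g p = (\<Sum>m\<in>A. c (lookup p m) * (\<Prod>v\<in>UNIV. g v ^ lookup m v))"
  unfolding substitute_def using assms
  by (intro sum.mono_neutral_left) (auto simp: in_keys_iff hom_zero)

lemma substitute_zero [simp]: "substitute c g 0 = 0"
  by (simp add: substitute_def)

lemma substitute_add: "substitute c g (p + q) = substitute c g p + substitute c g q"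
proof -
  let ?A = "keys p \<union> keys q"
  have "keys (p + q) \<subseteq> ?A" by (rule keys_add)
  then show ?thesis
    by (simp add: substitute_superset[of ?A] lookup_add hom_add algebra_simps sum.distrib)
qed

lemma substitute_single:
  "substitute c g (single m a) = c a * (\<Prod>v\<in>UNIV. g v ^ lookup m v)"
  by (subst substitute_superset[of "{m}"]) auto

lemma substitute_mult: "substitute c g (p * q) = substitute c g p * substitute c g q"
proof (induction p rule: monomial_induct)
  case (add m a p)
  have "substitute c g (single m a * q) = substitute c g (single m a) * substitute c g q"
  proof (induction q rule: monomial_induct)
    case (add m' a' q)
    have "substitute c g (single m a * single m' a')
        = substitute c g (single m a) * substitute c g (single m' a')"
      unfolding mult_single substitute_single hom_mult lookup_add power_add prod.distrib
      by (simp only: mult_ac)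
    then show ?case
      by (simp only: distrib_left substitute_add add.IH)
  qed simp
  then show ?case
    by (simp only: distrib_right substitute_add add.IH)
qed simp

lemma substitute_uminus: "substitute c g (- p) = - substitute c g p"
  using substitute_add[of g p "- p"] by (simp add: add_eq_0_iff)

lemma substitute_diff: "substitute c g (p - q) = substitute c g p - substitute c g q"
  using substitute_add[of g p "- q"] by (simp only: substitute_uminus diff_conv_add_uminus)

end

interpretation const_hom: coefficient_hom "single 0 :: 'k::field \<Rightarrow> ('m::comm_monoid_add \<Rightarrow>\<^sub>0 'k)"
  by unfold_locales (auto simp: single_add mult_single)

text \<open>
  Monomials in finitely many unordered variables embed into monomials in variables numbered by
  natural numbers. These carry a linear order that is compatible with multiplication, so leading terms multiply and the target
  ring is a domain.
\<close>

lemma mpol_no_zero_divisors: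
  fixes p q :: "('n::finite, 'k::field) mpol"
  assumes "p * q = 0"
  shows "p = 0 \<or> q = 0"
proof -
  obtain e :: "'n \<Rightarrow> nat" where e: "inj e"
    using finite_imp_inj_to_nat_seg[of "UNIV :: 'n set"] by auto
  define g :: "'n \<Rightarrow> (nat \<Rightarrow>\<^sub>0 nat) \<Rightarrow>\<^sub>0 'k" where
    "g v = single (single (e v) 1) 1" for v
  define \<mu> :: "('n \<Rightarrow>\<^sub>0 nat) \<Rightarrow> (nat \<Rightarrow>\<^sub>0 nat)" where
    "\<mu> m = (\<Sum>v\<in>UNIV. single (e v) (lookup m v))" for m
  have pow: "g v ^ k = single (single (e v) k) 1" for v k
    by (induction k) (auto simp: g_def mult_single simp flip: single_add)
  have prod: "(\<Prod>v\<in>A. g v ^ lookup m v)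
      = single (\<Sum>v\<in>A. single (e v) (lookup m v)) 1"
    if "finite A" for A m
    using that by induction (auto simp: pow mult_single)
  have \<mu>: "lookup (\<mu> m) (e v) = lookup m v" for m v
    using inj_eq[OF e] by (simp add: \<mu>_def lookup_sum lookup_single when_def)
  then have "inj \<mu>"
    by (intro injI poly_mapping_eqI) metis
  have sub: "substitute (single 0) g p
      = (\<Sum>m\<in>keys p. single (\<mu> m) (lookup p m))" for p :: "('n, 'k) mpol"
    by (simp add: substitute_def prod mult_single \<mu>_def)
  have inj: "p = 0" if "substitute (single 0) g p = 0" for p :: "('n, 'k) mpol"
  proof (rule poly_mapping_eqI)
    fix m
    have "lookup (substitute (single 0) g p) (\<mu> m) = lookup p m"
      using \<open>inj \<mu>\<close> by (auto simp: sub lookup_sum lookup_single when_def inj_eq sum.delta in_keys_iff)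
    then show "lookup p m = lookup 0 m"
      using that by simp
  qed
  have "substitute (single 0) g p * substitute (single 0) g q = 0"
    using assms by (metis const_hom.substitute_mult const_hom.substitute_zero)
  then show ?thesis
    using inj by auto
qed

interpretation scalar: vector_space "\<lambda>c p. single 0 c * (p :: ('n::finite, 'k::field) mpol)"
  by unfold_locales (simp_all add: distrib_left distrib_right single_add mult_single mult.assoc [symmetric])

lemma scalar_span_subset_ideal: "scalar.span L \<subseteq> ideal_generated L"
  unfolding ideal_generated_def
  by (rule scalar.span_minimal)
    (auto simp: scalar.subspace_def ring.span_superset ring.span_zero ring.span_add ring.span_scale)

lemma homogeneous_part_lookup:
  "p \<in> homogeneous_part j \<Longrightarrow> int (total_degree m) \<noteq> j \<Longrightarrow> lookup p m = 0"
  by (auto simp: homogeneous_part_iff)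

lemma linear_form_expansion:
  assumes "l \<in> linear_forms"
  shows "l = (\<Sum>v\<in>UNIV. single 0 (lookup l (single v 1))
     * single (single v 1) 1)"
proof (rule poly_mapping_eqI)
  fix m :: "'a \<Rightarrow>\<^sub>0 nat"
  let ?r = "\<Sum>v\<in>UNIV. single 0 (lookup l (single v 1))
     * single (single v 1) 1"
  show "lookup l m = lookup ?r m"
  proof (cases "total_degree m = 1")
    case True
    then have "(\<Sum>v\<in>UNIV. lookup m v) = 1"
      by (simp add: total_degree_def)
    then obtain w where w: "lookup m w = 1" "\<And>v. v \<noteq> w \<Longrightarrow> lookup m v = 0"
      using sum_eq_1_iff[OF finite_UNIV] by (metis UNIV_I)
    then have m: "m = single w 1"
      by (intro poly_mapping_eqI) (auto simp: lookup_single when_def)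
    have "single v 1 = (single w 1 :: _ \<Rightarrow>\<^sub>0 nat) \<longleftrightarrow> v = w" for v :: 'a
      by (metis lookup_single_eq lookup_single_not_eq zero_neq_one)
    then show ?thesis
      by (simp add: m lookup_sum mult_single lookup_single when_def sum.delta)
  next
    case False
    have "?r \<in> linear_forms"
      by (intro homogeneous_part_sum const_mult_homogeneous var_linear)
    then have "lookup ?r m = 0" "lookup l m = 0"
      using False assms by (simp_all only: homogeneous_part_lookup of_nat_1_eq_iff not_False_eq_True)
    then show ?thesis by (simp only:)
  qed
qed

text \<open>
  Choose a linear projection of the space of linear forms with kernel spanned by \<open>L\<close>. The algebra
  endomorphism that extends it kills exactly the ideal of \<open>L\<close>, so the residue class ring embeds
  into the polynomial ring, which has no zero divisors.
\<close>

lemma linear_ideal_kernel: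
  fixes L :: "('n::finite, 'k::field) mpol set"
  assumes L: "L \<subseteq> linear_forms"
  obtains \<phi> :: "('n, 'k) mpol \<Rightarrow> ('n, 'k) mpol" where
    "\<And>p q. \<phi> (p * q) = \<phi> p * \<phi> q"
    "\<And>p. \<phi> p = 0 \<longleftrightarrow> p \<in> ideal_generated L"
    "\<And>l. l \<in> linear_forms \<Longrightarrow> \<phi> l = 0 \<Longrightarrow> l \<in> scalar.span L"
proof -
  interpret vector_space_pair "\<lambda>c p. single 0 c * (p :: ('n, 'k) mpol)"
     "\<lambda>c p. single 0 c * (p :: ('n, 'k) mpol)" ..
  obtain B0 where B0: "B0 \<subseteq> L" "scalar.independent B0" "L \<subseteq> scalar.span B0"
    using scalar.basis_exists by metis
  define B where "B = scalar.extend_basis B0"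
  have B: "B0 \<subseteq> B" "scalar.independent B" "scalar.span B = UNIV"
    using B0(2) by (auto simp: B_def scalar.extend_basis_superset scalar.independent_extend_basis)
  define \<pi> where "\<pi> = construct B (\<lambda>b. if b \<in> B0 then 0 else b)"
  have lin: "Vector_Spaces.linear (\<lambda>c p. single 0 c * (p :: ('n, 'k) mpol))
      (\<lambda>c p. single 0 c * (p :: ('n, 'k) mpol)) \<pi>"
    unfolding \<pi>_def by (rule linear_construct[OF B(2)])
  note \<pi> = linear_add[OF lin] linear_scale[OF lin] linear_sum[OF lin] linear_0[OF lin]
  have basis: "\<pi> b = (if b \<in> B0 then 0 else b)" if "b \<in> B" for b
    unfolding \<pi>_def by (rule construct_basis[OF B(2) that])
  have diff: "\<pi> p - p \<in> scalar.span B0" for p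
  proof (rule scalar.span_induct[of p B])
    show "scalar.subspace {p. \<pi> p - p \<in> scalar.span B0}"
    proof (unfold scalar.subspace_def, intro conjI ballI allI CollectI; (elim CollectE)?)
      show "\<pi> 0 - 0 \<in> scalar.span B0" by (simp add: \<pi> scalar.span_zero)
    next
      fix x y assume "\<pi> x - x \<in> scalar.span B0" "\<pi> y - y \<in> scalar.span B0"
      then have "(\<pi> x - x) + (\<pi> y - y) \<in> scalar.span B0" by (rule scalar.span_add)
      then show "\<pi> (x + y) - (x + y) \<in> scalar.span B0" by (simp add: \<pi> algebra_simps)
    next
      fix c x assume "\<pi> x - x \<in> scalar.span B0"
      then have "single 0 c * (\<pi> x - x) \<in> scalar.span B0" by (rule scalar.span_scale)
      then show "\<pi> (single 0 c * x) - single 0 c * x \<in> scalar.span B0"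
        by (simp add: \<pi> right_diff_distrib)
    qed
  qed (use B(3) basis in \<open>auto simp: scalar.span_zero scalar.span_base scalar.span_neg\<close>)
  have zero: "\<pi> p = 0" if "p \<in> L" for p
  proof (rule scalar.span_induct[of p B0])
    show "p \<in> scalar.span B0" using that B0(3) by blast
  qed (use B(1) basis in \<open>auto simp: scalar.subspace_def \<pi>\<close>)
  define x where "x v = single (single v (1::nat)) (1::'k)" for v :: 'n
  define \<phi> where "\<phi> = substitute (single 0) (\<lambda>v. \<pi> (x v))"
  note hom = const_hom.substitute_add const_hom.substitute_mult const_hom.substitute_diff
    const_hom.substitute_zero
  have sum: "\<phi> (sum f A) = (\<Sum>i\<in>A. \<phi> (f i))" for f and A :: "'n set"
    by (induction A rule: infinite_finite_induct) (auto simp: \<phi>_def hom)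
  have \<phi>1: "\<phi> (single 0 c) = single 0 c" for c
    by (simp add: \<phi>_def const_hom.substitute_single)
  have \<phi>x: "\<phi> (x v) = \<pi> (x v)" for v
  proof -
    have "(\<Prod>w\<in>UNIV. \<pi> (x w) ^ (if v = w then Suc 0 else 0)) = (\<Prod>w\<in>UNIV. if v = w then \<pi> (x w) else 1)"
      by (intro prod.cong) auto
    then show ?thesis
      by (simp add: \<phi>_def x_def[of v] const_hom.substitute_single lookup_single when_def)
  qed
  have \<phi>mult: "\<phi> (p * q) = \<phi> p * \<phi> q" for p q
    by (simp add: \<phi>_def hom)
  have \<phi>\<pi>: "\<phi> l = \<pi> l" if "l \<in> linear_forms" for l
    by (subst (1 2) linear_form_expansion[OF that], fold x_def)
      (simp add: sum \<pi> \<phi>x \<phi>1 \<phi>mult)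
  have congr: "\<phi> p - p \<in> ideal_generated L" for p
  proof -
    have x: "\<phi> (x v) - x v \<in> ideal_generated L" for v
      using diff[of "x v"] scalar.span_mono[OF B0(1)] scalar_span_subset_ideal by (auto simp: \<phi>x)
    have mult: "\<phi> (p * q) - p * q \<in> ideal_generated L"
      if "\<phi> p - p \<in> ideal_generated L" "\<phi> q - q \<in> ideal_generated L" for p q
    proof -
      have "\<phi> q * (\<phi> p - p) + p * (\<phi> q - q) \<in> ideal_generated L"
        using that unfolding ideal_generated_def by (intro ring.span_add ring.span_scale)
      then show ?thesis
        by (simp add: \<phi>_def hom algebra_simps)
    qed
    have zero_mem: "0 \<in> ideal_generated L"
      by (simp add: ideal_generated_def ring.span_zero)
    have one: "\<phi> 1 = 1" using \<phi>1[of 1] by simp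
    have pow: "\<phi> (x v ^ k) - x v ^ k \<in> ideal_generated L" for v k
      by (induction k) (auto intro: mult x simp: one zero_mem)
    have prod: "\<phi> (\<Prod>v\<in>A. x v ^ k v) - (\<Prod>v\<in>A. x v ^ k v) \<in> ideal_generated L" if "finite A" for A k
      using that by induction (auto intro: mult pow simp: one zero_mem)
    have mono: "single m c = single 0 c * (\<Prod>v\<in>UNIV. x v ^ lookup m v)" for m c
    proof -
      have 1: "x v ^ k = single (single v k) 1" for v k
        by (induction k) (auto simp: x_def mult_single simp flip: single_add)
      have "(\<Prod>v\<in>A. x v ^ lookup m v)
          = single (\<Sum>v\<in>A. single v (lookup m v)) 1" if "finite A" for A
        using that by induction (auto simp: 1 mult_single)
      moreover have "(\<Sum>v\<in>UNIV. single v (lookup m v)) = m"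
        by (rule poly_mapping_eqI) (simp add: lookup_sum lookup_single when_def sum.delta)
      ultimately show ?thesis by (simp add: mult_single)
    qed
    show ?thesis
    proof (induction p rule: monomial_induct)
      case (add m c q)
      have "\<phi> (single m c) - single m c \<in> ideal_generated L"
        unfolding mono[of m c] by (rule mult) (auto simp: \<phi>1 zero_mem intro!: prod)
      from ring.span_add[OF this[unfolded ideal_generated_def] add[unfolded ideal_generated_def]]
      show ?case by (simp add: \<phi>_def hom algebra_simps ideal_generated_def)
    qed (simp add: \<phi>_def ideal_generated_def ring.span_zero)
  qed
  have ker: "\<phi> p = 0" if "p \<in> ideal_generated L" for p
  proof (rule ring.span_induct[of p L])
    show "p \<in> ring.span L" using that by (simp add: ideal_generated_def)
    show "ring.subspace {p. \<phi> p = 0}" by (auto simp: ring.subspace_def \<phi>_def hom)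
  qed (use \<phi>\<pi> zero L in auto)
  show ?thesis
  proof (rule that)
    show "\<phi> p = 0 \<longleftrightarrow> p \<in> ideal_generated L" for p
      using ker congr[of p] ring.span_neg[of "- p" L] by (auto simp: ideal_generated_def)
    show "l \<in> scalar.span L" if "l \<in> linear_forms" "\<phi> l = 0" for l
      using diff[of l] scalar.span_mono[OF B0(1)] scalar.span_neg[of "- l" B0] that by (auto simp: \<phi>\<pi>)
  qed (simp add: \<phi>_def hom)
qed

lemma linear_ideal_prime:
  assumes "L \<subseteq> linear_forms" "p * q \<in> ideal_generated L"
  shows "p \<in> ideal_generated L \<or> q \<in> ideal_generated L"
  using linear_ideal_kernel[OF assms(1)] assms(2) mpol_no_zero_divisors by metis

lemma linear_ideal_prod:
  assumes "L \<subseteq> linear_forms" "finite A" "(\<Prod>i\<in>A. f i) \<in> ideal_generated L" "1 \<notin> ideal_generated L"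
  shows "\<exists>i\<in>A. f i \<in> ideal_generated L"
  using assms(2,3,4) by (induction) (auto dest: linear_ideal_prime[OF assms(1)])

lemma linear_form_in_ideal:
  assumes "L \<subseteq> linear_forms" "l \<in> linear_forms" "l \<in> ideal_generated L"
  shows "l \<in> scalar.span L"
  using linear_ideal_kernel[OF assms(1)] assms(2,3) by metis

lemma linear_ideal_const_coeff:
  assumes "L \<subseteq> linear_forms" "p \<in> ideal_generated L"
  shows "lookup p 0 = 0"
proof (rule ring.span_induct[of p L])
  show "p \<in> ring.span L" using assms by (simp add: ideal_generated_def)
qed (use assms in \<open>auto simp: ring.subspace_def lookup_add const_coeff_mult const_coeff_homogeneous\<close>)

section \<open>Linear quotients\<close>

text \<open>
  Discarding the generators that lie in the span of their predecessors changes none of the spans of initial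
  segments, so properties of \<open>h\<close> relative to everything before it in \<open>hs\<close> pass to the
  pruned sequence.
\<close>

lemma (in Modules.module) prune_generators:
  "\<exists>gs. span (set gs) = span (set hs) \<and>
    (\<forall>t<length gs. \<exists>s<length hs. gs ! t = hs ! s \<and>
        span (set (take t gs)) = span (set (take s hs)) \<and> hs ! s \<notin> span (set (take s hs)))"
proof (induction hs rule: rev_induct)
  case (snoc h hs)
  then obtain gs where gs: "span (set gs) = span (set hs)"
    "\<And>t. t < length gs \<Longrightarrow> \<exists>s<length hs. gs ! t = hs ! s \<and>
        span (set (take t gs)) = span (set (take s hs)) \<and> hs ! s \<notin> span (set (take s hs))"
    by blast
  have old: "\<exists>s<length (hs @ [h]). gs ! t = (hs @ [h]) ! s \<and>
      span (set (take t gs)) = span (set (take s (hs @ [h]))) \<and> (hs @ [h]) ! s \<notin> span (set (take s (hs @ [h])))"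
    if t: "t < length gs" for t
  proof -
    obtain s where "s < length hs" "gs ! t = hs ! s \<and>
        span (set (take t gs)) = span (set (take s hs)) \<and> hs ! s \<notin> span (set (take s hs))"
      using gs(2)[OF t] by blast
    then show ?thesis
      by (intro exI[of _ s]) (auto simp: nth_append)
  qed
  show ?case
  proof (cases "h \<in> span (set hs)")
    case True
    then have "span (insert h (set hs)) = span (set hs)"
      by (intro subset_antisym span_minimal span_mono) (auto intro: span_base)
    then have "span (set (hs @ [h])) = span (set gs)"
      using gs(1) by simp
    then show ?thesis
      using old by (intro exI[of _ gs]) auto
  next
    case False
    have "span (set (gs @ [h])) = span (set (hs @ [h]))"
      using gs(1) by (simp add: span_insert)
    moreover have "\<exists>s<length (hs @ [h]). (gs @ [h]) ! t = (hs @ [h]) ! s \<and>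
        span (set (take t (gs @ [h]))) = span (set (take s (hs @ [h]))) \<and>
        (hs @ [h]) ! s \<notin> span (set (take s (hs @ [h])))"
      if "t < length (gs @ [h])" for t
    proof (cases "t < length gs")
      case True
      then show ?thesis using old[OF True] by (simp add: nth_append)
    next
      case t: False
      then have "t = length gs" using that by simp
      then show ?thesis
        using gs(1) False by (intro exI[of _ "length hs"]) (simp add: nth_append)
    qed
    ultimately show ?thesis by blast
  qed
qed (auto intro: exI[of _ "[]"])

type_synonym ('n, 'k) mvec = "nat \<Rightarrow>\<^sub>0 ('n, 'k) mpol"

definition vectors :: "nat \<Rightarrow> (nat \<Rightarrow>\<^sub>0 'r::comm_ring_1) set" where
  "vectors r = {u. keys u \<subseteq> {..<r}}"

lemma vectors_iff: "u \<in> vectors r \<longleftrightarrow> (\<forall>k\<ge>r. lookup u k = 0)"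
  unfolding vectors_def mem_Collect_eq subset_iff in_keys_iff lessThan_iff by (meson not_le)

lemma subspace_vectors: "vec.subspace (vectors r)"
  by (auto simp: vec.subspace_def vectors_iff lookup_add lookup_free_scale)

lemma vectors_expansion:
  assumes "u \<in> vectors r"
  shows "u = (\<Sum>k<r. free_scale (lookup u k) (single k 1))"
proof (rule poly_mapping_eqI)
  fix i
  have "lookup (\<Sum>k<r. free_scale (lookup u k) (single k 1)) i
      = (\<Sum>k<r. if k = i then lookup u k else 0)"
    unfolding lookup_sum lookup_free_scale by (intro sum.cong) (auto simp: lookup_single when_def)
  then show "lookup u i
      = lookup (\<Sum>k<r. free_scale (lookup u k) (single k 1)) i"
    using assms by (auto simp: vectors_iff sum.delta not_less)
qed

definition combination :: "(nat \<Rightarrow>\<^sub>0 'r::comm_ring_1) list \<Rightarrow> (nat \<Rightarrow>\<^sub>0 'r) \<Rightarrow> (nat \<Rightarrow>\<^sub>0 'r)" where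
  "combination hs u = (\<Sum>k<length hs. free_scale (lookup u k) (hs ! k))"

definition syzygies :: "(nat \<Rightarrow>\<^sub>0 'r::comm_ring_1) list \<Rightarrow> (nat \<Rightarrow>\<^sub>0 'r) set" where
  "syzygies hs = {u \<in> vectors (length hs). combination hs u = 0}"

lemma combination_Nil [simp]: "combination [] u = 0"
  by (simp add: combination_def)

lemma combination_snoc:
  "combination (hs @ [g]) u = combination hs u + free_scale (lookup u (length hs)) g"
  by (simp add: combination_def nth_append)

lemma module_hom_combination: "module_hom free_scale free_scale (combination hs)"
  by (intro module_hom.intro module_hom_axioms.intro module_free_scale)
    (simp_all add: combination_def lookup_add lookup_free_scale vec.scale_left_distrib sum.distrib
      vec.scale_sum_right)

lemmas combination_add = module_hom.add[OF module_hom_combination]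
  and combination_scale = module_hom.scale[OF module_hom_combination]
  and combination_zero [simp] = module_hom.zero[OF module_hom_combination]
  and combination_diff = module_hom.diff[OF module_hom_combination]
  and combination_sum = module_hom.sum[OF module_hom_combination]

lemma combination_single:
  "combination hs (single k c) = (if k < length hs then free_scale c (hs ! k) else 0)"
proof -
  have "combination hs (single k c) = (\<Sum>i<length hs. if i = k then free_scale c (hs ! k) else 0)"
    unfolding combination_def by (intro sum.cong) (auto simp: lookup_single when_def)
  then show ?thesis by (simp add: sum.delta)
qed

lemma combination_mem:
  assumes "vec.subspace S" "set hs \<subseteq> S"
  shows "combination hs u \<in> S"
  unfolding combination_def using assms
  by (intro vec.subspace_sum vec.subspace_scale) (auto simp: subset_iff)

lemma subspace_syzygies: "vec.subspace (syzygies hs)"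
proof -
  have "syzygies hs = vectors (length hs) \<inter> {u. combination hs u = 0}"
    by (auto simp: syzygies_def)
  then show ?thesis
    using vec.subspace_inter[OF subspace_vectors module_hom.subspace_kernel[OF module_hom_combination]]
    by simp
qed

lemma span_set_eq_combinations: "vec.span (set hs) = combination hs ` vectors (length hs)"
proof
  have sub: "vec.subspace (combination hs ` vectors (length hs))"
    by (rule module_hom.subspace_image[OF module_hom_combination subspace_vectors])
  have "h \<in> combination hs ` vectors (length hs)" if h: "h \<in> set hs" for h
  proof -
    obtain k where "k < length hs" "h = hs ! k" using h by (metis in_set_conv_nth)
    then show ?thesis
      by (intro image_eqI[of _ _ "single k 1"])
        (auto simp: combination_single vectors_iff lookup_single when_def)
  qed
  then show "vec.span (set hs) \<subseteq> combination hs ` vectors (length hs)"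
    using sub by (intro vec.span_minimal) auto
  show "combination hs ` vectors (length hs) \<subseteq> vec.span (set hs)"
    using combination_mem[OF vec.subspace_span vec.span_superset] by auto
qed

definition homogeneous_vectors :: "int \<Rightarrow> ('n::finite, 'k::field) mvec set" where
  "homogeneous_vectors j = {u. \<forall>k. lookup u k \<in> homogeneous_part j}"

definition vector_component :: "int \<Rightarrow> ('n::finite, 'k::field) mvec \<Rightarrow> ('n, 'k) mvec" where
  "vector_component j = Poly_Mapping.map (homogeneous_component j)"

lemma lookup_vector_component:
  "lookup (vector_component j u) k = homogeneous_component j (lookup u k)"
  by (auto simp: vector_component_def Poly_Mapping.map.rep_eq when_def)

lemma vector_component_simps [simp]:
  "vector_component j 0 = 0"
  "vector_component j (u + v) = vector_component j u + vector_component j v"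
  "vector_component j u \<in> homogeneous_vectors j"
  by (auto intro!: poly_mapping_eqI simp: lookup_vector_component lookup_add homogeneous_vectors_def)

lemma vector_component_sum:
  "vector_component j (sum f A) = (\<Sum>i\<in>A. vector_component j (f i))"
  by (induction A rule: infinite_finite_induct) auto

lemma vector_component_id: "u \<in> homogeneous_vectors j \<Longrightarrow> vector_component j u = u"
  by (rule poly_mapping_eqI)
    (auto simp: lookup_vector_component homogeneous_vectors_def homogeneous_component_id[of _ j])

lemma vector_component_vectors: "u \<in> vectors r \<Longrightarrow> vector_component j u \<in> vectors r"
  by (simp add: vectors_iff lookup_vector_component)

lemma vector_component_combination:
  assumes "set hs \<subseteq> homogeneous_vectors e"
  shows "vector_component j (combination hs u) = combination hs (vector_component (j - e) u)"
proof -
  have *: "vector_component j (free_scale p h) = free_scale (homogeneous_component (j - e) p) h"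
    if "h \<in> homogeneous_vectors e" for p h
    using that by - (rule poly_mapping_eqI,
      simp add: lookup_vector_component lookup_free_scale homogeneous_vectors_def homogeneous_component_mult)
  then show ?thesis
    unfolding combination_def vector_component_sum lookup_vector_component
  proof (intro sum.cong refl)
    fix i assume "i \<in> {..<length hs}"
    then have "hs ! i \<in> homogeneous_vectors e" using assms by (meson lessThan_iff nth_mem subsetD)
    then show "vector_component j (free_scale (lookup u i) (hs ! i))
        = free_scale (homogeneous_component (j - e) (lookup u i)) (hs ! i)"
      by (rule *)
  qed
qed

lemma combination_homogeneous:
  assumes "set hs \<subseteq> homogeneous_vectors e" "u \<in> homogeneous_vectors j"
  shows "combination hs u \<in> homogeneous_vectors (j + e)"
proof -
  have "combination hs u = vector_component (j + e) (combination hs u)"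
    using vector_component_combination[OF assms(1), of "j + e" u] vector_component_id[OF assms(2)] by simp
  then show ?thesis by (metis vector_component_simps(3))
qed

lemma homogeneous_coordinates:
  assumes "set hs \<subseteq> homogeneous_vectors e" "v \<in> vec.span (set hs)" "v \<in> homogeneous_vectors j"
  shows "\<exists>u. u \<in> vectors (length hs) \<and> u \<in> homogeneous_vectors (j - e) \<and> combination hs u = v"
proof -
  obtain u where u: "u \<in> vectors (length hs)" "combination hs u = v"
    using assms(2) unfolding span_set_eq_combinations by auto
  have "combination hs (vector_component (j - e) u) = v"
    using vector_component_combination[OF assms(1), of j u] vector_component_id[OF assms(3)] u(2) by simp
  then show ?thesis
    using vector_component_vectors[OF u(1)] vector_component_simps(3) by blast
qed

lemma homogeneous_vectors_closed:
  "u \<in> homogeneous_vectors j \<Longrightarrow> v \<in> homogeneous_vectors j \<Longrightarrow> u - v \<in> homogeneous_vectors j"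
  "p \<in> homogeneous_part j \<Longrightarrow> single k p \<in> homogeneous_vectors j"
  by (auto simp: homogeneous_vectors_def lookup_minus lookup_single when_def)

text \<open>
  This is \<open>span S :\<^sub>R h\<close>, the annihilator of \<open>h\<close> modulo the submodule generated by \<open>S\<close>.
\<close>

definition colon :: "('n::finite, 'k::field) mvec set \<Rightarrow> ('n, 'k) mvec \<Rightarrow> ('n, 'k) mpol set" where
  "colon S h = {c. free_scale c h \<in> vec.span S}"

definition linear_ideal :: "('n::finite, 'k::field) mpol set \<Rightarrow> bool" where
  "linear_ideal J \<longleftrightarrow> (\<exists>L. finite L \<and> L \<subseteq> linear_forms \<and> J = ideal_generated L)"

definition linear_quotients :: "('n::finite, 'k::field) mvec list \<Rightarrow> bool" where
  "linear_quotients hs \<longleftrightarrow> (\<forall>t<length hs. linear_ideal (colon (set (take t hs)) (hs ! t)))"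

lemma linear_quotients_Nil [simp]: "linear_quotients []"
  by (simp add: linear_quotients_def)

lemma linear_quotients_snoc:
  "linear_quotients (hs @ [g]) \<longleftrightarrow> linear_quotients hs \<and> linear_ideal (colon (set hs) g)"
  by (auto simp: linear_quotients_def nth_append less_Suc_eq)

lemma subspace_colon: "ring.subspace (colon S h)"
  unfolding ring.subspace_def colon_def
  by (auto simp: vec.scale_left_distrib vec.span_zero vec.span_add vec.span_scale simp flip: vec.scale_scale)

text \<open>
  Append a vector \<open>g\<close> with colon ideal \<open>(l\<^sub>1, \<dots>, l\<^sub>q)\<close>, the \<open>l\<^sub>k\<close> being linearly independent. Besides the old
  syzygies there is one new linear syzygy for each \<open>l\<^sub>k\<close>, with last coordinate \<open>l\<^sub>k\<close>. If a multiple \<open>c\<close> of the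
  \<open>k\<close>-th one depends on the previous ones, the last coordinate says \<open>c l\<^sub>k \<in> (l\<^sub>1, \<dots>, l\<^bsub>k-1\<^esub>)\<close>, whence
  \<open>c \<in> (l\<^sub>1, \<dots>, l\<^bsub>k-1\<^esub>)\<close> by primality; conversely \<open>l\<^sub>1, \<dots>, l\<^bsub>k-1\<^esub>\<close> are in the colon ideal by the Koszul relations.
\<close>

theorem syzygies_linear_quotients:
  fixes hs :: "('n::finite, 'k::field) mvec list"
  assumes "linear_quotients hs" "set hs \<subseteq> homogeneous_vectors e"
  shows "\<exists>gs. set gs \<subseteq> homogeneous_vectors 1 \<and> vec.span (set gs) = syzygies hs \<and> linear_quotients gs"
  using assms
proof (induction hs rule: rev_induct)
  case Nil
  have "syzygies [] = {0 :: ('n, 'k) mvec}"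
    by (auto simp: syzygies_def vectors_iff intro: poly_mapping_eqI)
  then show ?case
    by (intro exI[of _ "[]"]) simp
next
  case (snoc g hs)
  let ?s = "length hs"
  let ?Z = "syzygies (hs @ [g])"
  have "linear_quotients hs" "linear_ideal (colon (set hs) g)"
    and hom: "set hs \<subseteq> homogeneous_vectors e" "g \<in> homogeneous_vectors e"
    using snoc.prems by (auto simp: linear_quotients_snoc)
  then obtain gs L where gs: "set gs \<subseteq> homogeneous_vectors 1" "vec.span (set gs) = syzygies hs" "linear_quotients gs"
    and L: "finite L" "L \<subseteq> linear_forms" "colon (set hs) g = ideal_generated L"
    using snoc.IH by (auto simp: linear_ideal_def)
  obtain ls0 where ls0: "set ls0 = L" using L(1) finite_list by blast
  obtain ls where ls: "ring.span (set ls) = ring.span (set ls0)"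
    "\<forall>t<length ls. \<exists>s<length ls0. ls ! t = ls0 ! s \<and>
        ring.span (set (take t ls)) = ring.span (set (take s ls0)) \<and> ls0 ! s \<notin> ring.span (set (take s ls0))"
    using ring.prune_generators[of ls0] by iprover
  have ls_L: "ls ! t \<in> L" "ls ! t \<notin> ideal_generated (set (take t ls))" if t: "t < length ls" for t
  proof -
    obtain s where "s < length ls0" "ls ! t = ls0 ! s"
      "ring.span (set (take t ls)) = ring.span (set (take s ls0))" "ls0 ! s \<notin> ring.span (set (take s ls0))"
      using ls(2) t by iprover
    then show "ls ! t \<in> L" "ls ! t \<notin> ideal_generated (set (take t ls))"
      using ls0 by (auto simp: ideal_generated_def)
  qed
  have ls_lin: "set ls \<subseteq> linear_forms"
  proof
    fix x assume "x \<in> set ls"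
    then obtain t where "t < length ls" "x = ls ! t" by (metis in_set_conv_nth)
    then show "x \<in> linear_forms" using ls_L(1) L(2) by blast
  qed
  have ls_colon: "colon (set hs) g = ideal_generated (set ls)"
    using ls(1) ls0 L(3) by (simp add: ideal_generated_def)
  \<comment> \<open>Every generator of the colon ideal lifts to a linear syzygy.\<close>
  have "\<exists>u. u \<in> ?Z \<and> u \<in> homogeneous_vectors 1 \<and> lookup u ?s = l" if "l \<in> set ls" for l
  proof -
    have "l \<in> colon (set hs) g"
      using that by (simp add: ls_colon ideal_generated_def ring.span_base)
    then obtain u where u: "u \<in> vectors ?s" "combination hs u = free_scale l g"
      by (auto simp: colon_def span_set_eq_combinations)
    let ?u = "vector_component 1 u"
    have l: "l \<in> linear_forms" using that ls_lin by auto
    then have "free_scale l g \<in> homogeneous_vectors (1 + e)"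
      using hom(2) by (auto simp: homogeneous_vectors_def lookup_free_scale)
    then have "combination hs ?u = free_scale l g"
      using vector_component_combination[OF hom(1), of "1 + e" u] u(2) by (simp add: vector_component_id)
    moreover have "?u \<in> vectors ?s"
      using u(1) by (rule vector_component_vectors)
    ultimately have "single ?s l - ?u \<in> ?Z"
      "lookup (single ?s l - ?u) ?s = l"
      unfolding syzygies_def vectors_iff combination_snoc mem_Collect_eq
      by (auto simp: combination_diff combination_single lookup_minus lookup_single when_def)
    moreover have "single ?s l - ?u \<in> homogeneous_vectors 1"
      using l by (intro homogeneous_vectors_closed) auto
    ultimately show ?thesis by blast
  qed
  then obtain lift where lift: "\<And>l. l \<in> set ls \<Longrightarrow> lift l \<in> ?Z"
    "\<And>l. l \<in> set ls \<Longrightarrow> lift l \<in> homogeneous_vectors 1"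
    "\<And>l. l \<in> set ls \<Longrightarrow> lookup (lift l) ?s = l"
    by metis
  have syz_last: "u \<in> syzygies hs \<longleftrightarrow> u \<in> ?Z \<and> lookup u ?s = 0" for u
    unfolding syzygies_def vectors_iff combination_snoc mem_Collect_eq length_append_singleton
    by (auto simp: Suc_le_eq) (metis le_neq_implies_less)
  have syz_mono: "syzygies hs \<subseteq> ?Z"
    using syz_last by blast
  have last_coord: "lookup v ?s \<in> ideal_generated A"
    if "v \<in> vec.span (set gs \<union> lift ` A)" "A \<subseteq> set ls" for v A
  proof (rule vec.span_induct[OF that(1)])
    show "vec.subspace {v. lookup v ?s \<in> ideal_generated A}"
      by (auto simp: vec.subspace_def ideal_generated_def lookup_add lookup_free_scale
          ring.span_zero ring.span_add ring.span_scale)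
    fix x assume "x \<in> set gs \<union> lift ` A"
    then show "lookup x ?s \<in> ideal_generated A"
    proof
      assume "x \<in> set gs"
      then have "x \<in> syzygies hs" using gs(2) vec.span_superset by blast
      then show ?thesis using syz_last by (simp add: ideal_generated_def ring.span_zero)
    next
      assume "x \<in> lift ` A"
      then obtain l where l: "l \<in> A" "x = lift l" by blast
      then have "l \<in> set ls" using that(2) by blast
      then show ?thesis
        using l by (simp add: lift(3) ideal_generated_def ring.span_base)
    qed
  qed
  have "\<exists>w. w \<in> vec.span (lift ` set ls) \<and> lookup w ?s = c" if "c \<in> ideal_generated (set ls)" for c
  proof (rule ring.span_induct[of c "set ls"])
    show "c \<in> ring.span (set ls)" using that by (simp add: ideal_generated_def)
    have "{c. \<exists>w. w \<in> vec.span (lift ` set ls) \<and> lookup w ?s = c}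
        = (\<lambda>w. lookup w ?s) ` vec.span (lift ` set ls)" by auto
    moreover have coord: "module_hom free_scale (*) (\<lambda>w :: ('n, 'k) mvec. lookup w ?s)"
      by (intro module_hom.intro module_hom_axioms.intro module_free_scale module_mult)
        (simp_all add: lookup_add lookup_free_scale)
    ultimately show "ring.subspace {c. \<exists>w. w \<in> vec.span (lift ` set ls) \<and> lookup w ?s = c}"
      using module_hom.subspace_image[OF coord vec.subspace_span[of "lift ` set ls"]] by simp
    show "\<exists>w. w \<in> vec.span (lift ` set ls) \<and> lookup w ?s = x" if "x \<in> set ls" for x
      using lift(3)[OF that] that by (auto intro!: exI[of _ "lift x"] vec.span_base)
  qed
  then have last_lift: "\<exists>w. w \<in> vec.span (lift ` set ls) \<and> lookup w ?s = c" if "c \<in> ideal_generated (set ls)" for c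
    using that by blast
  have gs_le: "syzygies hs \<subseteq> vec.span (set gs \<union> X)" for X
    using gs(2) vec.span_mono[of "set gs" "set gs \<union> X"] by auto
  have "vec.span (set gs \<union> lift ` set ls) = ?Z"
  proof
    show "vec.span (set gs \<union> lift ` set ls) \<subseteq> ?Z"
      using gs(2) syz_mono lift(1) vec.span_superset
      by (intro vec.span_minimal subspace_syzygies) blast
    show "?Z \<subseteq> vec.span (set gs \<union> lift ` set ls)"
    proof
      fix u assume u: "u \<in> ?Z"
      let ?c = "lookup u ?s"
      let ?u = "u - single ?s ?c"
      have "?u \<in> vectors ?s"
        using u unfolding syzygies_def vectors_iff
        by (auto simp: lookup_minus lookup_single when_def Suc_le_eq)
      moreover have "combination hs ?u = free_scale (- ?c) g"
        using u by (simp add: syzygies_def combination_snoc combination_diff combination_single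
            eq_neg_iff_add_eq_0)
      ultimately have "- ?c \<in> colon (set hs) g"
        unfolding colon_def span_set_eq_combinations mem_Collect_eq by (metis image_eqI)
      then have "?c \<in> ideal_generated (set ls)"
        using ls_colon ring.span_neg[of "- ?c"] by (simp add: ideal_generated_def)
      then obtain w where w: "w \<in> vec.span (lift ` set ls)" "lookup w ?s = ?c"
        using last_lift by blast
      have "w \<in> ?Z"
        using w(1) lift(1) vec.span_minimal[OF _ subspace_syzygies, of "lift ` set ls" "hs @ [g]"] by auto
      then have "u - w \<in> ?Z"
        using u vec.subspace_diff[OF subspace_syzygies] by blast
      then have "u - w \<in> syzygies hs"
        using w(2) by (simp add: syz_last lookup_minus)
      then have "u - w \<in> vec.span (set gs \<union> lift ` set ls)"
        using gs_le by blast
      moreover have "w \<in> vec.span (set gs \<union> lift ` set ls)"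
        using w(1) vec.span_mono[of "lift ` set ls" "set gs \<union> lift ` set ls"] by auto
      ultimately show "u \<in> vec.span (set gs \<union> lift ` set ls)"
        using vec.span_add[of "u - w" _ w] by simp
    qed
  qed
  moreover have "linear_quotients (gs @ map lift (take k ls))" if "k \<le> length ls" for k
    using that
  proof (induction k)
    case (Suc k)
    let ?A = "set (take k ls)" and ?l = "ls ! k"
    have k: "k < length ls" using Suc.prems by simp
    have A: "?A \<subseteq> set ls" "?A \<subseteq> linear_forms" using ls_lin by (auto dest: in_set_takeD)
    have l: "?l \<in> set ls" using k by simp
    have "colon (set gs \<union> lift ` ?A) (lift ?l) = ideal_generated ?A"
    proof
      show "colon (set gs \<union> lift ` ?A) (lift ?l) \<subseteq> ideal_generated ?A"
      proof
        fix c assume "c \<in> colon (set gs \<union> lift ` ?A) (lift ?l)"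
        then have "lookup (free_scale c (lift ?l)) ?s \<in> ideal_generated ?A"
          using last_coord A(1) by (auto simp: colon_def)
        then have "c * ?l \<in> ideal_generated ?A"
          by (simp add: lookup_free_scale lift(3)[OF l])
        then show "c \<in> ideal_generated ?A"
          using linear_ideal_prime[OF A(2)] ls_L(2)[OF k] by blast
      qed
      have "a \<in> colon (set gs \<union> lift ` ?A) (lift ?l)" if a: "a \<in> ?A" for a
      proof -
        \<comment> \<open>The Koszul relation between two lifts involves only the earlier generators.\<close>
        let ?u = "free_scale a (lift ?l) - free_scale ?l (lift a)"
        have a': "a \<in> set ls" using a A(1) by auto
        have "?u \<in> ?Z"
          using lift(1)[OF l] lift(1)[OF a'] vec.subspace_diff[OF subspace_syzygies]
            vec.subspace_scale[OF subspace_syzygies] by blast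
        then have "?u \<in> syzygies hs"
          by (simp add: syz_last lookup_minus lookup_free_scale lift(3)[OF l] lift(3)[OF a'] mult.commute)
        then have "?u \<in> vec.span (set gs \<union> lift ` ?A)"
          using gs_le by blast
        moreover have "free_scale ?l (lift a) \<in> vec.span (set gs \<union> lift ` ?A)"
          using a by (intro vec.span_scale vec.span_base) auto
        ultimately have "free_scale a (lift ?l) \<in> vec.span (set gs \<union> lift ` ?A)"
          using vec.span_add[of ?u _ "free_scale ?l (lift a)"] by simp
        then show ?thesis by (simp add: colon_def)
      qed
      then show "ideal_generated ?A \<subseteq> colon (set gs \<union> lift ` ?A) (lift ?l)"
        unfolding ideal_generated_def by (intro ring.span_minimal subspace_colon) auto
    qed
    then have "linear_ideal (colon (set (gs @ map lift (take k ls))) (lift ?l))"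
      using A(2) by (auto simp: linear_ideal_def)
    then have "linear_quotients ((gs @ map lift (take k ls)) @ [lift ?l])"
      using Suc by (simp only: linear_quotients_snoc)
    then show ?case
      using k by (simp add: take_Suc_conv_app_nth)
  qed (use gs(3) in simp)
  from this[of "length ls"] have "linear_quotients (gs @ map lift ls)" by simp
  ultimately show ?case
    using gs(1) lift(2) by (intro exI[of _ "gs @ map lift ls"]) auto
qed

section \<open>Generic vectors\<close>

lemma (in vector_space) avoid_subspaces:
  assumes "infinite (UNIV :: 'a set)" "finite \<U>" "subspace V"
    and "\<And>U. U \<in> \<U> \<Longrightarrow> subspace U \<and> \<not> V \<subseteq> U"
  shows "\<exists>x\<in>V. \<forall>U\<in>\<U>. x \<notin> U"
  using assms(2,4)
proof (induction \<U>)
  case empty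
  then show ?case using subspace_0[OF assms(3)] by auto
next
  case (insert U0 \<U>)
  then obtain x where x: "x \<in> V" "\<And>U. U \<in> \<U> \<Longrightarrow> x \<notin> U" by blast
  show ?case
  proof (cases "x \<in> U0")
    case False
    then show ?thesis using x by auto
  next
    case True
    obtain y where y: "y \<in> V" "y \<notin> U0" using insert.prems by blast
    \<comment> \<open>A line in direction \<open>x\<close> meets each of the old subspaces at most once and misses the new one.\<close>
    have one: "c = c'" if "U \<in> \<U>" "scale c x + y \<in> U" "scale c' x + y \<in> U" for U c c'
    proof (rule ccontr)
      assume "c \<noteq> c'"
      have U: "subspace U" using that(1) insert.prems by blast
      have "scale (c - c') x \<in> U"
        using subspace_diff[OF U that(2,3)] by (simp add: scale_left_diff_distrib)
      then have "scale (inverse (c - c')) (scale (c - c') x) \<in> U"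
        by (rule subspace_scale[OF U])
      then show False
        using \<open>c \<noteq> c'\<close> x(2)[OF that(1)] by simp
    qed
    have "finite {c. scale c x + y \<in> U}" if "U \<in> \<U>" for U
    proof (cases "{c. scale c x + y \<in> U} = {}")
      case False
      then obtain c where "scale c x + y \<in> U" by blast
      then have "{c. scale c x + y \<in> U} \<subseteq> {c}"
        using one[OF that] by blast
      then show ?thesis by (rule finite_subset) simp
    next
      case True
      then show ?thesis by (simp only: finite.emptyI)
    qed
    then have "finite (\<Union>U\<in>\<U>. {c. scale c x + y \<in> U})"
      using insert.hyps(1) by blast
    then obtain c where c: "c \<notin> (\<Union>U\<in>\<U>. {c. scale c x + y \<in> U})"
      using assms(1) ex_new_if_finite by blast
    have U0: "subspace U0" using insert.prems by blast
    have "scale c x + y \<notin> U0"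
    proof
      assume "scale c x + y \<in> U0"
      then have "(scale c x + y) - scale c x \<in> U0"
        using subspace_diff[OF U0] subspace_scale[OF U0 True] by blast
      then show False using y(2) by simp
    qed
    moreover have "scale c x + y \<in> V"
      using x(1) y(1) assms(3) by (simp add: subspace_add subspace_scale)
    ultimately show ?thesis using c by blast
  qed
qed

text \<open>
  The \<open>k\<close>-th vector of the sequence \<open>g\<close>, to be chosen in the space \<open>V (cl k)\<close>, avoids every proper condition that
  can be formulated with the vectors before it and with the whole spaces \<open>V i\<close>. The spaces \<open>V i\<close> stand in for the
  vectors that are chosen later, which makes a choice one after the other possible.
\<close>

definition (in vector_space) generic :: "'i set \<Rightarrow> ('i \<Rightarrow> 'b set) \<Rightarrow> (nat \<Rightarrow> 'i) \<Rightarrow> (nat \<Rightarrow> 'b) \<Rightarrow> nat \<Rightarrow> 'b \<Rightarrow> bool" where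
  "generic I V cl g k x \<longleftrightarrow> x \<in> V (cl k) \<and>
     (\<forall>T B. T \<subseteq> {..<k} \<and> B \<subseteq> I \<and> x \<in> span (g ` T \<union> \<Union>(V ` B)) \<longrightarrow> V (cl k) \<subseteq> span (g ` T \<union> \<Union>(V ` B)))"

lemma (in vector_space) genericD:
  assumes "generic I V cl g k x"
  shows "x \<in> V (cl k)"
    and "T \<subseteq> {..<k} \<Longrightarrow> B \<subseteq> I \<Longrightarrow> x \<in> span (g ` T \<union> \<Union>(V ` B)) \<Longrightarrow> V (cl k) \<subseteq> span (g ` T \<union> \<Union>(V ` B))"
  using assms unfolding generic_def by iprover+

lemma (in vector_space) exists_generic_sequence:
  assumes "infinite (UNIV :: 'a set)" "finite I"
    and "\<And>k. cl k \<in> I" "\<And>i. i \<in> I \<Longrightarrow> subspace (V i)"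
  shows "\<exists>g. \<forall>k. generic I V cl g k (g k)"
proof (rule dependent_wellorder_choice)
  fix r and f g :: "nat \<Rightarrow> 'b" and k :: nat
  assume "\<And>y. y < k \<Longrightarrow> f y = g y"
  then have "f ` T = g ` T" if "T \<subseteq> {..<k}" for T
    using that by (intro image_cong) auto
  then show "generic I V cl f k r = generic I V cl g k r"
    unfolding generic_def by (metis (no_types, lifting))
next
  fix k and f :: "nat \<Rightarrow> 'b"
  let ?U = "\<lambda>(T, B). span (f ` T \<union> \<Union>(V ` B))"
  let ?\<U> = "{U \<in> ?U ` (Pow {..<k} \<times> Pow I). \<not> V (cl k) \<subseteq> U}"
  have "\<exists>x\<in>V (cl k). \<forall>U\<in>?\<U>. x \<notin> U"
  proof (rule avoid_subspaces)
    show "finite ?\<U>" using assms(2) by simp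
  qed (use assms in auto)
  then obtain x where x: "x \<in> V (cl k)" "\<forall>U\<in>?\<U>. x \<notin> U" by (rule bexE)
  have "generic I V cl f k x"
    unfolding generic_def
  proof (intro conjI allI impI x(1); elim conjE)
    fix T B assume TB: "T \<subseteq> {..<k}" "B \<subseteq> I" "x \<in> span (f ` T \<union> \<Union>(V ` B))"
    show "V (cl k) \<subseteq> span (f ` T \<union> \<Union>(V ` B))"
    proof (rule ccontr)
      assume "\<not> V (cl k) \<subseteq> span (f ` T \<union> \<Union>(V ` B))"
      moreover have "?U (T, B) \<in> ?U ` (Pow {..<k} \<times> Pow I)"
        using TB by (intro imageI) auto
      ultimately have "?U (T, B) \<in> ?\<U>" by simp
      with x(2) have "x \<notin> ?U (T, B)" by (rule bspec)
      then show False using TB(3) by simp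
    qed
  qed
  then show "\<exists>r. generic I V cl f k r" ..
qed

text \<open>
  Genericity with respect to earlier vectors implies genericity with respect to all others. If \<open>g k\<close> depends
  on a set with latest member \<open>g t\<close>, \<open>t > k\<close>, then the exchange lemma makes \<open>g t\<close> depend on \<open>g k\<close> and the remaining,
  earlier vectors; as \<open>g t\<close> is generic, the whole of \<open>V (cl t)\<close> does so, and \<open>g t\<close> can be
  replaced by the space \<open>V (cl t)\<close>. This shortens the list of vectors.
\<close>

lemma (in vector_space) generic_span:
  assumes "\<And>k. generic I V cl g k (g k)" "\<And>k. cl k \<in> I"
    and "finite T" "B \<subseteq> I" "k \<notin> T" "g k \<in> span (g ` T \<union> \<Union>(V ` B))"
  shows "V (cl k) \<subseteq> span (g ` T \<union> \<Union>(V ` B))"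
  using assms(3-)
proof (induction "card T" arbitrary: T B rule: less_induct)
  case less
  show ?case
  proof (cases "T \<subseteq> {..<k}")
    case True
    show ?thesis
      by (rule genericD(2)[OF assms(1) True less.prems(2,4)])
  next
    case False
    define t where "t = Max T"
    have t: "t \<in> T" "k < t"
    proof -
      obtain t' where "t' \<in> T" "\<not> t' < k" using False by auto
      moreover have "t' \<noteq> k" using \<open>t' \<in> T\<close> less.prems(3) by blast
      moreover have "t' \<le> t" unfolding t_def using less.prems(1) \<open>t' \<in> T\<close> by (rule Max_ge)
      ultimately show "k < t" by linarith
      show "t \<in> T" unfolding t_def using less.prems(1) \<open>t' \<in> T\<close> by (intro Max_in) auto
    qed
    define T' where "T' = T - {t}"
    have T: "T = insert t T'" "t \<notin> T'" "finite T'" "card T' < card T" "k \<notin> T'"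
      using t less.prems by (auto simp: T'_def card_Diff1_less simp del: card_Diff_insert)
    have T'_less: "insert k T' \<subseteq> {..<t}"
    proof -
      have "y < t" if "y \<in> T'" for y
        using that Max_ge[OF less.prems(1), of y] by (auto simp: T'_def t_def less_le)
      then show ?thesis using t(2) by auto
    qed
    let ?S = "g ` T' \<union> \<Union>(V ` B)"
    have S: "g ` T \<union> \<Union>(V ` B) = insert (g t) ?S" by (simp add: T(1))
    show ?thesis
    proof (cases "g k \<in> span ?S")
      case True
      then have "V (cl k) \<subseteq> span ?S"
        using less.hyps[OF T(4,3) less.prems(2) T(5)] by blast
      then show ?thesis
        unfolding S using span_mono[of ?S "insert (g t) ?S"] by blast
    next
      case False
      then have "g t \<in> span (insert (g k) ?S)"
        using in_span_insert[OF less.prems(4)[unfolded S] False] by simp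
      moreover have S': "insert (g k) ?S = g ` insert k T' \<union> \<Union>(V ` B)" by simp
      ultimately have "g t \<in> span (g ` insert k T' \<union> \<Union>(V ` B))" by (simp only:)
      then have "V (cl t) \<subseteq> span (insert (g k) ?S)"
        unfolding S' by (rule genericD(2)[OF assms(1) T'_less less.prems(2)])
      also have "\<dots> \<subseteq> span (insert (g t) ?S)"
      proof (intro span_minimal subspace_span insert_subsetI)
        show "g k \<in> span (insert (g t) ?S)" using less.prems(4) unfolding S .
        show "?S \<subseteq> span (insert (g t) ?S)" using span_superset[of "insert (g t) ?S"] by auto
      qed
      finally have Vt: "V (cl t) \<subseteq> span (insert (g t) ?S)" .
      let ?B = "insert (cl t) B"
      have gt: "g t \<in> V (cl t)" by (rule genericD(1)[OF assms(1)])
      have "insert (g t) ?S \<subseteq> g ` T' \<union> \<Union>(V ` ?B)" using gt by auto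
      then have "g k \<in> span (g ` T' \<union> \<Union>(V ` ?B))"
        using subsetD[OF span_mono less.prems(4)[unfolded S]] by blast
      then have "V (cl k) \<subseteq> span (g ` T' \<union> \<Union>(V ` ?B))"
        using less.prems(2) assms(2) by (intro less.hyps[OF T(4,3) _ T(5)]) auto
      also have "\<dots> \<subseteq> span (insert (g t) ?S)"
      proof (intro span_minimal subspace_span Un_least)
        show "g ` T' \<subseteq> span (insert (g t) ?S)" "\<Union>(V ` ?B) \<subseteq> span (insert (g t) ?S)"
          using Vt span_superset[of "insert (g t) ?S"] by auto
      qed
      finally show ?thesis unfolding S .
    qed
  qed
qed

text \<open>
  For a minimal \<open>T0\<close> with \<open>g k\<close> in its span, \<open>T0\<close> and \<open>k\<close> form a circuit: each of the vectors depends on the others,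
  so genericity applies to all of them.
\<close>

lemma (in vector_space) generic_circuit:
  assumes "\<And>k. generic I V cl g k (g k)" "\<And>k. cl k \<in> I"
    and "finite T" "k \<notin> T" "g k \<in> span (g ` T)"
  shows "\<exists>T0\<subseteq>T. \<forall>t\<in>insert k T0. V (cl t) \<subseteq> span (g ` T0)"
proof -
  define P where "P T0 \<longleftrightarrow> T0 \<subseteq> T \<and> g k \<in> span (g ` T0)" for T0
  have "P T" using assms(5) by (simp add: P_def)
  then obtain T0 where T0: "P T0" "\<And>T1. P T1 \<Longrightarrow> card T0 \<le> card T1"
    using arg_min_natI[of P _ card] arg_min_nat_le[of P _ card] by metis
  then have fin: "finite T0" and sub: "T0 \<subseteq> T"
    using assms(3) finite_subset by (auto simp: P_def)
  have k: "k \<notin> T0" using sub assms(4) by blast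
  note span' = generic_span[of I V cl g, where B = "{}", OF assms(1,2), simplified]
  have "V (cl t) \<subseteq> span (g ` T0)" if t: "t \<in> T0" for t
  proof -
    let ?T1 = "T0 - {t}"
    have "card ?T1 < card T0" using fin t by (rule card_Diff1_less)
    then have "g k \<notin> span (g ` ?T1)"
      using T0(2)[of ?T1] sub by (auto simp: P_def)
    moreover have "g k \<in> span (insert (g t) (g ` ?T1))"
      using T0(1) t by (metis P_def image_insert insert_Diff)
    ultimately have "g t \<in> span (g ` insert k ?T1)"
      using in_span_insert by simp
    then have "V (cl t) \<subseteq> span (g ` insert k ?T1)"
      using span'[of "insert k ?T1" t] fin k t by auto
    also have "\<dots> \<subseteq> span (g ` T0)"
      using T0(1) by (intro span_minimal subspace_span) (auto simp: P_def intro: span_base)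
    finally show ?thesis .
  qed
  moreover have "V (cl k) \<subseteq> span (g ` T0)"
    using span'[OF fin k] T0(1) by (simp add: P_def)
  ultimately show ?thesis using sub by blast
qed

section \<open>A determinantal relation\<close>

text \<open>
  The vector of ones is in the kernel of the matrix, so the determinant annihilates it, by
  multiplication with the adjugate matrix. This holds over every commutative ring.
\<close>

lemma relation_determinant:
  fixes a :: "nat \<Rightarrow> nat \<Rightarrow> 'a::comm_ring_1"
  assumes "\<And>i. i < n \<Longrightarrow> (\<Sum>j<n. a i j) = 0" "n > 0"
  shows "(\<Sum>p | p permutes {0..<n}. signof p * (\<Prod>i = 0..<n. a i (p i))) = 0"
proof -
  define A where "A = mat n n (\<lambda>(i, j). a i j)"
  define e where "e = vec n (\<lambda>_. 1 :: 'a)"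
  have A: "A \<in> carrier_mat n n" and e: "e \<in> carrier_vec n" by (auto simp: A_def e_def)
  have "A *\<^sub>v e = 0\<^sub>v n"
    using assms(1) by (intro eq_vecI) (auto simp: A_def e_def scalar_prod_def lessThan_atLeast0)
  then have "adj_mat A *\<^sub>v (A *\<^sub>v e) = 0\<^sub>v n"
    using adj_mat(1)[OF A] by (auto intro!: eq_vecI simp: scalar_prod_def)
  then have "(det A \<cdot>\<^sub>m 1\<^sub>m n) *\<^sub>v e = 0\<^sub>v n"
    using adj_mat[OF A] A e by (metis assoc_mult_mat_vec)
  then have "((det A \<cdot>\<^sub>m 1\<^sub>m n) *\<^sub>v e) $ 0 = 0"
    using assms(2) by simp
  moreover have "((det A \<cdot>\<^sub>m 1\<^sub>m n) *\<^sub>v e) $ 0 = (\<Sum>j = 0..<n. det A * (if j = 0 then 1 else 0))"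
    using assms(2) by (simp add: e_def scalar_prod_def)
  moreover have "(\<Sum>j = 0..<n. det A * (if j = 0 then 1 else 0)) = (\<Sum>j = 0..<n. if j = 0 then det A else 0)"
    by (intro sum.cong) auto
  moreover have "(\<Sum>j = 0..<n. if j = 0 then det A else 0) = det A"
    using sum.delta[of "{0..<n}" 0 "\<lambda>_. det A"] assms(2) by auto
  ultimately have "det A = 0" by (simp only:)
  have "A $$ (i, p i) = a i (p i)" if "p permutes {0..<n}" "i \<in> {0..<n}" for p i
    using that permutes_in_image[OF that(1), of i] by (simp add: A_def)
  then have "det A = (\<Sum>p | p permutes {0..<n}. signof p * (\<Prod>i = 0..<n. a i (p i)))"
    unfolding det_def'[OF A] by (intro sum.cong refl arg_cong2[where f = "(*)"] prod.cong) auto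
  then show ?thesis using \<open>det A = 0\<close> by (simp only:)
qed


text \<open>
  If every \<open>u i\<close> is a sum of elements \<open>w i j\<close> of \<open>W j\<close>, then the rows of the matrix
  with entries \<open>\<delta>\<^bsub>ij\<^esub> u i - w i j\<close> sum to zero. In the Leibniz expansion of its vanishing determinant
  the identity contributes \<open>\<Prod>i. u i - w i i\<close>; every other permutation contributes a
  product with one factor from each \<open>V j\<close>, and with a factor from \<open>W j\<close> for each \<open>j\<close> that it moves.
\<close>

lemma prod_mem_of_relations_upto:
  fixes u :: "nat \<Rightarrow> 'a::comm_ring_1"
  assumes N: "ring.subspace N" and "n > 0"
    and V: "\<And>i x y. i < n \<Longrightarrow> x \<in> V i \<Longrightarrow> y \<in> W i \<Longrightarrow> x - y \<in> V i"
    and W: "\<And>i x. i < n \<Longrightarrow> x \<in> W i \<Longrightarrow> - x \<in> W i" "\<And>i. i < n \<Longrightarrow> W i \<subseteq> V i"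
    and prods: "\<And>v i. i < n \<Longrightarrow> v i \<in> W i \<Longrightarrow> (\<And>j. j < n \<Longrightarrow> v j \<in> V j) \<Longrightarrow> (\<Prod>j<n. v j) \<in> N"
    and u: "\<And>i. i < n \<Longrightarrow> u i \<in> V i" "\<And>i. i < n \<Longrightarrow> u i = (\<Sum>j<n. w i j)"
    and w: "\<And>i j. i < n \<Longrightarrow> j < n \<Longrightarrow> w i j \<in> W j"
  shows "(\<Prod>i<n. u i) \<in> N"
proof -
  define a where "a i j = (if i = j then u i else 0) - w i j" for i j
  define c where "c p = (\<Prod>i = 0..<n. a i (p i))" for p
  have "(\<Sum>j<n. a i j) = 0" if "i < n" for i
    using that u(2)[OF that] by (simp add: a_def sum_subtractf sum.delta)
  then have zero: "(\<Sum>p | p permutes {0..<n}. signof p * c p) = 0"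
    unfolding c_def using relation_determinant \<open>n > 0\<close> by blast
  have other: "c p \<in> N" if p: "p permutes {0..<n}" "p \<noteq> id" for p
  proof -
    obtain i where i: "p i \<noteq> i" using p(2) by (auto simp: fun_eq_iff)
    have "i < n" using i p(1) by (metis atLeastLessThan_iff permutes_def zero_le)
    then have pi: "p i < n" using permutes_in_image[OF p(1), of i] by simp
    let ?q = "inv_into UNIV p"
    have q: "?q permutes {0..<n}" using p(1) by (rule permutes_inv)
    have qp: "?q (p x) = x" "p (?q x) = x" for x
      using permutes_inverses[OF p(1)] by auto
    have "c p = (\<Prod>j = 0..<n. a (?q j) j)"
      unfolding c_def using prod.permute[OF q, of "\<lambda>i. a i (p i)"] by (simp add: o_def qp(2))
    also have "\<dots> = (\<Prod>j<n. a (?q j) j)" by (simp add: atLeast0LessThan)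
    also have "\<dots> \<in> N"
    proof (rule prods[OF pi])
      have "w i (p i) \<in> W (p i)" using w[OF \<open>i < n\<close> pi] .
      then show "a (?q (p i)) (p i) \<in> W (p i)"
        using i W(1)[OF pi] by (simp add: qp a_def)
      fix j assume j: "j < n"
      then have "?q j < n" using permutes_in_image[OF q, of j] by simp
      then have "w (?q j) j \<in> W j" using w j by blast
      then show "a (?q j) j \<in> V j"
        using V[OF j] u(1)[OF j] W[OF j] by (cases "?q j = j") (auto simp: a_def)
    qed
    finally show ?thesis .
  qed
  have id: "id \<in> {p. p permutes {0..<n}}" by (simp add: permutes_id)
  have "(\<Sum>p \<in> {p. p permutes {0..<n}} - {id}. signof p * c p) \<in> N"
    using other by (intro ring.subspace_sum[OF N] ring.subspace_scale[OF N]) auto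
  moreover have "c id + (\<Sum>p \<in> {p. p permutes {0..<n}} - {id}. signof p * c p) = 0"
    using zero sum.remove[OF finite_permutations[of "{0..<n}"] id, of "\<lambda>p. signof p * c p"] by simp
  ultimately have "c id \<in> N"
    using ring.subspace_neg[OF N] by (simp add: eq_neg_iff_add_eq_0[symmetric])
  then have base: "(\<Prod>i<n. u i - w i i) \<in> N"
    by (simp add: c_def a_def atLeast0LessThan)
  have "(\<Prod>i<n. if i < k then u i else u i - w i i) \<in> N" if "k \<le> n" for k
    using that
  proof (induction k)
    case 0
    then show ?case using base by simp
  next
    case (Suc k)
    have k: "k \<in> {..<n}" and kn: "k < n" using Suc.prems by auto
    let ?f = "\<lambda>x i. if i = k then x else if i < k then u i else u i - w i i"
    have split: "(\<Prod>i<n. ?f x i) = x * (\<Prod>i\<in>{..<n} - {k}. if i < k then u i else u i - w i i)" for x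
      using prod.remove[OF finite_lessThan k, of "?f x"] by (auto intro!: prod.cong)
    have "(\<Prod>i<n. ?f (u k - w k k) i) \<in> N"
    proof -
      have "(\<Prod>i<n. ?f (u k - w k k) i) = (\<Prod>i<n. if i < k then u i else u i - w i i)"
        by (intro prod.cong) auto
      then show ?thesis using Suc by simp
    qed
    moreover have "(\<Prod>i<n. ?f (w k k) i) \<in> N"
    proof (rule prods[OF kn])
      show "?f (w k k) k \<in> W k" using w[OF kn kn] by simp
      show "?f (w k k) j \<in> V j" if "j < n" for j
        using w[OF that that] W(2)[OF that] u(1)[OF that] V[OF that] by auto
    qed
    ultimately have "(\<Prod>i<n. ?f (u k - w k k) i) + (\<Prod>i<n. ?f (w k k) i) \<in> N"
      by (rule ring.subspace_add[OF N])
    then have "(\<Prod>i<n. ?f (u k) i) \<in> N"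
      unfolding split by (simp flip: distrib_right)
    moreover have "(\<Prod>i<n. ?f (u k) i) = (\<Prod>i<n. if i < Suc k then u i else u i - w i i)"
      by (intro prod.cong) auto
    ultimately show ?case by simp
  qed
  from this[of n] show ?thesis by simp
qed

lemma prod_mem_of_relations:
  fixes u :: "'i \<Rightarrow> 'a::comm_ring_1"
  assumes N: "ring.subspace N" and C: "finite C" "C \<noteq> {}"
    and V: "\<And>i x y. i \<in> C \<Longrightarrow> x \<in> V i \<Longrightarrow> y \<in> W i \<Longrightarrow> x - y \<in> V i"
    and W: "\<And>i x. i \<in> C \<Longrightarrow> x \<in> W i \<Longrightarrow> - x \<in> W i" "\<And>i. i \<in> C \<Longrightarrow> W i \<subseteq> V i"
    and prods: "\<And>v i. i \<in> C \<Longrightarrow> v i \<in> W i \<Longrightarrow> (\<And>j. j \<in> C \<Longrightarrow> v j \<in> V j) \<Longrightarrow> (\<Prod>j\<in>C. v j) \<in> N"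
    and u: "\<And>i. i \<in> C \<Longrightarrow> u i \<in> V i" "\<And>i. i \<in> C \<Longrightarrow> u i = (\<Sum>j\<in>C. w i j)"
    and w: "\<And>i j. i \<in> C \<Longrightarrow> j \<in> C \<Longrightarrow> w i j \<in> W j"
  shows "(\<Prod>i\<in>C. u i) \<in> N"
proof -
  obtain h where h: "bij_betw h {..<card C} C"
    using ex_bij_betw_nat_finite[OF C(1)] by (auto simp: atLeast0LessThan)
  note reindex = prod.reindex_bij_betw[OF h]
  have hC: "h i \<in> C" if "i < card C" for i
    using bij_betwE[OF h] that by auto
  have "(\<Prod>i<card C. u (h i)) \<in> N"
  proof (rule prod_mem_of_relations_upto[OF N])
    show "0 < card C" using C by (simp add: card_gt_0_iff)
    fix i assume i: "i < card C"
    show "u (h i) \<in> V (h i)" using u(1) hC i by blast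
    show "u (h i) = (\<Sum>j<card C. w (h i) (h j))"
      using u(2)[OF hC[OF i]] sum.reindex_bij_betw[OF h, of "w (h i)"] by simp
    fix v :: "nat \<Rightarrow> 'a" assume v: "v i \<in> W (h i)" "\<And>j. j < card C \<Longrightarrow> v j \<in> V (h j)"
    let ?g = "inv_into {..<card C} h"
    have g: "?g (h j) = j" if "j < card C" for j
      using bij_betw_inv_into_left[OF h, of j] that by simp
    have gC: "?g j < card C" "h (?g j) = j" if "j \<in> C" for j
      using bij_betw_inv_into_right[OF h that] bij_betwE[OF bij_betw_inv_into[OF h]] that by auto
    have "(\<Prod>j\<in>C. v (?g j)) \<in> N"
    proof (rule prods[OF hC[OF i]])
      show "v (?g (h i)) \<in> W (h i)" using v(1) g[OF i] by simp
      show "v (?g j) \<in> V j" if "j \<in> C" for j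
        using v(2)[OF gC(1)[OF that]] gC(2)[OF that] by simp
    qed
    moreover have "(\<Prod>j\<in>C. v (?g j)) = (\<Prod>j<card C. v j)"
      unfolding reindex[symmetric] using g by (intro prod.cong) auto
    ultimately show "(\<Prod>j<card C. v j) \<in> N" by simp
  qed (use V W w hC in blast)+
  then show ?thesis by (simp add: reindex)
qed

section \<open>Products of ideals of linear forms over an infinite field\<close>

lemma prod_mem_span:
  assumes "finite C" "\<And>i. i \<in> C \<Longrightarrow> v i \<in> ring.span (S i)"
  shows "(\<Prod>i\<in>C. v i) \<in> ring.span {\<Prod>i\<in>C. s i | s. \<forall>i\<in>C. s i \<in> S i}"
proof -
  define P where "P C = {\<Prod>i\<in>C. s i | s. \<forall>i\<in>C. s i \<in> S i}" for C
  have "(\<Prod>i\<in>C. v i) \<in> ring.span (P C)"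
    using assms
  proof (induction C)
    case empty
    have "1 \<in> P {}" by (auto simp: P_def)
    then show ?case by (simp add: ring.span_base)
  next
    case (insert k C)
    have mult: "s * p \<in> P (insert k C)" if s: "s \<in> S k" and p: "p \<in> P C" for s p
    proof -
      obtain t where t: "p = (\<Prod>i\<in>C. t i)" "\<forall>i\<in>C. t i \<in> S i" using p by (auto simp: P_def)
      have "(\<Prod>i\<in>C. (t(k := s)) i) = p"
        unfolding t(1) using insert.hyps(2) by (intro prod.cong) auto
      then have "s * p = (\<Prod>i\<in>insert k C. (t(k := s)) i)"
        using insert.hyps by simp
      moreover have "\<forall>i\<in>insert k C. (t(k := s)) i \<in> S i"
        using t(2) s by auto
      ultimately show ?thesis unfolding P_def by blast
    qed
    have left: "s * y \<in> ring.span (P (insert k C))" if "s \<in> S k" "y \<in> ring.span (P C)" for s y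
      using that(2)
    proof (induction rule: ring.span_induct_alt)
      case (step c x y)
      have "c * (s * x) + s * y \<in> ring.span (P (insert k C))"
        using ring.span_add[OF ring.span_scale[OF ring.span_base[OF mult[OF that(1) step(1)]]] step(2)] .
      then show ?case by (simp only: distrib_left mult.left_commute [of s c])
    qed (simp add: ring.span_zero)
    have both: "x * y \<in> ring.span (P (insert k C))" if "x \<in> ring.span (S k)" "y \<in> ring.span (P C)" for x y
      using that(1)
    proof (induction rule: ring.span_induct_alt)
      case (step c x z)
      have "c * (x * y) + z * y \<in> ring.span (P (insert k C))"
        using ring.span_add[OF ring.span_scale[OF left[OF step(1) that(2)]] step(2)] .
      then show ?case by (simp only: distrib_right mult.assoc)
    qed (simp add: ring.span_zero)
    have "v k * (\<Prod>i\<in>C. v i) \<in> ring.span (P (insert k C))"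
      using insert by (intro both) auto
    then show ?case
      using insert.hyps by simp
  qed
  then show ?thesis by (simp only: P_def)
qed

lemma (in vector_space) mem_span_UN:
  assumes "finite C" "x \<in> span (\<Union>i\<in>C. S i)"
  shows "\<exists>w. x = (\<Sum>i\<in>C. w i) \<and> (\<forall>i\<in>C. w i \<in> span (S i))"
  using assms
proof (induction C arbitrary: x)
  case empty
  then show ?case by simp
next
  case (insert k C)
  then have "x \<in> span (S k \<union> (\<Union>i\<in>C. S i))" by simp
  then obtain a b where ab: "x = a + b" "a \<in> span (S k)" "b \<in> span (\<Union>i\<in>C. S i)"
    unfolding span_Un by blast
  obtain w where w: "b = (\<Sum>i\<in>C. w i)" "\<forall>i\<in>C. w i \<in> span (S i)"
    using insert.IH[OF ab(3)] by blast
  have "(\<Sum>i\<in>C. (w(k := a)) i) = b"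
    unfolding w(1) using insert.hyps(2) by (intro sum.cong) auto
  then have "x = (\<Sum>i\<in>insert k C. (w(k := a)) i)"
    using insert.hyps ab(1) by simp
  then show ?case
    using w(2) ab(2) by (intro exI[of _ "w(k := a)"]) auto
qed

lemma span_single_image:
  "vec.span (single k ` S) = single k ` ring.span (S :: 'r::comm_ring_1 set)"
proof -
  have "module_hom (*) free_scale (single k :: 'r \<Rightarrow> nat \<Rightarrow>\<^sub>0 'r)"
    by (intro module_hom.intro module_hom_axioms.intro module_free_scale module_mult)
      (auto intro!: poly_mapping_eqI simp: single_add lookup_free_scale lookup_single when_def)
  then show ?thesis by (rule module_hom.span_image)
qed

lemma free_scale_single: "free_scale c (single k p) = single k (c * p)"
  by (rule poly_mapping_eqI) (auto simp: lookup_free_scale lookup_single when_def)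

text \<open>
  One vector more than there are variables is enough to span each \<open>V i\<close>: as long as the first few generic
  vectors do not span \<open>V i\<close>, the next one is independent of them.
\<close>

lemma generic_linear_forms:
  fixes V :: "nat \<Rightarrow> ('n::finite, 'k::field) mpol set"
  assumes inf: "infinite (UNIV :: 'k set)" and I: "finite I" "I \<noteq> {}"
    and V: "\<And>i. i \<in> I \<Longrightarrow> scalar.subspace (V i)" "\<And>i. i \<in> I \<Longrightarrow> V i \<subseteq> linear_forms"
  obtains f :: "nat \<Rightarrow> nat \<Rightarrow> ('n, 'k) mpol" where
    "\<And>i j. i \<in> I \<Longrightarrow> f i j \<in> V i"
    "\<And>i. i \<in> I \<Longrightarrow> V i \<subseteq> scalar.span (f i ` {..card (UNIV :: 'n set)})"
    "\<And>T i j. finite T \<Longrightarrow> T \<subseteq> I \<times> UNIV \<Longrightarrow> i \<in> I \<Longrightarrow> (i, j) \<notin> T \<Longrightarrow>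
       f i j \<in> scalar.span ((\<lambda>(i, j). f i j) ` T) \<Longrightarrow>
       \<exists>T0\<subseteq>T. \<forall>t\<in>insert (i, j) T0. V (fst t) \<subseteq> scalar.span ((\<lambda>(i, j). f i j) ` T0)"
proof -
  obtain i0 where i0: "i0 \<in> I" using I(2) by blast
  define cl where "cl k = (let i = fst (prod_decode k) in if i \<in> I then i else i0)" for k
  have cl: "cl k \<in> I" for k using i0 by (simp add: cl_def Let_def)
  have cl_enc: "cl (prod_encode (i, j)) = i" if "i \<in> I" for i j
    using that by (simp add: cl_def)
  have "\<exists>g. \<forall>k. scalar.generic I V cl g k (g k)"
    by (rule scalar.exists_generic_sequence[OF inf I(1)]) (use cl V(1) in auto)
  then obtain g where g: "\<And>k. scalar.generic I V cl g k (g k)" by auto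
  define f where "f i j = g (prod_encode (i, j))" for i j
  have fV: "f i j \<in> V i" if "i \<in> I" for i j
    using scalar.genericD(1)[OF g] cl_enc[OF that] by (metis f_def)
  have image: "(\<lambda>(i, j). f i j) ` T = g ` (prod_encode ` T)" for T
    unfolding image_image by (intro image_cong) (auto simp: f_def)
  show ?thesis
  proof (rule that[of f])
    fix i assume i: "i \<in> I"
    show "V i \<subseteq> scalar.span (f i ` {..card (UNIV :: 'n set)})"
    proof (rule ccontr)
      assume not: "\<not> V i \<subseteq> scalar.span (f i ` {..card (UNIV :: 'n set)})"
      have new: "f i j \<notin> scalar.span (f i ` {..<j})" if "j \<le> card (UNIV :: 'n set)" for j
      proof
        assume "f i j \<in> scalar.span (f i ` {..<j})"
        moreover have fi: "f i ` {..<j} = g ` (\<lambda>j. prod_encode (i, j)) ` {..<j}"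
          unfolding image_image f_def ..
        moreover have "prod_encode (i, j) \<notin> (\<lambda>j. prod_encode (i, j)) ` {..<j}"
          by (auto simp: prod_encode_eq)
        ultimately have "V i \<subseteq> scalar.span (f i ` {..<j})"
          using scalar.generic_span[where B = "{}" and T = "(\<lambda>j. prod_encode (i, j)) ` {..<j}" and k = "prod_encode (i, j)", OF g cl]
          by (auto simp: cl_enc[OF i] f_def)
        then show False
          using not that scalar.span_mono[of "f i ` {..<j}" "f i ` {..card (UNIV :: 'n set)}"] by force
      qed
      have "scalar.independent (f i ` {..<j}) \<and> card (f i ` {..<j}) = j" if "j \<le> Suc (card (UNIV :: 'n set))" for j
        using that
      proof (induction j)
        case 0
        then show ?case by (simp add: scalar.independent_empty)
      next
        case (Suc j)
        then have notin: "f i j \<notin> scalar.span (f i ` {..<j})" using new by simp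
        have "f i j \<notin> f i ` {..<j}"
          using notin scalar.span_superset[of "f i ` {..<j}"] by (meson subsetD)
        moreover have "scalar.independent (f i ` {..<j})" "card (f i ` {..<j}) = j"
          using Suc.IH Suc.prems by simp_all
        ultimately show ?case
          unfolding lessThan_Suc image_insert
          using scalar.independent_insertI[OF notin] by simp
      qed
      from this[of "Suc (card (UNIV :: 'n set))"] have ind: "scalar.independent (f i ` {..card (UNIV :: 'n set)})" "card (f i ` {..card (UNIV :: 'n set)}) = Suc (card (UNIV :: 'n set))"
        by (simp_all add: lessThan_Suc_atMost)
      let ?X = "range (\<lambda>v :: 'n. single (single v (1::nat)) (1::'k))"
      have "p \<in> scalar.span ?X" if "p \<in> linear_forms" for p
        by (subst linear_form_expansion[OF that])
          (intro scalar.span_sum scalar.span_scale scalar.span_base, simp)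
      then have "f i ` {..card (UNIV :: 'n set)} \<subseteq> scalar.span ?X"
        using fV[OF i] V(2)[OF i] by blast
      then have "card (f i ` {..card (UNIV :: 'n set)}) \<le> card ?X"
        using scalar.independent_span_bound[OF _ ind(1)] by simp
      also have "\<dots> \<le> card (UNIV :: 'n set)" by (rule card_image_le) simp
      finally show False using ind(2) by simp
    qed
  next
    fix T i j
    assume T: "finite T" "T \<subseteq> I \<times> UNIV" "i \<in> I" "(i, j) \<notin> T" "f i j \<in> scalar.span ((\<lambda>(i, j). f i j) ` T)"
    have "prod_encode (i, j) \<notin> prod_encode ` T"
      using T(4) by (auto simp: inj_image_mem_iff[OF inj_prod_encode])
    then have "\<exists>S0\<subseteq>prod_encode ` T. \<forall>t\<in>insert (prod_encode (i, j)) S0. V (cl t) \<subseteq> scalar.span (g ` S0)"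
      using T(1) T(5)[unfolded image f_def] by (intro scalar.generic_circuit[OF g cl]) (simp_all add: image_image)
    then obtain S0 where S0: "S0 \<subseteq> prod_encode ` T" "\<forall>t\<in>insert (prod_encode (i, j)) S0. V (cl t) \<subseteq> scalar.span (g ` S0)"
      by iprover
    from S0(1) obtain T0 where T0: "T0 \<subseteq> T" "S0 = prod_encode ` T0"
      by (meson subset_imageE)
    have "V (fst t) \<subseteq> scalar.span ((\<lambda>(i, j). f i j) ` T0)" if "t \<in> insert (i, j) T0" for t
    proof -
      have "fst t \<in> I" using that T0(1) T(2,3) by auto
      then have "cl (prod_encode t) = fst t" using cl_enc[of "fst t" "snd t"] by simp
      moreover have "V (cl (prod_encode t)) \<subseteq> scalar.span (g ` S0)"
        using that S0(2) T0(2) by auto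
      ultimately show ?thesis by (simp add: image T0(2))
    qed
    then show "\<exists>T0\<subseteq>T. \<forall>t\<in>insert (i, j) T0. V (fst t) \<subseteq> scalar.span ((\<lambda>(i, j). f i j) ` T0)"
      using T0(1) by blast
  qed (rule fV)
qed


lemma scalar_subspace_homogeneous: "scalar.subspace (homogeneous_part j)"
  by (auto simp: scalar.subspace_def const_mult_homogeneous)

lemma homogeneous_part_prod:
  "(\<And>i. i \<in> A \<Longrightarrow> p i \<in> linear_forms) \<Longrightarrow> (\<Prod>i\<in>A. p i) \<in> homogeneous_part (int (card A))"
proof (induction A rule: infinite_finite_induct)
  case (insert i A)
  then show ?case
    using homogeneous_part_mult[of "p i" 1 "\<Prod>i\<in>A. p i" "int (card A)"] by simp
qed auto

lemma subspace_mult_preimage: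
  fixes S :: "'a::comm_ring_1 set"
  assumes "ring.subspace S"
  shows "ring.subspace {p. p * r \<in> S}"
proof (rule ring.subspaceI)
  show "0 \<in> {p. p * r \<in> S}"
    using ring.subspace_0[OF assms] by simp
  show "x + y \<in> {p. p * r \<in> S}" if "x \<in> {p. p * r \<in> S}" "y \<in> {p. p * r \<in> S}" for x y
    using ring.subspace_add[OF assms, of "x * r" "y * r"] that by (simp only: distrib_right mem_Collect_eq)
  show "c * x \<in> {p. p * r \<in> S}" if "x \<in> {p. p * r \<in> S}" for c x
    using ring.subspace_scale[OF assms, of "x * r" c] that by (simp only: mult.assoc mem_Collect_eq)
qed

text \<open>
  The last assumption is the consequence of genericity that is needed: a dependence of \<open>f i j\<close> on other
  vectors takes place in the sum of the spaces \<open>V k\<close> of all the vectors involved.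
\<close>

locale generic_factors =
  fixes I :: "nat set" and V :: "nat \<Rightarrow> ('n::finite, 'k::field) mpol set"
    and f :: "nat \<Rightarrow> nat \<Rightarrow> ('n, 'k) mpol" and D :: nat
  assumes fin: "finite I"
    and V_linear: "\<And>i. i \<in> I \<Longrightarrow> V i \<subseteq> linear_forms"
    and f_V: "\<And>i j. i \<in> I \<Longrightarrow> f i j \<in> V i"
    and circuit: "\<And>T i j. finite T \<Longrightarrow> T \<subseteq> I \<times> UNIV \<Longrightarrow> i \<in> I \<Longrightarrow> (i, j) \<notin> T \<Longrightarrow>
       f i j \<in> scalar.span ((\<lambda>(i, j). f i j) ` T) \<Longrightarrow>
       \<exists>T0\<subseteq>T. \<forall>t\<in>insert (i, j) T0. V (fst t) \<subseteq> scalar.span ((\<lambda>(i, j). f i j) ` T0)"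
begin

definition box :: "(nat \<Rightarrow> nat) set" where
  "box = (\<Pi>\<^sub>E i\<in>I. {..D})"

definition generator :: "(nat \<Rightarrow> nat) \<Rightarrow> ('n, 'k) mpol" where
  "generator a = (\<Prod>i\<in>I. f i (a i))"

definition smaller :: "(nat \<Rightarrow> nat) \<Rightarrow> (nat \<Rightarrow> nat) set" where
  "smaller a = {b \<in> box. (\<forall>i\<in>I. b i \<le> a i) \<and> (\<exists>i\<in>I. b i < a i)}"

definition lower_forms :: "(nat \<Rightarrow> nat) \<Rightarrow> ('n, 'k) mpol set" where
  "lower_forms a = (\<lambda>(i, j). f i j) ` (SIGMA i:I. {..<a i})"

lemma f_linear: "i \<in> I \<Longrightarrow> f i j \<in> linear_forms"
  using f_V V_linear by blast

lemma lower_forms_linear: "lower_forms a \<subseteq> linear_forms"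
  by (auto simp: lower_forms_def f_linear)

lemma finite_lower_forms: "finite (lower_forms a)"
  by (simp add: lower_forms_def fin finite_SigmaI)

text \<open>
  If one of the factors of a generator lies in the span of the lower forms, genericity provides
  a set of indices whose whole spaces are spanned by their own lower forms, and the
  determinantal relation expresses the generator by smaller ones.
\<close>

lemma generator_redundant:
  assumes a: "a \<in> box" and i0: "i0 \<in> I" "f i0 (a i0) \<in> scalar.span (lower_forms a)"
  shows "generator a \<in> ring.span (generator ` smaller a)"
proof -
  let ?T = "SIGMA i:I. {..<a i}"
  have "\<exists>T0\<subseteq>?T. \<forall>t\<in>insert (i0, a i0) T0. V (fst t) \<subseteq> scalar.span ((\<lambda>(i, j). f i j) ` T0)"
  proof (rule circuit)
    show "f i0 (a i0) \<in> scalar.span ((\<lambda>(i, j). f i j) ` ?T)"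
      using i0(2) by (simp add: lower_forms_def)
  qed (use fin i0(1) in \<open>auto simp: finite_SigmaI\<close>)
  then obtain T0 where T0: "T0 \<subseteq> ?T"
    "\<And>t. t \<in> insert (i0, a i0) T0 \<Longrightarrow> V (fst t) \<subseteq> scalar.span ((\<lambda>(i, j). f i j) ` T0)" by blast
  define C where "C = fst ` insert (i0, a i0) T0"
  have C_I: "C \<subseteq> I" and C_ne: "C \<noteq> {}"
    using T0(1) i0(1) by (auto simp: C_def)
  note C = C_I finite_subset[OF C_I fin] C_ne
  define W where "W i = scalar.span (f i ` {..<a i})" for i
  define U where "U i = scalar.span (f i ` {..a i})" for i
  have "(\<lambda>(i, j). f i j) ` T0 \<subseteq> (\<Union>i\<in>C. f i ` {..<a i})"
  proof
    fix x assume "x \<in> (\<lambda>(i, j). f i j) ` T0"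
    then obtain i j where ij: "(i, j) \<in> T0" "x = f i j" by auto
    then have "i \<in> C" unfolding C_def by (intro image_eqI[of _ _ "(i, j)"]) auto
    moreover have "j < a i" using ij(1) T0(1) by blast
    ultimately show "x \<in> (\<Union>i\<in>C. f i ` {..<a i})" using ij(2) by blast
  qed
  then have span_T0: "scalar.span ((\<lambda>(i, j). f i j) ` T0) \<subseteq> scalar.span (\<Union>i\<in>C. f i ` {..<a i})"
    by (rule scalar.span_mono)
  have "\<exists>w. f i (a i) = (\<Sum>j\<in>C. w j) \<and> (\<forall>j\<in>C. w j \<in> W j)" if i: "i \<in> C" for i
  proof -
    obtain t where t: "i = fst t" "t \<in> insert (i0, a i0) T0"
      using i unfolding C_def by (rule imageE)
    have "f i (a i) \<in> V i" using f_V C(1) i by blast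
    then have "f i (a i) \<in> scalar.span (\<Union>i\<in>C. f i ` {..<a i})"
      using T0(2)[OF t(2)] t(1) span_T0 by blast
    then show ?thesis
      unfolding W_def by (rule scalar.mem_span_UN[OF C(2)])
  qed
  then obtain w where w: "\<And>i. i \<in> C \<Longrightarrow> f i (a i) = (\<Sum>j\<in>C. w i j)"
    "\<And>i j. i \<in> C \<Longrightarrow> j \<in> C \<Longrightarrow> w i j \<in> W j"
    by metis
  have split: "(\<Prod>i\<in>I. g i) = (\<Prod>i\<in>C. g i) * (\<Prod>i\<in>I - C. g i)" for g :: "nat \<Rightarrow> ('n, 'k) mpol"
    using prod.subset_diff[OF C(1) fin, of g] by (simp only: mult.commute)
  define rest where "rest = (\<Prod>i\<in>I - C. f i (a i))"
  define N where "N = {p. p * rest \<in> ring.span (generator ` smaller a)}"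
  have N: "ring.subspace N"
    unfolding N_def by (rule subspace_mult_preimage[OF ring.subspace_span])
  have WU: "W i \<subseteq> U i" for i
    unfolding W_def U_def by (intro scalar.span_mono) auto
  have "(\<Prod>i\<in>C. f i (a i)) \<in> N"
  proof (rule prod_mem_of_relations[OF N C(2,3)])
    fix v i assume i: "i \<in> C" and v: "v i \<in> W i" "\<And>j. j \<in> C \<Longrightarrow> v j \<in> U j"
    define S where "S j = f j ` (if j = i then {..<a j} else {..a j})" for j
    have "v j \<in> ring.span (S j)" if "j \<in> C" for j
    proof -
      have "v j \<in> scalar.span (S j)"
        using v(1) v(2)[OF that] by (auto simp: S_def W_def U_def)
      then show ?thesis
        using scalar_span_subset_ideal by (auto simp: ideal_generated_def)
    qed
    then have "(\<Prod>j\<in>C. v j) \<in> ring.span {\<Prod>j\<in>C. s j | s. \<forall>j\<in>C. s j \<in> S j}"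
      by (rule prod_mem_span[OF C(2)])
    also have "\<dots> \<subseteq> N"
    proof (rule ring.span_minimal[OF _ N], rule subsetI)
      fix x assume "x \<in> {\<Prod>j\<in>C. s j | s. \<forall>j\<in>C. s j \<in> S j}"
      then obtain s where s: "x = (\<Prod>j\<in>C. s j)" "\<forall>j\<in>C. s j \<in> S j" by blast
      then have "\<forall>j\<in>C. \<exists>b. b \<in> (if j = i then {..<a j} else {..a j}) \<and> s j = f j b"
        unfolding S_def by blast
      then obtain b where b: "\<forall>j\<in>C. b j \<in> (if j = i then {..<a j} else {..a j}) \<and> s j = f j (b j)"
        by metis
      define b' where "b' = restrict (\<lambda>j. if j \<in> C then b j else a j) I"
      have le: "\<forall>j\<in>I. b' j \<le> a j" "b' i < a i"
        using b i C(1) by (auto simp: b'_def split: if_splits)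
      have "\<forall>i\<in>I. b' i \<le> D"
        using a le(1) unfolding box_def PiE_iff by (meson atMost_iff order_trans)
      moreover have "b' \<in> extensional I"
        by (simp add: b'_def)
      ultimately have "b' \<in> box"
        unfolding box_def PiE_iff by blast
      then have "b' \<in> smaller a"
        using le i C(1) by (auto simp: smaller_def)
      moreover have "generator b' = x * rest"
      proof -
        have "generator b' = (\<Prod>j\<in>I. if j \<in> C then s j else f j (a j))"
          unfolding generator_def using b by (intro prod.cong) (auto simp: b'_def)
        also have "\<dots> = (\<Prod>j\<in>C. if j \<in> C then s j else f j (a j)) * (\<Prod>j\<in>I - C. if j \<in> C then s j else f j (a j))"
          by (rule split)
        also have "\<dots> = x * rest"
          unfolding s(1) rest_def by (intro arg_cong2[where f = "(*)"] prod.cong) auto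
        finally show ?thesis .
      qed
      ultimately show "x \<in> N"
        unfolding N_def by (metis (mono_tags, lifting) image_eqI mem_Collect_eq ring.span_base)
    qed
    finally show "(\<Prod>j\<in>C. v j) \<in> N" .
  next
    fix i assume i: "i \<in> C"
    show "W i \<subseteq> U i" by (rule WU)
    show "f i (a i) \<in> U i" unfolding U_def by (intro scalar.span_base) auto
    show "f i (a i) = (\<Sum>j\<in>C. w i j)" by (rule w(1)[OF i])
    show "- x \<in> W i" if "x \<in> W i" for x using that unfolding W_def by (rule scalar.span_neg)
    show "x - y \<in> U i" if "x \<in> U i" "y \<in> W i" for x y
      using that WU unfolding U_def by (blast intro: scalar.span_diff)
    show "w i j \<in> W j" if "j \<in> C" for j by (rule w(2)[OF i that])
  qed
  moreover have "generator a = (\<Prod>i\<in>C. f i (a i)) * rest"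
    unfolding generator_def rest_def by (rule split)
  ultimately show ?thesis by (simp add: N_def)
qed

text \<open>
  Both inclusions are elementary once no factor of the generator lies in the ideal of its lower forms. The set
  \<open>prev\<close> may contain incomparable index vectors; each of them still has an index below the corresponding one of \<open>a\<close>.
\<close>

lemma generator_colon:
  assumes a: "a \<in> box" and prev: "smaller a \<subseteq> prev"
    and later: "\<And>b. b \<in> prev \<Longrightarrow> \<exists>i\<in>I. b i < a i"
    and irredundant: "generator a \<notin> ring.span (generator ` prev)"
  shows "{c. c * generator a \<in> ring.span (generator ` prev)} = ideal_generated (lower_forms a)"
proof
  have notin: "f i (a i) \<notin> ideal_generated (lower_forms a)" if "i \<in> I" for i
  proof
    assume "f i (a i) \<in> ideal_generated (lower_forms a)"
    then have "f i (a i) \<in> scalar.span (lower_forms a)"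
      using linear_form_in_ideal[OF lower_forms_linear f_linear[OF that]] by blast
    then have "generator a \<in> ring.span (generator ` smaller a)"
      by (rule generator_redundant[OF a that])
    also have "\<dots> \<subseteq> ring.span (generator ` prev)"
      using prev by (intro ring.span_mono image_mono)
    finally show False using irredundant by contradiction
  qed
  have "1 \<notin> ideal_generated (lower_forms a)"
    using linear_ideal_const_coeff[OF lower_forms_linear, of 1 a] by auto
  then have gen: "generator a \<notin> ideal_generated (lower_forms a)"
    using linear_ideal_prod[OF lower_forms_linear fin] notin unfolding generator_def by blast
  have "generator b \<in> ideal_generated (lower_forms a)" if b: "b \<in> prev" for b
  proof -
    obtain i where i: "i \<in> I" "b i < a i" using later b by blast
    then have "f i (b i) \<in> lower_forms a" by (auto simp: lower_forms_def)
    then have "(\<Prod>i\<in>I - {i}. f i (b i)) * f i (b i) \<in> ideal_generated (lower_forms a)"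
      unfolding ideal_generated_def by (intro ring.span_scale ring.span_base)
    then show ?thesis
      unfolding generator_def using prod.remove[OF fin i(1), of "\<lambda>i. f i (b i)"] by (simp add: mult.commute)
  qed
  then have "ring.span (generator ` prev) \<subseteq> ideal_generated (lower_forms a)"
    unfolding ideal_generated_def by (intro ring.span_minimal ring.subspace_span) auto
  then show "{c. c * generator a \<in> ring.span (generator ` prev)} \<subseteq> ideal_generated (lower_forms a)"
    using linear_ideal_prime[OF lower_forms_linear] gen by blast
  have sub: "ring.subspace {c. c * generator a \<in> ring.span (generator ` prev)}"
    by (rule subspace_mult_preimage[OF ring.subspace_span])
  show "ideal_generated (lower_forms a) \<subseteq> {c. c * generator a \<in> ring.span (generator ` prev)}"
    unfolding ideal_generated_def
  proof (rule ring.span_minimal[OF _ sub], rule subsetI, rule CollectI)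
    fix l assume "l \<in> lower_forms a"
    then obtain i j where ij: "i \<in> I" "j < a i" "l = f i j" by (auto simp: lower_forms_def)
    \<comment> \<open>Exchanging the factor \<open>f i (a i)\<close> for \<open>f i j\<close> gives a smaller generator.\<close>
    define b where "b = a(i := j)"
    have "b \<in> box" using a ij unfolding box_def b_def by (auto simp: PiE_iff extensional_def)
    then have "b \<in> smaller a" using ij by (auto simp: smaller_def b_def)
    then have "generator b \<in> generator ` prev" using prev by blast
    then have "f i (a i) * generator b \<in> ring.span (generator ` prev)"
      by (intro ring.span_scale ring.span_base)
    moreover have "f i (a i) * generator b = l * generator a"
    proof -
      define P where "P = (\<Prod>k\<in>I - {i}. f k (a k))"
      have "(\<Prod>k\<in>I - {i}. f k (b k)) = P"
        unfolding P_def by (intro prod.cong) (auto simp: b_def)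
      then have "generator b = f i (b i) * P"
        using prod.remove[OF fin ij(1), of "\<lambda>k. f k (b k)"] by (simp only: generator_def)
      moreover have "generator a = f i (a i) * P"
        using prod.remove[OF fin ij(1), of "\<lambda>k. f k (a k)"] by (simp only: generator_def P_def)
      ultimately show ?thesis
        by (simp add: b_def ij(3) mult.left_commute)
    qed
    ultimately show "l * generator a \<in> ring.span (generator ` prev)" by simp
  qed
qed

text \<open>
  Sorting by the sum of the indices puts all smaller index vectors before \<open>a\<close>, but none that is at least
  \<open>a\<close> in every component. Redundant generators are then pruned.
\<close>

lemma exists_linear_quotients:
  "\<exists>gs. set gs \<subseteq> homogeneous_vectors (int (card I)) \<and> linear_quotients gs \<and>
     vec.span (set gs) = single 0 ` ring.span (generator ` box)"
proof -
  have fin_box: "finite box" by (simp add: box_def fin finite_PiE)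
  then obtain xs0 where xs0: "set xs0 = box" "distinct xs0"
    using finite_distinct_list by blast
  define size where "size b = (\<Sum>i\<in>I. b i)" for b :: "nat \<Rightarrow> nat"
  define xs where "xs = sort_key size xs0"
  have xs: "set xs = box" "distinct xs" "sorted (map size xs)"
    using xs0 by (simp_all add: xs_def)
  define vec where "vec b = single (0::nat) (generator b)" for b
  obtain gs where gs: "vec.span (set gs) = vec.span (set (map vec xs))"
    "\<forall>t<length gs. \<exists>s<length (map vec xs). gs ! t = map vec xs ! s \<and>
        vec.span (set (take t gs)) = vec.span (set (take s (map vec xs))) \<and> map vec xs ! s \<notin> vec.span (set (take s (map vec xs)))"
    using vec.prune_generators[of "map vec xs"] by iprover
  have span_vec: "vec.span (vec ` X) = single 0 ` ring.span (generator ` X)" for X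
    using span_single_image[of 0 "generator ` X"] by (simp add: vec_def image_image)
  have gs_t: "gs ! t \<in> homogeneous_vectors (int (card I)) \<and> linear_ideal (colon (set (take t gs)) (gs ! t))" if t: "t < length gs" for t
  proof -
    obtain s where s: "s < length (map vec xs)" "gs ! t = map vec xs ! s"
        "vec.span (set (take t gs)) = vec.span (set (take s (map vec xs)))" "map vec xs ! s \<notin> vec.span (set (take s (map vec xs)))"
      using gs(2) t by iprover
    have sx: "s < length xs" using s(1) by simp
    define a where "a = xs ! s"
    define prev where "prev = set (take s xs)"
    have a: "a \<in> box" using nth_mem[OF sx] unfolding xs(1) a_def .
    have gt: "gs ! t = vec a" unfolding s(2) a_def using sx by (rule nth_map)
    have prev_span: "vec.span (set (take t gs)) = single 0 ` ring.span (generator ` prev)"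
      unfolding s(3) prev_def by (simp only: take_map set_map span_vec)
    have col: "colon (set (take t gs)) (gs ! t) = {c. c * generator a \<in> ring.span (generator ` prev)}"
      unfolding colon_def prev_span gt vec_def free_scale_single inj_image_mem_iff[OF inj_single] ..
    have "{c. c * generator a \<in> ring.span (generator ` prev)} = ideal_generated (lower_forms a)"
    proof (rule generator_colon[OF a])
      show "smaller a \<subseteq> prev"
      proof
        fix b assume b: "b \<in> smaller a"
        then have "size b < size a"
          unfolding size_def smaller_def using fin by (auto intro!: sum_strict_mono_ex1)
        moreover have "b \<in> set xs" using b unfolding xs(1) by (simp add: smaller_def)
        then obtain k where k: "k < length xs" "b = xs ! k"
          unfolding in_set_conv_nth by blast
        ultimately have "\<not> s \<le> k"
          using sorted_nth_mono[OF xs(3), of s k] by (auto simp: a_def)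
        then show "b \<in> prev"
          using k by (auto simp: prev_def in_set_conv_nth)
      qed
      show "\<exists>i\<in>I. b i < a i" if b: "b \<in> prev" for b
      proof (rule ccontr)
        assume "\<not> (\<exists>i\<in>I. b i < a i)"
        then have le: "\<And>i. i \<in> I \<Longrightarrow> a i \<le> b i" by (auto simp: not_less)
        obtain k where k: "k < s" "b = xs ! k"
          using b sx by (auto simp: prev_def in_set_conv_nth)
        have "size b \<le> size a"
          using sorted_nth_mono[OF xs(3), of k s] k sx by (simp add: a_def)
        then have "\<forall>i\<in>I. a i = b i"
          using sum_strict_mono_ex1[OF fin, of a b] le unfolding size_def by (metis le_neq_implies_less not_le)
        moreover have "b \<in> box" using nth_mem[of k xs] k sx unfolding xs(1) by simp
        ultimately have "a = b"
          using a unfolding box_def by (metis (no_types, lifting) PiE_ext)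
        then show False
          using k sx xs(2) by (auto simp: a_def nth_eq_iff_index_eq)
      qed
      show "generator a \<notin> ring.span (generator ` prev)"
      proof
        assume "generator a \<in> ring.span (generator ` prev)"
        then have "gs ! t \<in> vec.span (set (take t gs))"
          unfolding prev_span gt vec_def by (rule imageI)
        then show False using s(4) by (simp only: s(2) s(3))
      qed
    qed
    moreover have "vec a \<in> homogeneous_vectors (int (card I))"
      unfolding vec_def generator_def
      by (intro homogeneous_vectors_closed homogeneous_part_prod f_linear)
    moreover have "linear_ideal (ideal_generated (lower_forms a))"
      unfolding linear_ideal_def using finite_lower_forms lower_forms_linear by iprover
    ultimately show ?thesis
      by (simp only: col) (simp only: gt)
  qed
  have "set gs \<subseteq> homogeneous_vectors (int (card I))"
    using gs_t unfolding subset_iff in_set_conv_nth by blast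
  moreover have "linear_quotients gs"
    using gs_t unfolding linear_quotients_def by blast
  moreover have "vec.span (set gs) = single 0 ` ring.span (generator ` box)"
    using gs(1) by (simp add: span_vec xs(1))
  ultimately show ?thesis by blast
qed

end

theorem product_linear_quotients:
  fixes L :: "nat \<Rightarrow> ('n::finite, 'k::field) mpol set"
  assumes inf: "infinite (UNIV :: 'k set)" and I: "finite I" "I \<noteq> {}"
    and L: "\<And>i. i \<in> I \<Longrightarrow> L i \<subseteq> linear_forms"
  shows "\<exists>gs. set gs \<subseteq> homogeneous_vectors (int (card I)) \<and> linear_quotients gs \<and>
     vec.span (set gs) = single 0 ` ring.span {\<Prod>i\<in>I. l i | l. \<forall>i\<in>I. l i \<in> L i}"
proof -
  define V where "V i = scalar.span (L i)" for i
  have V: "scalar.subspace (V i)" "i \<in> I \<Longrightarrow> V i \<subseteq> linear_forms" for i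
    using scalar.span_minimal[OF L scalar_subspace_homogeneous] by (auto simp: V_def)
  obtain f :: "nat \<Rightarrow> nat \<Rightarrow> ('n, 'k) mpol" where f:
    "\<And>i j. i \<in> I \<Longrightarrow> f i j \<in> V i"
    "\<And>i. i \<in> I \<Longrightarrow> V i \<subseteq> scalar.span (f i ` {..card (UNIV :: 'n set)})"
    "\<And>T i j. finite T \<Longrightarrow> T \<subseteq> I \<times> UNIV \<Longrightarrow> i \<in> I \<Longrightarrow> (i, j) \<notin> T \<Longrightarrow>
       f i j \<in> scalar.span ((\<lambda>(i, j). f i j) ` T) \<Longrightarrow>
       \<exists>T0\<subseteq>T. \<forall>t\<in>insert (i, j) T0. V (fst t) \<subseteq> scalar.span ((\<lambda>(i, j). f i j) ` T0)"
    using generic_linear_forms[OF inf I, of V] V by blast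
  interpret generic_factors I V f "card (UNIV :: 'n set)"
    using I(1) V(2) f(1,3) by unfold_locales
  have to_ring: "scalar.span S \<subseteq> ring.span S" for S :: "('n, 'k) mpol set"
    using scalar_span_subset_ideal by (auto simp: ideal_generated_def)
  have "ring.span (generator ` box) = ring.span {\<Prod>i\<in>I. l i | l. \<forall>i\<in>I. l i \<in> L i}" (is "_ = ring.span ?P")
  proof
    have "generator b \<in> ring.span ?P" for b
      unfolding generator_def
    proof (rule prod_mem_span[OF I(1)])
      show "f i (b i) \<in> ring.span (L i)" if "i \<in> I" for i
        using f(1)[OF that] to_ring by (auto simp: V_def)
    qed
    then show "ring.span (generator ` box) \<subseteq> ring.span ?P"
      by (intro ring.span_minimal ring.subspace_span) auto
    have "(\<Prod>i\<in>I. l i) \<in> ring.span (generator ` box)" if l: "\<forall>i\<in>I. l i \<in> L i" for l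
    proof -
      have "l i \<in> ring.span (f i ` {..card (UNIV :: 'n set)})" if "i \<in> I" for i
        using l that f(2)[OF that] to_ring scalar.span_base[of "l i" "L i"] by (auto simp: V_def)
      then have "(\<Prod>i\<in>I. l i) \<in> ring.span {\<Prod>i\<in>I. s i | s. \<forall>i\<in>I. s i \<in> f i ` {..card (UNIV :: 'n set)}}"
        by (rule prod_mem_span[OF I(1)])
      moreover have "{\<Prod>i\<in>I. s i | s. \<forall>i\<in>I. s i \<in> f i ` {..card (UNIV :: 'n set)}} \<subseteq> generator ` box"
      proof
        fix x assume "x \<in> {\<Prod>i\<in>I. s i | s. \<forall>i\<in>I. s i \<in> f i ` {..card (UNIV :: 'n set)}}"
        then obtain s where s: "x = (\<Prod>i\<in>I. s i)" "\<forall>i\<in>I. s i \<in> f i ` {..card (UNIV :: 'n set)}"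
          by blast
        from s(2) have "\<forall>i\<in>I. \<exists>b. b \<le> card (UNIV :: 'n set) \<and> s i = f i b" by auto
        then obtain b where b: "\<forall>i\<in>I. b i \<le> card (UNIV :: 'n set) \<and> s i = f i (b i)" by metis
        have "x = generator (restrict b I)"
          unfolding generator_def s(1) using b by (intro prod.cong) auto
        moreover have "restrict b I \<in> box" using b by (auto simp: box_def)
        ultimately show "x \<in> generator ` box" by blast
      qed
      then have "ring.span {\<Prod>i\<in>I. s i | s. \<forall>i\<in>I. s i \<in> f i ` {..card (UNIV :: 'n set)}} \<subseteq> ring.span (generator ` box)"
        by (rule ring.span_mono)
      ultimately show ?thesis by blast
    qed
    then show "ring.span ?P \<subseteq> ring.span (generator ` box)"
      by (intro ring.span_minimal ring.subspace_span) auto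
  qed
  then show ?thesis
    using exists_linear_quotients by simp
qed

section \<open>Bases of homogeneous generators\<close>

interpretation kvec: vector_space "\<lambda>c u. free_scale (single 0 c) (u :: ('n::finite, 'k::field) mvec)"
  by unfold_locales
    (simp_all add: vec.scale_right_distrib vec.scale_left_distrib single_add mult_single)

lemma kvec_span_subset: "kvec.span S \<subseteq> vec.span S"
  by (intro kvec.span_minimal kvec.subspaceI vec.span_superset vec.span_zero vec.span_add vec.span_scale)

text \<open>
  Linear independence over the coefficient field, whose elements are the homogeneous polynomials of degree \<open>0\<close>.
\<close>

definition constant_independent :: "('n::finite, 'k::field) mvec list \<Rightarrow> bool" where
  "constant_independent hs \<longleftrightarrow>
     (\<forall>c. c \<in> vectors (length hs) \<longrightarrow> c \<in> homogeneous_vectors 0 \<longrightarrow> combination hs c = 0 \<longrightarrow> c = 0)"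

lemma constant_independentI:
  fixes hs :: "('n::finite, 'k::field) mvec list"
  assumes "\<And>t. t < length hs \<Longrightarrow> hs ! t \<notin> kvec.span (set (take t hs))"
  shows "constant_independent hs"
  unfolding constant_independent_def
proof (intro allI impI, rule ccontr)
  fix c :: "('n, 'k) mvec"
  assume c: "c \<in> vectors (length hs)" "c \<in> homogeneous_vectors 0" "combination hs c = 0" "c \<noteq> 0"
  define t where "t = Max (keys c)"
  have ne: "keys c \<noteq> {}" using c(4) by simp
  have t: "t \<in> keys c" unfolding t_def using ne by (intro Max_in) simp_all
  then have tl: "t < length hs" using c(1) by (auto simp: vectors_def)
  define a where "a k = lookup (lookup c k) 0" for k
  have a: "lookup c k = single 0 (a k)" for k
    using c(2) homogeneous_part_0[of "lookup c k"] by (simp add: homogeneous_vectors_def a_def)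
  have at: "a t \<noteq> 0" using t a[of t] by (auto simp: in_keys_iff)
  have above: "lookup c k = 0" if "t < k" for k
  proof (rule ccontr)
    assume "lookup c k \<noteq> 0"
    then have "k \<le> t" unfolding t_def by (intro Max_ge) (simp_all add: in_keys_iff)
    then show False using that by simp
  qed
  let ?s = "\<lambda>k. free_scale (single 0 (a k)) (hs ! k)"
  have "combination hs c = (\<Sum>k<Suc t. ?s k)"
    unfolding combination_def a[symmetric] using tl
    by (intro sum.mono_neutral_right) (auto simp: above)
  then have sum: "(\<Sum>k<t. ?s k) + ?s t = 0"
    using c(3) by simp
  have "(\<Sum>k<t. ?s k) \<in> kvec.span (set (take t hs))"
  proof (intro kvec.span_sum kvec.span_scale kvec.span_base)
    fix k assume "k \<in> {..<t}"
    then show "hs ! k \<in> set (take t hs)"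
      using tl by (auto simp: in_set_conv_nth intro!: exI[of _ k])
  qed
  then have "- (\<Sum>k<t. ?s k) \<in> kvec.span (set (take t hs))" by (rule kvec.span_neg)
  moreover have "- (\<Sum>k<t. ?s k) = ?s t" using sum by (simp add: neg_eq_iff_add_eq_0)
  ultimately have "?s t \<in> kvec.span (set (take t hs))" by (simp only:)
  then have "free_scale (single 0 (inverse (a t))) (?s t) \<in> kvec.span (set (take t hs))"
    by (rule kvec.span_scale)
  then have "hs ! t \<in> kvec.span (set (take t hs))"
    using at by (simp add: mult_single)
  then show False using assms[OF tl] by contradiction
qed

text \<open>
  A dependence relation over the field would put \<open>1\<close> into a colon ideal, but an ideal generated by linear forms
  contains no polynomial with a constant term.
\<close>

lemma linear_quotients_independent:
  assumes "linear_quotients hs"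
  shows "constant_independent hs"
proof (rule constant_independentI, rule notI)
  fix t assume t: "t < length hs" "hs ! t \<in> kvec.span (set (take t hs))"
  obtain L where L: "L \<subseteq> linear_forms" "colon (set (take t hs)) (hs ! t) = ideal_generated L"
    using assms t(1) unfolding linear_quotients_def linear_ideal_def by blast
  have "1 \<in> colon (set (take t hs)) (hs ! t)"
    using t(2) kvec_span_subset unfolding colon_def by auto
  then show False
    using linear_ideal_const_coeff[OF L(1), of 1] unfolding L(2) by simp
qed

lemma combination_combination:
  "combination hs (combination Q u) = combination (map (combination hs) Q) u"
  unfolding combination_def[of Q] combination_def[of "map (combination hs) Q"]
  by (simp add: combination_sum combination_scale)

lemma combination_units:
  assumes "length E = n" "\<And>t. t < n \<Longrightarrow> E ! t = single t 1" "u \<in> vectors n"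
  shows "combination E u = u"
proof -
  have "combination E u = (\<Sum>k<n. free_scale (lookup u k) (single k 1))"
    unfolding combination_def assms(1) using assms(2) by (intro sum.cong) simp_all
  then show ?thesis using vectors_expansion[OF assms(3)] by simp
qed

text \<open>
  The columns of \<open>Q\<close> are the coordinates of \<open>gs\<close> in terms of \<open>hs\<close>, and those of \<open>P\<close> the coordinates of \<open>hs\<close>
  in terms of \<open>gs\<close>.
\<close>

lemma transition_inverse:
  assumes "constant_independent gs"
    and Q: "map (combination hs) Q = gs" "set Q \<subseteq> homogeneous_vectors 0"
    and P: "map (combination gs) P = hs" "set P \<subseteq> homogeneous_vectors 0" "set P \<subseteq> vectors (length gs)"
    and u: "u \<in> vectors (length gs)"
  shows "combination P (combination Q u) = u"
proof -
  have len: "length Q = length gs" "length P = length hs"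
    using arg_cong[OF Q(1), of length] arg_cong[OF P(1), of length] by simp_all
  have "map (combination P) Q ! t = single t 1" if t: "t < length gs" for t
  proof -
    have Qt: "Q ! t \<in> homogeneous_vectors 0" using Q(2) nth_mem[of t Q] t len(1) by auto
    let ?v = "combination P (Q ! t) - single t 1"
    have "combination P (Q ! t) \<in> vectors (length gs)"
      by (rule combination_mem[OF subspace_vectors P(3)])
    moreover have "single t 1 \<in> vectors (length gs)"
      using t by (auto simp: vectors_iff lookup_single when_def)
    ultimately have "?v \<in> vectors (length gs)" by (rule vec.subspace_diff[OF subspace_vectors])
    moreover have "?v \<in> homogeneous_vectors 0"
      using combination_homogeneous[OF P(2) Qt] by (intro homogeneous_vectors_closed) auto
    moreover have "combination gs ?v = 0"
    proof -
      have "combination gs (combination P (Q ! t)) = combination hs (Q ! t)"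
        unfolding combination_combination P(1) ..
      also have "\<dots> = gs ! t" using nth_map[of t Q "combination hs"] t len(1) unfolding Q(1) by simp
      finally show ?thesis using t by (simp add: combination_diff combination_single)
    qed
    ultimately have "?v = 0" using assms(1) unfolding constant_independent_def by blast
    then show ?thesis using t len(1) by simp
  qed
  then show ?thesis
    unfolding combination_combination using len u by (intro combination_units[where n = "length gs"]) auto
qed

text \<open>
  Bases of the same homogeneous component differ by an invertible matrix \<open>Q\<close> of constants, which maps
  the syzygies of \<open>gs\<close> isomorphically to those of \<open>hs\<close> and preserves degrees and colon ideals.
\<close>

lemma syzygies_change_of_basis:
  fixes gs hs :: "('n::finite, 'k::field) mvec list"
  assumes gs: "set gs \<subseteq> homogeneous_vectors e" "linear_quotients gs"
    and hs: "set hs \<subseteq> homogeneous_vectors e" "constant_independent hs"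
    and span: "vec.span (set gs) = vec.span (set hs)"
  shows "\<exists>ks. set ks \<subseteq> homogeneous_vectors 1 \<and> linear_quotients ks \<and> vec.span (set ks) = syzygies hs"
proof -
  have transition: "\<exists>Q. map (combination hs) Q = gs \<and> set Q \<subseteq> homogeneous_vectors 0 \<and> set Q \<subseteq> vectors (length hs)"
    if h: "set hs \<subseteq> homogeneous_vectors e" and g: "set gs \<subseteq> homogeneous_vectors e"
      and sp: "vec.span (set gs) = vec.span (set hs)" for gs hs :: "('n, 'k) mvec list"
  proof -
    have "\<forall>v\<in>set gs. \<exists>u. u \<in> vectors (length hs) \<and> u \<in> homogeneous_vectors 0 \<and> combination hs u = v"
    proof
      fix v assume v: "v \<in> set gs"
      then have "v \<in> vec.span (set hs)" using sp vec.span_base by blast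
      then show "\<exists>u. u \<in> vectors (length hs) \<and> u \<in> homogeneous_vectors 0 \<and> combination hs u = v"
        using homogeneous_coordinates[OF h, of v e] g v by auto
    qed
    then obtain q where q: "\<forall>v\<in>set gs. q v \<in> vectors (length hs) \<and> q v \<in> homogeneous_vectors 0 \<and> combination hs (q v) = v"
      by metis
    then show ?thesis
      by (intro exI[of _ "map q gs"]) (auto simp: map_idI)
  qed
  obtain Q where Q: "map (combination hs) Q = gs" "set Q \<subseteq> homogeneous_vectors 0" "set Q \<subseteq> vectors (length hs)"
    using transition[OF hs(1) gs(1) span] by iprover
  obtain P where P: "map (combination gs) P = hs" "set P \<subseteq> homogeneous_vectors 0" "set P \<subseteq> vectors (length gs)"
    using transition[OF gs(1) hs(1) span[symmetric]] by iprover
  note PQ = transition_inverse[OF linear_quotients_independent[OF gs(2)] Q(1,2) P]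
  note QP = transition_inverse[OF hs(2) P(1,2) Q]
  have A: "combination hs (combination Q u) = combination gs u" for u
    unfolding combination_combination Q(1) ..
  have B: "combination gs (combination P u) = combination hs u" for u
    unfolding combination_combination P(1) ..
  have range_A: "combination Q u \<in> vectors (length hs)" for u
    by (rule combination_mem[OF subspace_vectors Q(3)])
  have range_B: "combination P u \<in> vectors (length gs)" for u
    by (rule combination_mem[OF subspace_vectors P(3)])
  obtain ks where ks: "set ks \<subseteq> homogeneous_vectors 1" "vec.span (set ks) = syzygies gs" "linear_quotients ks"
    using syzygies_linear_quotients[OF gs(2,1)] by iprover
  have span_A: "vec.span (combination Q ` X) = combination Q ` vec.span X" for X
    by (rule module_hom.span_image[OF module_hom_combination])
  have "set (map (combination Q) ks) \<subseteq> homogeneous_vectors 1"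
    using combination_homogeneous[OF Q(2)] ks(1) by fastforce
  moreover have "vec.span (set (map (combination Q) ks)) = syzygies hs"
  proof -
    have "combination Q ` syzygies gs = syzygies hs"
    proof
      show "combination Q ` syzygies gs \<subseteq> syzygies hs"
        using range_A A by (auto simp: syzygies_def)
      show "syzygies hs \<subseteq> combination Q ` syzygies gs"
      proof
        fix v assume v: "v \<in> syzygies hs"
        then have "combination Q (combination P v) = v" using QP by (simp add: syzygies_def)
        moreover have "combination P v \<in> syzygies gs" using v B range_B by (simp add: syzygies_def)
        ultimately show "v \<in> combination Q ` syzygies gs" by (metis image_eqI)
      qed
    qed
    then show ?thesis by (simp add: span_A ks(2))
  qed
  moreover have "linear_quotients (map (combination Q) ks)"
    unfolding linear_quotients_def length_map
  proof (intro allI impI)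
    fix t assume t: "t < length ks"
    have sub: "vec.span (set ks) \<subseteq> vectors (length gs)" unfolding ks(2) by (auto simp: syzygies_def)
    have sub_t: "vec.span (set (take t ks)) \<subseteq> vectors (length gs)"
      using sub vec.span_mono[OF set_take_subset[of t ks]] by (rule order_trans[rotated])
    have kt: "free_scale c (ks ! t) \<in> vectors (length gs)" for c
      using sub t by (intro subsetD[OF sub] vec.span_scale vec.span_base) simp
    have inj: "inj_on (combination Q) (vectors (length gs))"
      using PQ by (intro inj_on_inverseI[of _ "combination P"]) auto
    have "colon (set (take t (map (combination Q) ks))) (map (combination Q) ks ! t)
        = {c. combination Q (free_scale c (ks ! t)) \<in> combination Q ` vec.span (set (take t ks))}"
      unfolding colon_def take_map set_map span_A nth_map[OF t] combination_scale ..
    also have "\<dots> = colon (set (take t ks)) (ks ! t)"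
      unfolding colon_def using inj_on_image_mem_iff[OF inj kt sub_t] by (intro Collect_cong)
    finally show "linear_ideal (colon (set (take t (map (combination Q) ks))) (map (combination Q) ks ! t))"
      using ks(3) t by (simp only: linear_quotients_def)
  qed
  ultimately show ?thesis by blast
qed

section \<open>Extension of the coefficient field\<close>

locale field_extension =
  fixes emb :: "'k::field \<Rightarrow> 'l::field"
  assumes emb_zero [simp]: "emb 0 = 0" and emb_one [simp]: "emb 1 = 1"
    and emb_add: "emb (x + y) = emb x + emb y" and emb_mult: "emb (x * y) = emb x * emb y"
begin

sublocale ext: vector_space "\<lambda>c x. emb c * x"
  by unfold_locales (simp_all only: emb_one emb_add emb_mult distrib_left distrib_right mult.assoc mult_1_left)

text \<open>
  Functionals of the larger field, regarded as a vector space over the smaller one. Applied to all coefficients, they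
  are linear over the polynomial ring with coefficients in the smaller field (\<open>restrict_poly_mult\<close>), and so they map relations to relations.
\<close>

definition functional :: "('l \<Rightarrow> 'k) \<Rightarrow> bool" where
  "functional \<phi> \<longleftrightarrow> (\<forall>x y. \<phi> (x + y) = \<phi> x + \<phi> y) \<and> (\<forall>c x. \<phi> (emb c * x) = c * \<phi> x)"

lemma functionalD:
  assumes "functional \<phi>"
  shows "\<phi> (x + y) = \<phi> x + \<phi> y" "\<phi> (emb c * x) = c * \<phi> x" "\<phi> (x * emb c) = \<phi> x * c" "\<phi> 0 = 0"
proof -
  have add: "\<forall>x y. \<phi> (x + y) = \<phi> x + \<phi> y" and scale: "\<forall>c x. \<phi> (emb c * x) = c * \<phi> x"
    using assms unfolding functional_def by auto
  show "\<phi> (x + y) = \<phi> x + \<phi> y" by (rule add[rule_format])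
  show "\<phi> (emb c * x) = c * \<phi> x" by (rule scale[rule_format])
  show "\<phi> (x * emb c) = \<phi> x * c"
    using scale[rule_format, of c x] by (simp only: mult.commute)
  show "\<phi> 0 = 0" using scale[rule_format, of 0 0] by simp
qed

definition coordinate :: "'l \<Rightarrow> 'l \<Rightarrow> 'k" where
  "coordinate b x = ext.representation (ext.extend_basis {}) x b"

lemma coordinate:
  shows "functional (coordinate b)" "finite {b. coordinate b x \<noteq> 0}"
    and "finite S \<Longrightarrow> {b. coordinate b x \<noteq> 0} \<subseteq> S \<Longrightarrow> (\<Sum>b\<in>S. emb (coordinate b x) * b) = x"
proof -
  let ?B = "ext.extend_basis {}"
  have B: "ext.independent ?B" "x \<in> ext.span ?B" for x
    using ext.independent_extend_basis[OF ext.independent_empty] ext.span_extend_basis[OF ext.independent_empty] by auto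
  show "functional (coordinate b)"
    unfolding functional_def coordinate_def
    by (simp add: ext.representation_add[OF B(1) B(2) B(2)] ext.representation_scale[OF B(1) B(2)])
  show "finite {b. coordinate b x \<noteq> 0}"
    unfolding coordinate_def by (rule ext.finite_representation)
  assume S: "finite S" "{b. coordinate b x \<noteq> 0} \<subseteq> S"
  have "(\<Sum>b\<in>S. emb (coordinate b x) * b) = (\<Sum>b | coordinate b x \<noteq> 0. emb (coordinate b x) * b)"
    using S by (intro sum.mono_neutral_right) auto
  also have "\<dots> = x"
    unfolding coordinate_def by (rule ext.sum_nonzero_representation_eq[OF B])
  finally show "(\<Sum>b\<in>S. emb (coordinate b x) * b) = x" .
qed

lemma exists_retraction: "\<exists>\<rho>. functional \<rho> \<and> (\<forall>c. \<rho> (emb c) = c)"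
proof -
  have "\<exists>b. coordinate b 1 \<noteq> 0"
  proof (rule ccontr)
    assume "\<not> (\<exists>b. coordinate b 1 \<noteq> 0)"
    then have "{b. coordinate b 1 \<noteq> 0} \<subseteq> {}" by simp
    from coordinate(3)[OF finite.emptyI this] show False by simp
  qed
  then obtain b where b: "coordinate b 1 \<noteq> 0" by (rule exE)
  define \<rho> where "\<rho> x = coordinate b x / coordinate b 1" for x
  have \<rho>: "functional \<rho>"
    unfolding functional_def \<rho>_def using functionalD[OF coordinate(1)[of b]] by (simp add: add_divide_distrib)
  moreover have "\<rho> (emb c) = c" for c
    using functionalD(2)[OF \<rho>, of c 1] b by (simp add: \<rho>_def)
  ultimately show ?thesis by blast
qed

definition extend_poly :: "('n::finite, 'k) mpol \<Rightarrow> ('n, 'l) mpol" where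
  "extend_poly = Poly_Mapping.map emb"

definition extend :: "('n::finite, 'k) mvec \<Rightarrow> ('n, 'l) mvec" where
  "extend = Poly_Mapping.map extend_poly"

definition restrict_poly :: "('l \<Rightarrow> 'k) \<Rightarrow> ('n::finite, 'l) mpol \<Rightarrow> ('n, 'k) mpol" where
  "restrict_poly \<phi> = Poly_Mapping.map \<phi>"

definition restrict_vec :: "('l \<Rightarrow> 'k) \<Rightarrow> ('n::finite, 'l) mvec \<Rightarrow> ('n, 'k) mvec" where
  "restrict_vec \<phi> = Poly_Mapping.map (restrict_poly \<phi>)"

lemma lookup_extend_poly: "lookup (extend_poly p) m = emb (lookup p m)"
  by (simp add: extend_poly_def Poly_Mapping.map.rep_eq when_def)

lemma extend_poly_zero [simp]: "extend_poly 0 = 0"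
  by (rule poly_mapping_eqI) (simp add: lookup_extend_poly)

lemma extend_poly_add: "extend_poly (p + q) = extend_poly p + extend_poly q"
  by (rule poly_mapping_eqI) (simp add: lookup_extend_poly lookup_add emb_add)

lemma extend_poly_single: "extend_poly (single m c) = single m (emb c)"
  by (rule poly_mapping_eqI) (simp add: lookup_extend_poly lookup_single when_def)

lemma extend_poly_mult: "extend_poly (p * q) = extend_poly p * extend_poly q"
proof (induction p rule: monomial_induct)
  case (add m c p)
  have "extend_poly (single m c * q) = extend_poly (single m c) * extend_poly q"
    by (induction q rule: monomial_induct)
      (simp_all only: distrib_left extend_poly_add extend_poly_single mult_single emb_mult extend_poly_zero mult_zero_right)
  then show ?case by (simp only: distrib_right extend_poly_add add.IH)
qed simp

lemma extend_poly_prod: "finite A \<Longrightarrow> extend_poly (\<Prod>i\<in>A. p i) = (\<Prod>i\<in>A. extend_poly (p i))"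
proof (induction A rule: finite_induct)
  case empty
  have "extend_poly 1 = 1" using extend_poly_single[of 0 1] by simp
  then show ?case by simp
qed (simp add: extend_poly_mult)

lemma lookup_extend: "lookup (extend u) k = extend_poly (lookup u k)"
  by (simp add: extend_def Poly_Mapping.map.rep_eq when_def)

lemma extend_add: "extend (u + v) = extend u + extend v"
  by (rule poly_mapping_eqI) (simp add: lookup_extend lookup_add extend_poly_add)

lemma extend_zero [simp]: "extend 0 = 0"
  by (rule poly_mapping_eqI) (simp add: lookup_extend)

lemma extend_sum: "extend (sum f A) = (\<Sum>i\<in>A. extend (f i))"
  by (induction A rule: infinite_finite_induct) (simp_all add: extend_add)

lemma extend_scale: "extend (free_scale c u) = free_scale (extend_poly c) (extend u)"
  by (rule poly_mapping_eqI) (simp add: lookup_extend lookup_free_scale extend_poly_mult)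

lemma extend_single: "extend (single k p) = single k (extend_poly p)"
  by (rule poly_mapping_eqI) (simp add: lookup_extend lookup_single when_def)

lemma extend_vectors: "u \<in> vectors r \<Longrightarrow> extend u \<in> vectors r"
  by (simp add: vectors_iff lookup_extend)

lemma extend_poly_homogeneous: "p \<in> homogeneous_part j \<Longrightarrow> extend_poly p \<in> homogeneous_part j"
  unfolding homogeneous_part_iff lookup_extend_poly by (metis emb_zero)

lemma extend_homogeneous: "u \<in> homogeneous_vectors j \<Longrightarrow> extend u \<in> homogeneous_vectors j"
  by (simp add: homogeneous_vectors_def lookup_extend extend_poly_homogeneous)

lemma extend_combination: "combination (map extend hs) (extend u) = extend (combination hs u)"
  by (simp add: combination_def extend_sum extend_scale lookup_extend)

context
  fixes \<phi> assumes \<phi>: "functional \<phi>"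
begin

lemma lookup_restrict_poly: "lookup (restrict_poly \<phi> p) m = \<phi> (lookup p m)"
  by (simp add: restrict_poly_def Poly_Mapping.map.rep_eq when_def functionalD(4)[OF \<phi>])

lemma restrict_poly_zero: "restrict_poly \<phi> 0 = 0"
  by (rule poly_mapping_eqI) (simp add: lookup_restrict_poly functionalD(4)[OF \<phi>])

lemma restrict_poly_add: "restrict_poly \<phi> (p + q) = restrict_poly \<phi> p + restrict_poly \<phi> q"
  by (rule poly_mapping_eqI) (simp add: lookup_restrict_poly lookup_add functionalD(1)[OF \<phi>])

lemma restrict_poly_single: "restrict_poly \<phi> (single m c) = single m (\<phi> c)"
  by (rule poly_mapping_eqI) (simp add: lookup_restrict_poly lookup_single when_def functionalD(4)[OF \<phi>])

lemma restrict_poly_mult: "restrict_poly \<phi> (c * extend_poly p) = restrict_poly \<phi> c * p"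
proof (induction c rule: monomial_induct)
  case (add m a c)
  have "restrict_poly \<phi> (single m a * extend_poly p) = restrict_poly \<phi> (single m a) * p"
    by (induction p rule: monomial_induct)
      (simp_all only: distrib_left extend_poly_add restrict_poly_add extend_poly_single mult_single
        restrict_poly_single functionalD(3)[OF \<phi>] extend_poly_zero mult_zero_right restrict_poly_zero)
  then show ?case by (simp only: distrib_right restrict_poly_add add.IH)
qed (simp add: restrict_poly_zero)

lemma lookup_restrict_vec: "lookup (restrict_vec \<phi> u) k = restrict_poly \<phi> (lookup u k)"
  by (simp add: restrict_vec_def Poly_Mapping.map.rep_eq when_def restrict_poly_zero)

lemma restrict_vec_zero: "restrict_vec \<phi> 0 = 0"
  by (rule poly_mapping_eqI) (simp add: lookup_restrict_vec restrict_poly_zero)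

lemma restrict_vec_add: "restrict_vec \<phi> (u + v) = restrict_vec \<phi> u + restrict_vec \<phi> v"
  by (rule poly_mapping_eqI) (simp add: lookup_restrict_vec lookup_add restrict_poly_add)

lemma restrict_vec_sum: "restrict_vec \<phi> (sum f A) = (\<Sum>i\<in>A. restrict_vec \<phi> (f i))"
  by (induction A rule: infinite_finite_induct) (simp_all add: restrict_vec_add restrict_vec_zero)

lemma restrict_vec_scale: "restrict_vec \<phi> (free_scale c (extend u)) = free_scale (restrict_poly \<phi> c) u"
  by (rule poly_mapping_eqI) (simp add: lookup_restrict_vec lookup_free_scale lookup_extend restrict_poly_mult)

lemma restrict_vec_vectors: "u \<in> vectors r \<Longrightarrow> restrict_vec \<phi> u \<in> vectors r"
  by (simp add: vectors_iff lookup_restrict_vec restrict_poly_zero)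

lemma restrict_vec_homogeneous:
  fixes u :: "('n::finite, 'l) mvec"
  assumes "u \<in> homogeneous_vectors j"
  shows "restrict_vec \<phi> u \<in> homogeneous_vectors j"
proof -
  have "restrict_poly \<phi> p \<in> homogeneous_part j" if "p \<in> homogeneous_part j" for p :: "('n, 'l) mpol"
    using that functionalD(4)[OF \<phi>] unfolding homogeneous_part_iff lookup_restrict_poly by metis
  then show ?thesis using assms by (simp add: homogeneous_vectors_def lookup_restrict_vec)
qed

lemma restrict_vec_combination:
  "restrict_vec \<phi> (combination (map extend hs) u) = combination hs (restrict_vec \<phi> u)"
  by (simp add: combination_def restrict_vec_sum restrict_vec_scale lookup_restrict_vec)

lemma restrict_vec_mem:
  assumes N: "vec.subspace N" and u: "u \<in> vec.span (extend ` N)"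
  shows "restrict_vec \<phi> u \<in> N"
  using u
proof (induction rule: vec.span_induct_alt)
  case base
  show ?case using vec.subspace_0[OF N] by (simp add: restrict_vec_zero)
next
  case (step c x y)
  then obtain n where n: "n \<in> N" "x = extend n" by blast
  show ?case
    unfolding restrict_vec_add n(2) restrict_vec_scale
    by (intro vec.subspace_add[OF N] vec.subspace_scale[OF N] n(1) step(2))
qed

end

text \<open>
  Expand all coefficients of \<open>u\<close> in a basis of the larger field. The coordinates that belong to one basis element
  form a restriction of \<open>u\<close>, and only finitely many basis elements occur.
\<close>

lemma finitely_many_restrictions:
  fixes u :: "('n::finite, 'l) mvec"
  shows "\<exists>\<Phi>. finite \<Phi> \<and> (\<forall>\<phi>\<in>\<Phi>. functional \<phi>) \<and> u \<in> vec.span (extend ` (\<lambda>\<phi>. restrict_vec \<phi> u) ` \<Phi>)"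
proof -
  define S where "S = (\<Union>k\<in>keys u. \<Union>m\<in>keys (lookup u k).
     {b. coordinate b (lookup (lookup u k) m) \<noteq> 0})"
  have S: "finite S"
    unfolding S_def using coordinate(2) by (intro finite_UN_I finite_keys)
  have zero: "coordinate b 0 = 0" for b by (rule functionalD(4)[OF coordinate(1)])
  have coef: "(\<Sum>b\<in>S. emb (coordinate b x) * b) = x"
    if "x = lookup (lookup u k) m" for x k m
  proof (rule coordinate(3)[OF S])
    show "{b. coordinate b x \<noteq> 0} \<subseteq> S"
    proof (cases "x = 0")
      case False
      then have "m \<in> keys (lookup u k)" "k \<in> keys u"
        using that by (auto simp: in_keys_iff)
      then show ?thesis unfolding S_def that by blast
    qed (simp add: zero)
  qed
  let ?r = "\<lambda>b. restrict_vec (coordinate b) u"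
  have "u = (\<Sum>b\<in>S. free_scale (single 0 b) (extend (?r b)))"
  proof (rule poly_mapping_eqI, rule poly_mapping_eqI)
    fix k m
    have "lookup (lookup (\<Sum>b\<in>S. free_scale (single 0 b) (extend (?r b))) k) m
      = (\<Sum>b\<in>S. b * emb (coordinate b (lookup (lookup u k) m)))"
      by (simp add: lookup_sum lookup_free_scale lookup_extend lookup_extend_poly
          lookup_restrict_vec[OF coordinate(1)] lookup_restrict_poly[OF coordinate(1)])
    also have "\<dots> = lookup (lookup u k) m"
      using coef[OF refl] by (simp only: mult.commute)
    finally show "lookup (lookup u k) m = lookup
      (lookup (\<Sum>b\<in>S. free_scale (single 0 b) (extend (?r b))) k) m" ..
  qed
  also have "\<dots> \<in> vec.span (extend ` (\<lambda>\<phi>. restrict_vec \<phi> u) ` coordinate ` S)"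
    by (intro vec.span_sum vec.span_scale vec.span_base imageI)
  finally have "u \<in> vec.span (extend ` (\<lambda>\<phi>. restrict_vec \<phi> u) ` coordinate ` S)" .
  then show ?thesis
    using S coordinate(1) by (intro exI[of _ "coordinate ` S"]) auto
qed

lemma mem_extensionI:
  assumes "\<And>\<phi>. functional \<phi> \<Longrightarrow> restrict_vec \<phi> u \<in> N"
  shows "u \<in> vec.span (extend ` N)"
proof -
  obtain \<Phi> where \<Phi>: "\<forall>\<phi>\<in>\<Phi>. functional \<phi>" "u \<in> vec.span (extend ` (\<lambda>\<phi>. restrict_vec \<phi> u) ` \<Phi>)"
    using finitely_many_restrictions[of u] by iprover
  have "extend ` (\<lambda>\<phi>. restrict_vec \<phi> u) ` \<Phi> \<subseteq> extend ` N"
    using \<Phi>(1) assms by (intro image_mono) blast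
  then show ?thesis using \<Phi>(2) vec.span_mono by blast
qed

lemma span_extend_span: "vec.span (extend ` vec.span X) = vec.span (extend ` X)"
proof
  have "extend x \<in> vec.span (extend ` X)" if "x \<in> vec.span X" for x
    using that
  proof (induction rule: vec.span_induct_alt)
    case (step c x y)
    show ?case
      unfolding extend_add extend_scale
      by (intro vec.span_add vec.span_scale vec.span_base imageI step)
  qed (simp add: vec.span_zero)
  then show "vec.span (extend ` vec.span X) \<subseteq> vec.span (extend ` X)"
    by (intro vec.span_minimal vec.subspace_span) blast
  show "vec.span (extend ` X) \<subseteq> vec.span (extend ` vec.span X)"
    by (intro vec.span_mono image_mono vec.span_superset)
qed

text \<open>
  All functionals together detect whether a vector is a syzygy, and they map syzygies over the larger field to
  syzygies over the smaller one.
\<close>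

lemma syzygies_extend: "syzygies (map extend hs) = vec.span (extend ` syzygies hs)"
proof
  show "syzygies (map extend hs) \<subseteq> vec.span (extend ` syzygies hs)"
  proof
    fix u assume u: "u \<in> syzygies (map extend hs)"
    show "u \<in> vec.span (extend ` syzygies hs)"
    proof (rule mem_extensionI)
      fix \<phi> assume \<phi>: "functional \<phi>"
      have "combination hs (restrict_vec \<phi> u) = restrict_vec \<phi> (combination (map extend hs) u)"
        by (rule restrict_vec_combination[OF \<phi>, symmetric])
      then show "restrict_vec \<phi> u \<in> syzygies hs"
        using u restrict_vec_vectors[OF \<phi>, of u "length hs"] by (simp add: syzygies_def restrict_vec_zero[OF \<phi>])
    qed
  qed
  have "extend ` syzygies hs \<subseteq> syzygies (map extend hs)"
    using extend_vectors by (auto simp: syzygies_def extend_combination)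
  then show "vec.span (extend ` syzygies hs) \<subseteq> syzygies (map extend hs)"
    by (intro vec.span_minimal subspace_syzygies)
qed

lemma constant_independent_extend:
  assumes "constant_independent hs"
  shows "constant_independent (map extend hs)"
  unfolding constant_independent_def
proof (intro allI impI)
  fix c :: "('a, 'l) mvec"
  assume c: "c \<in> vectors (length (map extend hs))" "c \<in> homogeneous_vectors 0" "combination (map extend hs) c = 0"
  have "c \<in> vec.span (extend ` {0})"
  proof (rule mem_extensionI)
    fix \<phi> assume \<phi>: "functional \<phi>"
    have "combination hs (restrict_vec \<phi> c) = restrict_vec \<phi> (combination (map extend hs) c)"
      by (rule restrict_vec_combination[OF \<phi>, symmetric])
    then have "combination hs (restrict_vec \<phi> c) = 0"
      using c(3) by (simp add: restrict_vec_zero[OF \<phi>])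
    moreover have "restrict_vec \<phi> c \<in> vectors (length hs)"
      using restrict_vec_vectors[OF \<phi> c(1)] by simp
    ultimately have "restrict_vec \<phi> c = 0"
      using restrict_vec_homogeneous[OF \<phi> c(2)] assms unfolding constant_independent_def by blast
    then show "restrict_vec \<phi> c \<in> {0}" by simp
  qed
  moreover have "vec.span (extend ` {0}) \<subseteq> {0 :: ('a, 'l) mvec}"
    by (rule vec.span_minimal) (auto simp: vec.subspace_def)
  ultimately show "c = 0" by blast
qed

text \<open>
  The generators \<open>hs\<close> are minimal, and after the extension of the field their span has a
  generating sequence with linear quotients.
\<close>

definition linear_after_extension :: "int \<Rightarrow> ('n::finite, 'k) mvec list \<Rightarrow> bool" where
  "linear_after_extension e hs \<longleftrightarrow> set hs \<subseteq> homogeneous_vectors e \<and> constant_independent hs \<and>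
     (\<exists>gs :: ('n, 'l) mvec list. set gs \<subseteq> homogeneous_vectors e \<and> linear_quotients gs \<and>
        vec.span (set gs) = vec.span (extend ` set hs))"

text \<open>
  Each generator over the larger field is a combination of finitely many of its own restrictions, which lie in \<open>N\<close>
  and have the same degree. So finitely many homogeneous elements of \<open>N\<close> generate its extension; a functional that
  retracts the larger field to the smaller one then shows that they generate \<open>N\<close>.
\<close>

lemma descend_generators:
  fixes N :: "('n::finite, 'k) mvec set" and gs :: "('n, 'l) mvec list"
  assumes N: "vec.subspace N"
    and gs: "set gs \<subseteq> homogeneous_vectors e" "linear_quotients gs" "vec.span (set gs) = vec.span (extend ` N)"
  shows "\<exists>hs. linear_after_extension e hs \<and> vec.span (set hs) = N"
proof -
  have "\<forall>g\<in>set gs. \<exists>S. finite S \<and> S \<subseteq> N \<inter> homogeneous_vectors e \<and> g \<in> vec.span (extend ` S)"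
  proof
    fix g assume g: "g \<in> set gs"
    obtain \<Phi> where \<Phi>: "finite \<Phi>" "\<forall>\<phi>\<in>\<Phi>. functional \<phi>" "g \<in> vec.span (extend ` (\<lambda>\<phi>. restrict_vec \<phi> g) ` \<Phi>)"
      using finitely_many_restrictions[of g] by iprover
    have "g \<in> vec.span (extend ` N)" using g gs(3) vec.span_base by blast
    then have "restrict_vec \<phi> g \<in> N \<inter> homogeneous_vectors e" if "\<phi> \<in> \<Phi>" for \<phi>
      using \<Phi>(2) that restrict_vec_mem[OF _ N, of \<phi> g] restrict_vec_homogeneous[of \<phi> g e] g gs(1) by blast
    then have "(\<lambda>\<phi>. restrict_vec \<phi> g) ` \<Phi> \<subseteq> N \<inter> homogeneous_vectors e"
      by (rule image_subsetI)
    then show "\<exists>S. finite S \<and> S \<subseteq> N \<inter> homogeneous_vectors e \<and> g \<in> vec.span (extend ` S)"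
      using \<Phi>(1,3) by (intro exI[of _ "(\<lambda>\<phi>. restrict_vec \<phi> g) ` \<Phi>"]) simp
  qed
  then obtain T where T: "\<forall>g\<in>set gs. finite (T g) \<and> T g \<subseteq> N \<inter> homogeneous_vectors e \<and> g \<in> vec.span (extend ` T g)"
    by metis
  define S where "S = (\<Union>g\<in>set gs. T g)"
  have S: "finite S" "S \<subseteq> N" "S \<subseteq> homogeneous_vectors e"
    using T by (auto simp: S_def)
  have "set gs \<subseteq> vec.span (extend ` S)"
  proof
    fix g assume g: "g \<in> set gs"
    then have "extend ` T g \<subseteq> extend ` S" by (auto simp: S_def)
    then show "g \<in> vec.span (extend ` S)" using T g vec.span_mono by blast
  qed
  then have "vec.span (extend ` N) \<subseteq> vec.span (extend ` S)"
    unfolding gs(3)[symmetric] by (intro vec.span_minimal vec.subspace_span)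
  then have ext: "extend n \<in> vec.span (extend ` S)" if "n \<in> N" for n
    using that vec.span_base by blast
  have span_S: "vec.span S = N"
  proof
    show "vec.span S \<subseteq> N" using S(2) N by (rule vec.span_minimal)
    obtain \<rho> where \<rho>: "functional \<rho>" "\<forall>c. \<rho> (emb c) = c" using exists_retraction by iprover
    have retract: "restrict_vec \<rho> (extend u) = u" for u :: "('n, 'k) mvec"
      by (rule poly_mapping_eqI, rule poly_mapping_eqI)
        (simp add: lookup_restrict_vec[OF \<rho>(1)] lookup_extend lookup_restrict_poly[OF \<rho>(1)] lookup_extend_poly \<rho>(2))
    show "N \<subseteq> vec.span S"
    proof
      fix n assume "n \<in> N"
      then have "extend n \<in> vec.span (extend ` vec.span S)"
        using ext by (simp only: span_extend_span)
      then have "restrict_vec \<rho> (extend n) \<in> vec.span S"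
        by (rule restrict_vec_mem[OF \<rho>(1) vec.subspace_span])
      then show "n \<in> vec.span S" by (simp only: retract)
    qed
  qed
  obtain xs where xs: "set xs = S" using S(1) finite_list by blast
  obtain hs where hs: "kvec.span (set hs) = kvec.span (set xs)"
    "\<forall>t<length hs. \<exists>s<length xs. hs ! t = xs ! s \<and>
        kvec.span (set (take t hs)) = kvec.span (set (take s xs)) \<and> xs ! s \<notin> kvec.span (set (take s xs))"
    using module.prune_generators[OF kvec.module_axioms, of xs] by iprover
  have hs_t: "hs ! t \<in> S \<and> hs ! t \<notin> kvec.span (set (take t hs))" if t: "t < length hs" for t
  proof -
    obtain s where s: "s < length xs" "hs ! t = xs ! s"
      "kvec.span (set (take t hs)) = kvec.span (set (take s xs))" "xs ! s \<notin> kvec.span (set (take s xs))"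
      using hs(2) t by iprover
    show ?thesis unfolding s(2,3) using s(4) nth_mem[OF s(1)] xs by simp
  qed
  have hs_S: "set hs \<subseteq> S" using hs_t unfolding subset_iff in_set_conv_nth by blast
  have span_hs: "vec.span (set hs) = N"
  proof
    show "vec.span (set hs) \<subseteq> N" using vec.span_mono[OF hs_S] span_S by simp
    have "S \<subseteq> kvec.span (set hs)" unfolding hs(1) xs by (rule kvec.span_superset)
    then have "S \<subseteq> vec.span (set hs)" using kvec_span_subset by (rule order_trans)
    then show "N \<subseteq> vec.span (set hs)"
      unfolding span_S[symmetric] by (intro vec.span_minimal vec.subspace_span)
  qed
  have "constant_independent hs" using hs_t by (intro constant_independentI) blast
  moreover have "set hs \<subseteq> homogeneous_vectors e" using hs_S S(3) by (rule order_trans)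
  moreover have "vec.span (set gs) = vec.span (extend ` set hs)"
    unfolding gs(3) span_hs[symmetric] by (rule span_extend_span)
  ultimately have "linear_after_extension e hs"
    unfolding linear_after_extension_def using gs(1,2) by blast
  then show ?thesis using span_hs by blast
qed

lemma linear_after_extension_syzygies:
  assumes "linear_after_extension e hs"
  shows "\<exists>ks. linear_after_extension 1 ks \<and> vec.span (set ks) = syzygies hs"
proof -
  obtain gs :: "('a, 'l) mvec list" where gs: "set gs \<subseteq> homogeneous_vectors e" "linear_quotients gs"
    "vec.span (set gs) = vec.span (extend ` set hs)"
    using assms unfolding linear_after_extension_def by iprover
  have hs: "set hs \<subseteq> homogeneous_vectors e" "constant_independent hs"
    using assms unfolding linear_after_extension_def by iprover+
  have "set (map extend hs) \<subseteq> homogeneous_vectors e"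
    using hs(1) extend_homogeneous by auto
  then obtain ks :: "('a, 'l) mvec list" where ks: "set ks \<subseteq> homogeneous_vectors 1" "linear_quotients ks"
    "vec.span (set ks) = syzygies (map extend hs)"
    using syzygies_change_of_basis[OF gs(1,2) _ constant_independent_extend[OF hs(2)]] gs(3) by auto
  show ?thesis
    using descend_generators[OF subspace_syzygies ks(1,2) ks(3)[unfolded syzygies_extend]] .
qed

text \<open>
  The lists \<open>H i\<close> are the columns of the matrices of a minimal linear resolution.
\<close>

lemma exists_linear_syzygy_sequence:
  fixes L :: "nat \<Rightarrow> ('n::finite, 'k) mpol set"
  assumes inf: "infinite (UNIV :: 'l set)" and I: "finite I" "I \<noteq> {}"
    and L: "\<And>i. i \<in> I \<Longrightarrow> L i \<subseteq> linear_forms"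
  shows "\<exists>H :: nat \<Rightarrow> ('n, 'k) mvec list. set (H 0) \<subseteq> homogeneous_vectors (int (card I)) \<and>
     vec.span (set (H 0)) = single 0 ` ring.span {\<Prod>i\<in>I. l i | l. \<forall>i\<in>I. l i \<in> L i} \<and>
     (\<forall>i. set (H (Suc i)) \<subseteq> homogeneous_vectors 1 \<and> vec.span (set (H (Suc i))) = syzygies (H i))"
proof -
  let ?P = "{\<Prod>i\<in>I. l i | l. \<forall>i\<in>I. l i \<in> L i}"
  let ?Q = "{\<Prod>i\<in>I. l i | l. \<forall>i\<in>I. l i \<in> extend_poly ` L i}"
  let ?N = "vec.span (single 0 ` ?P)"
  have L': "extend_poly ` L i \<subseteq> linear_forms" if "i \<in> I" for i
    using L[OF that] extend_poly_homogeneous by blast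
  obtain gs :: "('n, 'l) mvec list" where gs: "set gs \<subseteq> homogeneous_vectors (int (card I))" "linear_quotients gs"
    "vec.span (set gs) = single 0 ` ring.span ?Q"
    using product_linear_quotients[OF inf I, of "\<lambda>i. extend_poly ` L i"] L' by blast
  have PQ: "extend_poly ` ?P = ?Q"
  proof (intro equalityI subsetI)
    fix x assume "x \<in> extend_poly ` ?P"
    then obtain l where l: "x = extend_poly (\<Prod>i\<in>I. l i)" "\<forall>i\<in>I. l i \<in> L i" by blast
    then have "x = (\<Prod>i\<in>I. extend_poly (l i))" "\<forall>i\<in>I. extend_poly (l i) \<in> extend_poly ` L i"
      using extend_poly_prod[OF I(1)] by auto
    then show "x \<in> ?Q" by blast
  next
    fix x assume "x \<in> ?Q"
    then obtain l where l: "x = (\<Prod>i\<in>I. l i)" "\<forall>i\<in>I. l i \<in> extend_poly ` L i" by blast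
    from l(2) have "\<forall>i\<in>I. \<exists>k. k \<in> L i \<and> l i = extend_poly k" by blast
    then obtain k where k: "\<forall>i\<in>I. k i \<in> L i \<and> l i = extend_poly (k i)" by metis
    then have "x = extend_poly (\<Prod>i\<in>I. k i)"
      unfolding extend_poly_prod[OF I(1)] l(1) by (intro prod.cong) auto
    then show "x \<in> extend_poly ` ?P" using k by blast
  qed
  have "extend ` single 0 ` ?P = single 0 ` extend_poly ` ?P"
    unfolding image_image extend_single ..
  then have sp: "vec.span (set gs) = vec.span (extend ` ?N)"
    unfolding span_extend_span gs(3) PQ span_single_image[symmetric] by (simp only:)
  then obtain hs where hs: "linear_after_extension (int (card I)) hs" "vec.span (set hs) = ?N"
    using descend_generators[OF vec.subspace_span gs(1,2) sp] by iprover
  have "\<exists>H. \<forall>i. (linear_after_extension (if i = 0 then int (card I) else 1) (H i) \<and> (i = 0 \<longrightarrow> vec.span (set (H i)) = ?N))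
      \<and> vec.span (set (H (Suc i))) = syzygies (H i)"
  proof (rule dependent_nat_choice)
    show "\<exists>x. linear_after_extension (if 0 = 0 then int (card I) else 1) x \<and> (0 = 0 \<longrightarrow> vec.span (set x) = ?N)"
      using hs by auto
    fix x and i :: nat
    assume x: "linear_after_extension (if i = 0 then int (card I) else 1) x \<and> (i = 0 \<longrightarrow> vec.span (set x) = ?N)"
    from linear_after_extension_syzygies[OF conjunct1[OF x]]
    show "\<exists>y. (linear_after_extension (if Suc i = 0 then int (card I) else 1) y \<and> (Suc i = 0 \<longrightarrow> vec.span (set y) = ?N))
       \<and> vec.span (set y) = syzygies x"
      by simp
  qed
  then obtain H where H: "\<forall>i. (linear_after_extension (if i = 0 then int (card I) else 1) (H i) \<and> (i = 0 \<longrightarrow> vec.span (set (H i)) = ?N))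
      \<and> vec.span (set (H (Suc i))) = syzygies (H i)" by (rule exE)
  have "set (H i) \<subseteq> homogeneous_vectors (if i = 0 then int (card I) else 1)" for i
    using spec[OF H, of i] unfolding linear_after_extension_def by iprover
  note homog = this
  show ?thesis
  proof (intro exI[of _ H] conjI allI)
    show "set (H 0) \<subseteq> homogeneous_vectors (int (card I))" using homog[of 0] by simp
    show "vec.span (set (H 0)) = single 0 ` ring.span ?P"
      using spec[OF H, of 0] by (simp only: span_single_image simp_thms)
    fix i
    show "set (H (Suc i)) \<subseteq> homogeneous_vectors 1" using homog[of "Suc i"] by simp
    show "vec.span (set (H (Suc i))) = syzygies (H i)" using spec[OF H, of i] by (simp only: simp_thms)
  qed
qed

end

lemma field_extension_fract: "field_extension (\<lambda>c :: 'k::field. Fract [:c:] 1)"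
  by unfold_locales (simp_all add: Zero_fract_def One_fract_def one_pCons mult.commute)

lemma infinite_fract: "infinite (UNIV :: 'k::field poly fract set)"
proof -
  have "inj (\<lambda>n. Fract (monom 1 n) (1 :: 'k poly))"
    by (rule injI) (simp add: eq_fract monom_eq_iff')
  then have "infinite (range (\<lambda>n. Fract (monom 1 n) (1 :: 'k poly)))"
    by (simp add: finite_image_iff)
  then show ?thesis
    using finite_subset[OF subset_UNIV] by (rule contrapos_nn)
qed

section \<open>Maps between free modules\<close>

lemma hom_expansion:
  assumes "module_hom free_scale scale \<phi>" "u \<in> vectors r"
  shows "\<phi> u = (\<Sum>k<r. scale (lookup u k) (\<phi> (single k 1)))"
proof -
  have "\<phi> (\<Sum>k<r. free_scale (lookup u k) (single k 1))
      = (\<Sum>k<r. scale (lookup u k) (\<phi> (single k 1)))"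
    by (simp only: module_hom.sum[OF assms(1)] module_hom.scale[OF assms(1)])
  then show ?thesis using vectors_expansion[OF assms(2)] by simp
qed

lemma hom_eqI:
  assumes "module_hom free_scale scale \<phi>" "module_hom free_scale scale \<psi>" "u \<in> vectors r"
    and "\<And>k. k < r \<Longrightarrow> \<phi> (single k 1) = \<psi> (single k 1)"
  shows "\<phi> u = \<psi> u"
  unfolding hom_expansion[OF assms(1,3)] hom_expansion[OF assms(2,3)]
  using assms(4) by (intro sum.cong) simp_all

lemma free_hom_diff:
  assumes f: "module_hom free_scale free_scale f" and g: "module_hom free_scale free_scale g"
  shows "module_hom free_scale free_scale (\<lambda>u. f u - g u)"
  by (intro module_hom.intro module_hom_axioms.intro module_free_scale)
    (simp_all add: module_hom.add[OF f] module_hom.add[OF g] module_hom.scale[OF f] module_hom.scale[OF g]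
      vec.scale_right_diff_distrib)

lemma free_component_iff:
  "u \<in> free_component F i j \<longleftrightarrow> u \<in> vectors (rank F i) \<and>
     (\<forall>k<rank F i. lookup u k \<in> homogeneous_part (j - shift F i k))"
  by (simp add: free_component_def vectors_def)

lemma free_component_vectors: "u \<in> free_component F i j \<Longrightarrow> u \<in> vectors (rank F i)"
  by (simp add: free_component_iff)

lemma free_component_closed:
  shows free_component_zero: "0 \<in> free_component F i j"
    and free_component_add: "u \<in> free_component F i j \<Longrightarrow> v \<in> free_component F i j \<Longrightarrow> u + v \<in> free_component F i j"
    and free_component_diff: "u \<in> free_component F i j \<Longrightarrow> v \<in> free_component F i j \<Longrightarrow> u - v \<in> free_component F i j"
    and free_component_neg: "u \<in> free_component F i j \<Longrightarrow> - u \<in> free_component F i j"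
  by (simp_all add: free_component_iff vectors_iff lookup_add lookup_minus)

lemma free_component_sum:
  "(\<And>k. k \<in> A \<Longrightarrow> f k \<in> free_component F i j) \<Longrightarrow> sum f A \<in> free_component F i j"
  by (induction A rule: infinite_finite_induct) (simp_all add: free_component_zero free_component_add)

lemma basis_mem_free_component:
  "k < rank F i \<Longrightarrow> single k 1 \<in> free_component F i (shift F i k)"
  by (auto simp: free_component_iff vectors_iff lookup_single when_def)

text \<open>Matrices of degree-preserving maps, as lists of the images of the basis vectors.\<close>

definition graded_matrix ::
  "('n::finite, 'k::field, 'm) free_complex \<Rightarrow> nat \<Rightarrow> ('n, 'k, 'm) free_complex \<Rightarrow> nat \<Rightarrow> ('n, 'k) mvec list \<Rightarrow> bool" where
  "graded_matrix F i G l A \<longleftrightarrow> length A = rank F i \<and> (\<forall>k<rank F i. A ! k \<in> free_component G l (shift F i k))"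

lemma graded_matrix_map:
  assumes "graded_matrix F i G l A" "u \<in> free_component F i j"
  shows "combination A u \<in> free_component G l j"
  unfolding combination_def
proof (rule free_component_sum)
  fix k assume "k \<in> {..<length A}"
  then have k: "k < rank F i" using assms(1) by (simp add: graded_matrix_def)
  have A: "A ! k \<in> free_component G l (shift F i k)"
    using assms(1) k by (simp add: graded_matrix_def)
  have u: "lookup u k \<in> homogeneous_part (j - shift F i k)"
    using assms(2) k by (simp add: free_component_iff)
  have "lookup u k * lookup (A ! k) m \<in> homogeneous_part (j - shift G l m)"
    if m: "m < rank G l" for m
  proof -
    have "lookup (A ! k) m \<in> homogeneous_part (shift F i k - shift G l m)"
      using A m by (simp add: free_component_iff)
    from homogeneous_part_mult[OF u this] show ?thesis by simp
  qed
  then show "free_scale (lookup u k) (A ! k) \<in> free_component G l j"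
    using A by (simp add: free_component_iff vectors_iff lookup_free_scale)
qed

text \<open>
  Free modules are projective in the category of graded modules.
\<close>

lemma exists_graded_lift:
  assumes \<phi>: "module_hom free_scale scale \<phi>" and T: "module_hom free_scale scale T"
    and lift: "\<And>j u. u \<in> free_component F i j \<Longrightarrow> \<phi> u \<in> T ` free_component G l j"
  shows "\<exists>A. graded_matrix F i G l A \<and> (\<forall>u \<in> vectors (rank F i). T (combination A u) = \<phi> u)"
proof -
  have "\<exists>y. y \<in> free_component G l (shift F i k) \<and> T y = \<phi> (single k 1)" if k: "k < rank F i" for k
    using lift[OF basis_mem_free_component[OF k]] by auto
  then obtain y where y: "\<forall>k<rank F i. y k \<in> free_component G l (shift F i k) \<and> T (y k) = \<phi> (single k 1)"
    by metis
  let ?A = "map y [0..<rank F i]"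
  have "T (combination ?A u) = \<phi> u" if u: "u \<in> vectors (rank F i)" for u
  proof -
    have "module_hom free_scale scale (T \<circ> combination ?A)"
      by (rule module_hom_compose[OF module_hom_combination T])
    then have "(T \<circ> combination ?A) u = \<phi> u"
      by (rule hom_eqI[OF _ \<phi> u]) (use y in \<open>simp add: combination_single\<close>)
    then show ?thesis by simp
  qed
  moreover have "graded_matrix F i G l ?A" using y by (simp add: graded_matrix_def)
  ultimately show ?thesis by blast
qed

section \<open>Comparison of graded free resolutions\<close>

definition cycles :: "('n::finite, 'k::field, 'm::zero) free_complex \<Rightarrow> nat \<Rightarrow> int \<Rightarrow> ('n, 'k) mvec set" where
  "cycles F i j = {u \<in> free_component F i j. case i of 0 \<Rightarrow> aug F u = 0 | Suc l \<Rightarrow> diff F l u = 0}"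

lemma resolutionD:
  assumes "graded_free_resolution scale M F"
  shows "module_hom free_scale scale (aug F)" "module_hom free_scale free_scale (diff F i)"
    and "aug F ` free_component F 0 j = M j" "diff F i ` free_component F (Suc i) j = cycles F i j"
  using assms unfolding graded_free_resolution_def cycles_def
  by (cases i; simp)+

lemma cycles_free: "u \<in> cycles F i j \<Longrightarrow> u \<in> free_component F i j"
  by (simp add: cycles_def)

lemma diff_mem_cycles:
  "graded_free_resolution scale M F \<Longrightarrow> u \<in> free_component F (Suc i) j \<Longrightarrow> diff F i u \<in> cycles F i j"
  using resolutionD(4) by blast

lemma exists_chain_map:
  assumes F: "graded_free_resolution scale M F" and G: "graded_free_resolution scale M G"
  shows "\<exists>A. (\<forall>i. graded_matrix F i G i (A i)) \<and>
     (\<forall>j. \<forall>u\<in>free_component F 0 j. aug G (combination (A 0) u) = aug F u) \<and>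
     (\<forall>i j. \<forall>u\<in>free_component F (Suc i) j. diff G i (combination (A (Suc i)) u) = combination (A i) (diff F i u))"
proof -
  define P where "P i B \<longleftrightarrow> graded_matrix F i G i B \<and> (\<forall>j. \<forall>u\<in>cycles F i j. combination B u \<in> cycles G i j) \<and>
     (i = 0 \<longrightarrow> (\<forall>j. \<forall>u\<in>free_component F 0 j. aug G (combination B u) = aug F u))" for i B
  define Q where "Q i B C \<longleftrightarrow>
     (\<forall>j. \<forall>u\<in>free_component F (Suc i) j. diff G i (combination C u) = combination B (diff F i u))" for i B C
  have "\<exists>A. \<forall>i. P i (A i) \<and> Q i (A i) (A (Suc i))"
  proof (rule dependent_nat_choice)
    have "aug F u \<in> aug G ` free_component G 0 j" if "u \<in> free_component F 0 j" for j u
      using that unfolding resolutionD(3)[OF G] resolutionD(3)[OF F, symmetric] by (rule imageI)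
    then obtain B where B: "graded_matrix F 0 G 0 B" "\<forall>u\<in>vectors (rank F 0). aug G (combination B u) = aug F u"
      using exists_graded_lift[OF resolutionD(1)[OF F] resolutionD(1)[OF G], where F = F and i = 0 and G = G and l = 0] by iprover
    have "combination B u \<in> cycles G 0 j" if u: "u \<in> cycles F 0 j" for u j
      using graded_matrix_map[OF B(1) cycles_free[OF u]] bspec[OF B(2) free_component_vectors[OF cycles_free[OF u]]] u
      by (simp add: cycles_def)
    moreover have "aug G (combination B u) = aug F u" if "u \<in> free_component F 0 j" for u j
      using B(2) free_component_vectors[OF that] by blast
    ultimately show "\<exists>B. P 0 B" using B(1) unfolding P_def by blast
  next
    fix B i assume "P i B"
    then have B: "graded_matrix F i G i B" "\<And>u j. u \<in> cycles F i j \<Longrightarrow> combination B u \<in> cycles G i j"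
      by (simp_all add: P_def)
    have hom: "module_hom free_scale free_scale (combination B \<circ> diff F i)"
      by (rule module_hom_compose[OF resolutionD(2)[OF F] module_hom_combination])
    have "(combination B \<circ> diff F i) u \<in> diff G i ` free_component G (Suc i) j" if "u \<in> free_component F (Suc i) j" for j u
      unfolding resolutionD(4)[OF G] o_apply by (rule B(2)[OF diff_mem_cycles[OF F that]])
    then obtain C where C: "graded_matrix F (Suc i) G (Suc i) C"
      "\<forall>u\<in>vectors (rank F (Suc i)). diff G i (combination C u) = (combination B \<circ> diff F i) u"
      using exists_graded_lift[OF hom resolutionD(2)[OF G], where F = F and i = "Suc i" and G = G and l = "Suc i"] by iprover
    have Q: "diff G i (combination C u) = combination B (diff F i u)" if "u \<in> free_component F (Suc i) j" for u j
      using C(2) free_component_vectors[OF that] by simp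
    have "combination C u \<in> cycles G (Suc i) j" if u: "u \<in> cycles F (Suc i) j" for u j
    proof -
      have "diff F i u = 0" using u by (simp add: cycles_def)
      then have "diff G i (combination C u) = 0" using Q[OF cycles_free[OF u]] by simp
      then show ?thesis
        using graded_matrix_map[OF C(1) cycles_free[OF u]] by (simp add: cycles_def)
    qed
    then show "\<exists>C. P (Suc i) C \<and> Q i B C"
      using C(1) Q unfolding P_def Q_def by blast
  qed
  then obtain A where A: "\<forall>i. P i (A i) \<and> Q i (A i) (A (Suc i))" by (rule exE)
  show ?thesis
  proof (intro exI[of _ A] conjI allI ballI)
    fix i j u
    show "graded_matrix F i G i (A i)" using spec[OF A, of i] by (simp only: P_def)
    show "aug G (combination (A 0) u) = aug F u" if "u \<in> free_component F 0 j"
      using spec[OF A, of 0] that by (auto simp only: P_def)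
    show "diff G i (combination (A (Suc i)) u) = combination (A i) (diff F i u)" if "u \<in> free_component F (Suc i) j"
      using spec[OF A, of i] that by (auto simp only: Q_def)
  qed
qed

text \<open>
  The homotopy is built one step at a time: what \<open>\<gamma>\<close> minus the identity minus the previous homotopy map leaves over
  is a cycle, hence a boundary.
\<close>

lemma exists_homotopy:
  assumes F: "graded_free_resolution scale M F"
    and hom: "\<And>i. module_hom free_scale free_scale (\<gamma> i)"
    and deg: "\<And>i j u. u \<in> free_component F i j \<Longrightarrow> \<gamma> i u \<in> free_component F i j"
    and aug: "\<And>j u. u \<in> free_component F 0 j \<Longrightarrow> aug F (\<gamma> 0 u) = aug F u"
    and chain: "\<And>i j u. u \<in> free_component F (Suc i) j \<Longrightarrow> diff F i (\<gamma> (Suc i) u) = \<gamma> i (diff F i u)"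
  shows "\<exists>S. (\<forall>i. graded_matrix F i F (Suc i) (S i)) \<and>
     (\<forall>j. \<forall>u\<in>free_component F 0 j. diff F 0 (combination (S 0) u) = \<gamma> 0 u - u) \<and>
     (\<forall>i j. \<forall>u\<in>free_component F (Suc i) j.
        diff F (Suc i) (combination (S (Suc i)) u) = \<gamma> (Suc i) u - u - combination (S i) (diff F i u))"
proof -
  define P where "P i B \<longleftrightarrow> graded_matrix F i F (Suc i) B \<and>
     (\<forall>j. \<forall>u\<in>cycles F i j. diff F i (combination B u) = \<gamma> i u - u) \<and>
     (i = 0 \<longrightarrow> (\<forall>j. \<forall>u\<in>free_component F 0 j. diff F 0 (combination B u) = \<gamma> 0 u - u))" for i B
  define Q where "Q i B C \<longleftrightarrow> (\<forall>j. \<forall>u\<in>free_component F (Suc i) j.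
        diff F (Suc i) (combination C u) = \<gamma> (Suc i) u - u - combination B (diff F i u))" for i B C
  have ident: "module_hom free_scale free_scale (\<lambda>u :: ('a, 'b) mvec. u)"
    by (rule vec.module_hom_ident)
  note aug_diff = module_hom.diff[OF resolutionD(1)[OF F]]
  note diff_diff = module_hom.diff[OF resolutionD(2)[OF F]]
  have "\<exists>S. \<forall>i. P i (S i) \<and> Q i (S i) (S (Suc i))"
  proof (rule dependent_nat_choice)
    have h: "module_hom free_scale free_scale (\<lambda>u. \<gamma> 0 u - u)"
      by (rule free_hom_diff[OF hom ident])
    have "\<gamma> 0 u - u \<in> diff F 0 ` free_component F (Suc 0) j" if "u \<in> free_component F 0 j" for j u
      unfolding resolutionD(4)[OF F] cycles_def using that deg[OF that] aug[OF that]
      by (simp add: free_component_diff aug_diff)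
    then obtain B where B: "graded_matrix F 0 F (Suc 0) B" "\<forall>u\<in>vectors (rank F 0). diff F 0 (combination B u) = \<gamma> 0 u - u"
      using exists_graded_lift[OF h resolutionD(2)[OF F], where F = F and i = 0 and G = F and l = "Suc 0"] by iprover
    have "diff F 0 (combination B u) = \<gamma> 0 u - u" if "u \<in> free_component F 0 j" for u j
      using B(2) free_component_vectors[OF that] by blast
    then show "\<exists>B. P 0 B" using B(1) cycles_free unfolding P_def by blast
  next
    fix B i assume "P i B"
    then have B: "graded_matrix F i F (Suc i) B" "\<And>u j. u \<in> cycles F i j \<Longrightarrow> diff F i (combination B u) = \<gamma> i u - u"
      by (simp_all add: P_def)
    have h: "module_hom free_scale free_scale (\<lambda>u. \<gamma> (Suc i) u - u - combination B (diff F i u))"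
      using module_hom_compose[OF resolutionD(2)[OF F] module_hom_combination]
      by (intro free_hom_diff hom ident) (simp add: o_def)
    have "\<gamma> (Suc i) u - u - combination B (diff F i u) \<in> diff F (Suc i) ` free_component F (Suc (Suc i)) j"
      if u: "u \<in> free_component F (Suc i) j" for j u
    proof -
      have du: "diff F i u \<in> cycles F i j" by (rule diff_mem_cycles[OF F u])
      have "combination B (diff F i u) \<in> free_component F (Suc i) j"
        by (rule graded_matrix_map[OF B(1) cycles_free[OF du]])
      moreover have "diff F i (\<gamma> (Suc i) u - u - combination B (diff F i u)) = 0"
        by (simp add: diff_diff chain[OF u] B(2)[OF du])
      ultimately show ?thesis
        unfolding resolutionD(4)[OF F] cycles_def using deg[OF u] u by (simp add: free_component_diff)
    qed
    then obtain C where C: "graded_matrix F (Suc i) F (Suc (Suc i)) C"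
      "\<forall>u\<in>vectors (rank F (Suc i)). diff F (Suc i) (combination C u) = \<gamma> (Suc i) u - u - combination B (diff F i u)"
      using exists_graded_lift[OF h resolutionD(2)[OF F], where F = F and i = "Suc i" and G = F and l = "Suc (Suc i)"] by iprover
    have Q: "diff F (Suc i) (combination C u) = \<gamma> (Suc i) u - u - combination B (diff F i u)"
      if "u \<in> free_component F (Suc i) j" for u j
      using C(2) free_component_vectors[OF that] by blast
    have "diff F (Suc i) (combination C u) = \<gamma> (Suc i) u - u" if "u \<in> cycles F (Suc i) j" for u j
      using Q[OF cycles_free[OF that]] that by (simp add: cycles_def)
    then show "\<exists>C. P (Suc i) C \<and> Q i B C"
      using C(1) Q unfolding P_def Q_def by blast
  qed
  then obtain S where S: "\<forall>i. P i (S i) \<and> Q i (S i) (S (Suc i))" by (rule exE)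
  show ?thesis
  proof (intro exI[of _ S] conjI allI ballI)
    fix i j u
    show "graded_matrix F i F (Suc i) (S i)" using spec[OF S, of i] by (simp only: P_def)
    show "diff F 0 (combination (S 0) u) = \<gamma> 0 u - u" if "u \<in> free_component F 0 j"
      using spec[OF S, of 0] that by (auto simp only: P_def)
    show "diff F (Suc i) (combination (S (Suc i)) u) = \<gamma> (Suc i) u - u - combination (S i) (diff F i u)"
      if "u \<in> free_component F (Suc i) j"
      using spec[OF S, of i] that by (auto simp only: Q_def)
  qed
qed

section \<open>Reduction modulo the variables\<close>

definition reduce :: "('n::finite, 'k::field) mvec \<Rightarrow> nat \<Rightarrow>\<^sub>0 'k" where
  "reduce = Poly_Mapping.map (\<lambda>p. lookup p 0)"

definition const_vec :: "(nat \<Rightarrow>\<^sub>0 'k) \<Rightarrow> ('n::finite, 'k::field) mvec" where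
  "const_vec = Poly_Mapping.map (single 0)"

lemma lookup_reduce: "lookup (reduce u) k = lookup (lookup u k) 0"
  by (simp add: reduce_def Poly_Mapping.map.rep_eq when_def)

lemma lookup_const_vec: "lookup (const_vec v) k = single 0 (lookup v k)"
  by (simp add: const_vec_def Poly_Mapping.map.rep_eq when_def)

lemma reduce_simps [simp]:
  "reduce 0 = 0" "reduce (u - v) = reduce u - reduce v" "reduce (- u) = - reduce u"
  "reduce (const_vec w) = w"
  by (rule poly_mapping_eqI, simp add: lookup_reduce lookup_minus lookup_const_vec)+

lemma const_vec_simps [simp]: "const_vec 0 = 0" "const_vec (v - w) = const_vec v - const_vec w"
  by (rule poly_mapping_eqI, simp add: lookup_const_vec lookup_minus single_diff)+

lemma tensor_diff_eq: "tensor_diff F i v = reduce (diff F i (const_vec v))"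
  by (simp add: tensor_diff_def reduce_def const_vec_def)

text \<open>
  A map of free modules induces a map of the reductions modulo the ideal of the variables.
\<close>

lemma reduce_hom_cong:
  fixes u v :: "('n::finite, 'k::field) mvec"
  assumes \<phi>: "module_hom free_scale free_scale \<phi>" and "u \<in> vectors r" "v \<in> vectors r" "reduce u = reduce v"
  shows "reduce (\<phi> u) = reduce (\<phi> v)"
proof (rule poly_mapping_eqI)
  fix l
  have *: "lookup (reduce (\<phi> w)) l
      = (\<Sum>k<r. lookup (reduce w) k * lookup (reduce (\<phi> (single k 1))) l)"
    if "w \<in> vectors r" for w
    by (subst hom_expansion[OF \<phi> that]) (simp add: lookup_reduce lookup_sum lookup_free_scale const_coeff_mult)
  show "lookup (reduce (\<phi> u)) l = lookup (reduce (\<phi> v)) l"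
    using *[OF assms(2)] *[OF assms(3)] assms(4) by simp
qed

lemma const_vec_vectors: "u \<in> vectors r \<Longrightarrow> const_vec (reduce u) \<in> vectors r"
  by (simp add: vectors_iff lookup_const_vec lookup_reduce)

lemma tensor_component_iff:
  "v \<in> tensor_component F i j \<longleftrightarrow> (\<forall>k. lookup v k \<noteq> 0 \<longrightarrow> k < rank F i \<and> shift F i k = j)"
  by (auto simp: tensor_component_def subset_iff in_keys_iff)

lemma const_vec_free_component:
  "v \<in> tensor_component F i j \<Longrightarrow> const_vec v \<in> free_component F i j"
  unfolding tensor_component_iff free_component_iff vectors_iff lookup_const_vec
  by (metis const_homogeneous diff_self homogeneous_part_closed(1) not_le single_zero)

lemma reduce_tensor_component:
  assumes "u \<in> free_component F i j"
  shows "reduce u \<in> tensor_component F i j"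
  unfolding tensor_component_iff lookup_reduce
proof (intro allI impI)
  fix k assume k: "lookup (lookup u k) 0 \<noteq> 0"
  then have "lookup u k \<noteq> 0" by auto
  then have r: "k < rank F i" using assms unfolding free_component_iff vectors_iff by (meson not_le)
  then have "lookup u k \<in> homogeneous_part (j - shift F i k)"
    using assms by (simp add: free_component_iff)
  then show "k < rank F i \<and> shift F i k = j"
    using const_coeff_homogeneous k r by fastforce
qed

lemma tensor_component_diff:
  "v \<in> tensor_component F i j \<Longrightarrow> w \<in> tensor_component F i j \<Longrightarrow> v - w \<in> tensor_component F i j"
  unfolding tensor_component_iff lookup_minus by (metis diff_self)

lemma tensor_boundary_reduce:
  assumes F: "graded_free_resolution scale M F" and u: "u \<in> free_component F (Suc i) j"
  shows "reduce (diff F i u) \<in> tensor_boundaries F i j"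
proof -
  have "reduce (diff F i u) = tensor_diff F i (reduce u)"
    unfolding tensor_diff_eq using free_component_vectors[OF u]
    by (intro reduce_hom_cong[OF resolutionD(2)[OF F]] const_vec_vectors) simp_all
  then show ?thesis
    using reduce_tensor_component[OF u] unfolding tensor_boundaries_def by blast
qed

lemma tensor_boundaries_diff:
  assumes F: "graded_free_resolution scale M F" and "v \<in> tensor_boundaries F i j" "w \<in> tensor_boundaries F i j"
  shows "v - w \<in> tensor_boundaries F i j"
proof -
  obtain a b where ab: "a \<in> tensor_component F (Suc i) j" "b \<in> tensor_component F (Suc i) j"
    "v = tensor_diff F i a" "w = tensor_diff F i b"
    using assms(2,3) unfolding tensor_boundaries_def by blast
  have "v - w = tensor_diff F i (a - b)"
    unfolding ab tensor_diff_eq by (simp add: module_hom.diff[OF resolutionD(2)[OF F]])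
  then show ?thesis
    using tensor_component_diff[OF ab(1,2)] unfolding tensor_boundaries_def by blast
qed

lemma zero_tensor_cycles:
  assumes F: "graded_free_resolution scale M F"
  shows "0 \<in> tensor_cycles F i j"
proof -
  have "tensor_diff F l 0 = 0" for l
    by (simp add: tensor_diff_eq module_hom.zero[OF resolutionD(2)[OF F]])
  then show ?thesis by (cases i) (simp_all add: tensor_component_iff)
qed

lemma homology_trivial_iff:
  assumes F: "graded_free_resolution scale M F"
  shows "is_singleton (homology F i j) \<longleftrightarrow> tensor_cycles F i j \<subseteq> tensor_boundaries F i j"
proof
  let ?Z = "tensor_cycles F i j" and ?B = "tensor_boundaries F i j"
  let ?r = "{(u, v). u \<in> ?Z \<and> v \<in> ?Z \<and> u - v \<in> ?B}"
  have zero: "0 \<in> ?Z" by (rule zero_tensor_cycles[OF F])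
  have "reduce (diff F i 0) \<in> ?B" by (rule tensor_boundary_reduce[OF F free_component_zero])
  then have zero_B: "0 \<in> ?B" by (simp add: module_hom.zero[OF resolutionD(2)[OF F]])
  {
    assume "is_singleton (homology F i j)"
    then obtain X where X: "?Z // ?r = {X}" unfolding homology_def is_singleton_def by blast
    show "?Z \<subseteq> ?B"
    proof
      fix v assume v: "v \<in> ?Z"
      have "?r `` {v} = X" "?r `` {0} = X"
        using X quotientI[OF v, of ?r] quotientI[OF zero, of ?r] by simp_all
      moreover have "0 \<in> ?r `` {0}" using zero zero_B by simp
      ultimately have "0 \<in> ?r `` {v}" by simp
      then show "v \<in> ?B" by simp
    qed
  next
    assume sub: "?Z \<subseteq> ?B"
    have "?r `` {v} = ?Z" if "v \<in> ?Z" for v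
    proof -
      have "v - w \<in> ?B" if "w \<in> ?Z" for w
        using sub that \<open>v \<in> ?Z\<close> by (intro tensor_boundaries_diff[OF F]) blast+
      then show ?thesis using that by auto
    qed
    then have "?Z // ?r = {?Z}" unfolding quotient_def using zero by auto
    then show "is_singleton (homology F i j)" unfolding homology_def by (simp only: is_singletonI)
  }
qed

text \<open>
  Write the identity of \<open>F\<close> up to homotopy as a composition \<open>F \<rightarrow> G \<rightarrow> F\<close>. If \<open>G\<close> has no
  generator of degree \<open>j\<close> in step \<open>i\<close>, the reduction of the composition vanishes there.
\<close>

lemma homology_trivial_of_resolution:
  assumes F: "graded_free_resolution scale M F" and G: "graded_free_resolution scale M G"
    and no_gen: "\<And>k. k < rank G i \<Longrightarrow> shift G i k \<noteq> j"
  shows "is_singleton (homology F i j)"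
  unfolding homology_trivial_iff[OF F]
proof
  obtain A where A0: "\<forall>i. graded_matrix F i G i (A i)"
    "\<forall>j. \<forall>u\<in>free_component F 0 j. aug G (combination (A 0) u) = aug F u"
    "\<forall>i j. \<forall>u\<in>free_component F (Suc i) j. diff G i (combination (A (Suc i)) u) = combination (A i) (diff F i u)"
    using exists_chain_map[OF F G] by iprover
  obtain B where B0: "\<forall>i. graded_matrix G i F i (B i)"
    "\<forall>j. \<forall>u\<in>free_component G 0 j. aug F (combination (B 0) u) = aug G u"
    "\<forall>i j. \<forall>u\<in>free_component G (Suc i) j. diff F i (combination (B (Suc i)) u) = combination (B i) (diff G i u)"
    using exists_chain_map[OF G F] by iprover
  note A = A0[rule_format] and B = B0[rule_format]
  define \<gamma> where "\<gamma> i u = combination (B i) (combination (A i) u)" for i u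
  note A' = graded_matrix_map[OF A(1)] and B' = graded_matrix_map[OF B(1)]
  have "\<exists>S. (\<forall>i. graded_matrix F i F (Suc i) (S i)) \<and>
     (\<forall>j. \<forall>u\<in>free_component F 0 j. diff F 0 (combination (S 0) u) = \<gamma> 0 u - u) \<and>
     (\<forall>i j. \<forall>u\<in>free_component F (Suc i) j.
        diff F (Suc i) (combination (S (Suc i)) u) = \<gamma> (Suc i) u - u - combination (S i) (diff F i u))"
  proof (rule exists_homotopy[OF F])
    show "module_hom free_scale free_scale (\<gamma> i)" for i
      using module_hom_compose[OF module_hom_combination[of "A i"] module_hom_combination[of "B i"]]
      by (simp add: o_def \<gamma>_def[abs_def])
    fix j u
    show "\<gamma> i u \<in> free_component F i j" if "u \<in> free_component F i j" for i
      unfolding \<gamma>_def by (rule B'[OF A'[OF that]])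
    show "aug F (\<gamma> 0 u) = aug F u" if "u \<in> free_component F 0 j"
      unfolding \<gamma>_def B(2)[OF A'[OF that]] by (rule A(2)[OF that])
    show "diff F i (\<gamma> (Suc i) u) = \<gamma> i (diff F i u)" if "u \<in> free_component F (Suc i) j" for i
      unfolding \<gamma>_def B(3)[OF A'[OF that]] A(3)[OF that] ..
  qed
  then obtain S where S0: "\<forall>i. graded_matrix F i F (Suc i) (S i)"
    "\<forall>j. \<forall>u\<in>free_component F 0 j. diff F 0 (combination (S 0) u) = \<gamma> 0 u - u"
    "\<forall>i j. \<forall>u\<in>free_component F (Suc i) j.
        diff F (Suc i) (combination (S (Suc i)) u) = \<gamma> (Suc i) u - u - combination (S i) (diff F i u)"
    by iprover
  note S = S0[rule_format]
  note S' = graded_matrix_map[OF S(1)]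
  fix v assume v: "v \<in> tensor_cycles F i j"
  then have "v \<in> tensor_component F i j" by (cases i) simp_all
  then have u: "const_vec v \<in> free_component F i j" by (rule const_vec_free_component)
  let ?u = "const_vec v"
  have zero: "(0 :: ('a, 'b) mvec) \<in> vectors r" for r by (simp add: vectors_iff)
  have "reduce (combination (A i) ?u) = 0"
  proof (rule poly_mapping_eqI)
    fix k
    have "reduce (combination (A i) ?u) \<in> tensor_component G i j"
      by (rule reduce_tensor_component[OF A'[OF u]])
    then show "lookup (reduce (combination (A i) ?u)) k = lookup 0 k"
      using no_gen unfolding tensor_component_iff by auto
  qed
  then have "reduce (\<gamma> i ?u) = reduce (combination (B i) 0)"
    unfolding \<gamma>_def using free_component_vectors[OF A'[OF u]] zero
    by (intro reduce_hom_cong[OF module_hom_combination]) simp_all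
  then have \<gamma>: "reduce (\<gamma> i ?u) = 0" by simp
  have "\<exists>w \<in> free_component F (Suc i) j. reduce (diff F i w) = v"
  proof (cases i)
    case 0
    have "reduce (diff F 0 (- combination (S 0) ?u)) = v"
      using S(2)[of ?u j] u \<gamma> unfolding 0 by (simp add: module_hom.neg[OF resolutionD(2)[OF F]])
    then show ?thesis
      using S'[OF u] unfolding 0 by (intro bexI[of _ "- combination (S 0) ?u"] free_component_neg)
  next
    case (Suc l)
    have "reduce (diff F l ?u) = 0"
      using v unfolding Suc by (simp add: tensor_diff_eq)
    moreover have "diff F l ?u \<in> vectors (rank F l)"
      using diff_mem_cycles[OF F, of ?u l j] u unfolding Suc
      by (intro free_component_vectors[of _ F l j] cycles_free)
    ultimately have "reduce (combination (S l) (diff F l ?u)) = reduce (combination (S l) 0)"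
      using zero by (intro reduce_hom_cong[OF module_hom_combination]) simp_all
    then have "reduce (diff F i (- combination (S i) ?u)) = v"
      using S(3)[of ?u l j] u \<gamma> unfolding Suc by (simp add: module_hom.neg[OF resolutionD(2)[OF F]])
    then show ?thesis
      using S'[OF u] by (intro bexI[of _ "- combination (S i) ?u"] free_component_neg)
  qed
  then show "v \<in> tensor_boundaries F i j"
    using tensor_boundary_reduce[OF F] by blast
qed

text \<open>
  Modulo the variables, the elements of degree \<open>d\<close> of the free module that covers \<open>M\<close> lose nothing: generators of lower
  degree map to zero in \<open>M\<close>, and those of higher degree have zero coefficients.
\<close>

lemma homology_initial_nontrivial:
  assumes F: "graded_free_resolution scale M F"
    and M: "\<And>j. j < d \<Longrightarrow> M j = {0}" "f \<in> M d" "f \<noteq> 0"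
  shows "\<not> is_singleton (homology F 0 d)"
proof
  assume "is_singleton (homology F 0 d)"
  then have sub: "tensor_component F 0 d \<subseteq> tensor_boundaries F 0 d"
    by (simp add: homology_trivial_iff[OF F])
  have "Modules.module scale" by (rule module_hom.axioms(2)[OF resolutionD(1)[OF F]])
  then interpret Modules.module scale .
  have aug_reduce: "aug F u = aug F (const_vec (reduce u))" if u: "u \<in> free_component F 0 d" for u
  proof -
    have uv: "u \<in> vectors (rank F 0)" by (rule free_component_vectors[OF u])
    have "scale (lookup u k) (aug F (single k 1))
        = scale (lookup (const_vec (reduce u)) k) (aug F (single k 1))"
      if k: "k < rank F 0" for k
    proof -
      have uk: "lookup u k \<in> homogeneous_part (d - shift F 0 k)"
        using u k by (simp add: free_component_iff)
      consider "shift F 0 k < d" | "shift F 0 k = d" | "shift F 0 k > d" by linarith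
      then show ?thesis
      proof cases
        case 1
        have "aug F (single k 1) \<in> M (shift F 0 k)"
          using basis_mem_free_component[OF k] resolutionD(3)[OF F] by blast
        then show ?thesis using M(1)[OF 1] by simp
      next
        case 2
        then show ?thesis
          using uk homogeneous_part_0[of "lookup u k"] by (simp add: lookup_const_vec lookup_reduce)
      next
        case 3
        then have "lookup u k \<in> {0}"
          using uk by (subst (asm) homogeneous_part_neg) simp_all
        then show ?thesis by (simp add: lookup_const_vec lookup_reduce)
      qed
    qed
    then show ?thesis
      unfolding hom_expansion[OF resolutionD(1)[OF F] uv]
        hom_expansion[OF resolutionD(1)[OF F] const_vec_vectors[OF uv]]
      by (intro sum.cong) simp_all
  qed
  obtain u where u: "u \<in> free_component F 0 d" "f = aug F u"
    using M(2) unfolding resolutionD(3)[OF F, symmetric] by blast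
  then obtain w where w: "w \<in> tensor_component F (Suc 0) d" "reduce u = tensor_diff F 0 w"
    using sub reduce_tensor_component[OF u(1)] unfolding tensor_boundaries_def by blast
  have x: "diff F 0 (const_vec w) \<in> cycles F 0 d"
    by (rule diff_mem_cycles[OF F const_vec_free_component[OF w(1)]])
  have "f = aug F (const_vec (reduce (diff F 0 (const_vec w))))"
    using aug_reduce[OF u(1)] u(2) w(2) by (simp add: tensor_diff_eq)
  also have "\<dots> = aug F (diff F 0 (const_vec w))"
    using aug_reduce[OF cycles_free[OF x]] by simp
  also have "\<dots> = 0" using x by (simp add: cycles_def)
  finally show False using M(3) by simp
qed

section \<open>Linear resolutions\<close>

text \<open>
  The first coordinate is taken in the augmentation because an ideal is represented by vectors with
  a single entry.
\<close>

definition linear_complex :: "int \<Rightarrow> (nat \<Rightarrow> ('n::finite, 'k::field) mvec list) \<Rightarrow> ('n, 'k, ('n, 'k) mpol) free_complex" where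
  "linear_complex d H = \<lparr>rank = (\<lambda>i. length (H i)), shift = (\<lambda>i k. d + int i),
     diff = (\<lambda>i. combination (H (Suc i))), aug = (\<lambda>u. lookup (combination (H 0) u) 0)\<rparr>"

lemma free_component_linear:
  "free_component (linear_complex d H) i j = vectors (length (H i)) \<inter> homogeneous_vectors (j - (d + int i))"
proof (intro equalityI subsetI)
  fix u assume "u \<in> free_component (linear_complex d H) i j"
  then have u: "u \<in> vectors (length (H i))"
    "\<And>k. k < length (H i) \<Longrightarrow> lookup u k \<in> homogeneous_part (j - (d + int i))"
    by (simp_all add: free_component_iff linear_complex_def)
  have "lookup u k \<in> homogeneous_part (j - (d + int i))" for k
    using u by (cases "k < length (H i)") (simp_all add: vectors_iff)
  then show "u \<in> vectors (length (H i)) \<inter> homogeneous_vectors (j - (d + int i))"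
    using u(1) by (simp add: homogeneous_vectors_def)
qed (simp add: free_component_iff linear_complex_def homogeneous_vectors_def)

lemma linear_complex_resolution:
  fixes H :: "nat \<Rightarrow> ('n::finite, 'k::field) mvec list"
  assumes H0: "set (H 0) \<subseteq> homogeneous_vectors d" "vec.span (set (H 0)) = single 0 ` J"
    and HS: "\<And>i. set (H (Suc i)) \<subseteq> homogeneous_vectors 1" "\<And>i. vec.span (set (H (Suc i))) = syzygies (H i)"
  shows "graded_free_resolution (*) (ideal_components J) (linear_complex d H)"
proof -
  let ?F = "linear_complex d H"
  have aug_hom: "module_hom free_scale (*) (aug ?F)"
    by (intro module_hom.intro module_hom_axioms.intro module_free_scale module_mult)
      (simp_all add: linear_complex_def combination_add combination_scale lookup_add lookup_free_scale)
  have in_J: "\<exists>p\<in>J. combination (H 0) u = single 0 p" for u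
    using combination_mem[OF vec.subspace_span vec.span_superset, of "H 0" u] unfolding H0(2) by blast
  have aug_zero: "aug ?F u = 0 \<longleftrightarrow> combination (H 0) u = 0" for u
    using in_J[of u] by (auto simp: linear_complex_def)
  have exact: "combination (H (Suc i)) ` (vectors (length (H (Suc i))) \<inter> homogeneous_vectors (e - 1))
      = {u \<in> vectors (length (H i)) \<inter> homogeneous_vectors e. combination (H i) u = 0}" for i e
  proof (intro equalityI subsetI)
    fix x assume "x \<in> combination (H (Suc i)) ` (vectors (length (H (Suc i))) \<inter> homogeneous_vectors (e - 1))"
    then obtain u where u: "u \<in> homogeneous_vectors (e - 1)" "x = combination (H (Suc i)) u" by blast
    have "x \<in> syzygies (H i)"
      unfolding u(2) HS(2)[symmetric] by (rule combination_mem[OF vec.subspace_span vec.span_superset])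
    moreover have "x \<in> homogeneous_vectors e"
      using combination_homogeneous[OF HS(1) u(1)] u(2) by simp
    ultimately show "x \<in> {u \<in> vectors (length (H i)) \<inter> homogeneous_vectors e. combination (H i) u = 0}"
      by (simp add: syzygies_def)
  next
    fix x assume "x \<in> {u \<in> vectors (length (H i)) \<inter> homogeneous_vectors e. combination (H i) u = 0}"
    then have "x \<in> vec.span (set (H (Suc i)))" "x \<in> homogeneous_vectors e"
      unfolding HS(2) by (simp_all add: syzygies_def)
    from homogeneous_coordinates[OF HS(1) this]
    show "x \<in> combination (H (Suc i)) ` (vectors (length (H (Suc i))) \<inter> homogeneous_vectors (e - 1))"
      by blast
  qed
  have aug_image: "aug ?F ` free_component ?F 0 j = ideal_components J j" for j
  proof (intro equalityI subsetI)
    fix x assume "x \<in> aug ?F ` free_component ?F 0 j"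
    then obtain u where u: "u \<in> homogeneous_vectors (j - d)" "x = aug ?F u"
      unfolding free_component_linear by auto
    obtain p where p: "p \<in> J" "combination (H 0) u = single 0 p" using in_J by blast
    have "combination (H 0) u \<in> homogeneous_vectors j"
      using combination_homogeneous[OF H0(1) u(1)] by simp
    then have "x \<in> homogeneous_part j" using u(2) by (simp add: linear_complex_def homogeneous_vectors_def)
    moreover have "x = p" using u(2) p(2) by (simp add: linear_complex_def)
    ultimately show "x \<in> ideal_components J j" using p(1) by (simp add: ideal_components_def)
  next
    fix x assume x: "x \<in> ideal_components J j"
    then have "single 0 x \<in> vec.span (set (H 0))" unfolding H0(2) by (simp add: ideal_components_def)
    moreover have "single 0 x \<in> homogeneous_vectors j"
      using x by (intro homogeneous_vectors_closed(2)) (simp add: ideal_components_def)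
    ultimately obtain u where u: "u \<in> vectors (length (H 0))" "u \<in> homogeneous_vectors (j - d)"
      "combination (H 0) u = single 0 x"
      using homogeneous_coordinates[OF H0(1)] by blast
    then have "x = aug ?F u" by (simp add: linear_complex_def)
    then show "x \<in> aug ?F ` free_component ?F 0 j"
      unfolding free_component_linear using u(1,2) by auto
  qed
  show ?thesis
    unfolding graded_free_resolution_def aug_zero
  proof (intro conjI allI aug_hom aug_image)
    show "module_hom free_scale free_scale (diff ?F i)" for i
      by (simp add: linear_complex_def module_hom_combination)
    show "diff ?F 0 ` free_component ?F 1 j = {u \<in> free_component ?F 0 j. combination (H 0) u = 0}" for j
    proof -
      have e: "j - (d + int 1) = j - (d + int 0) - 1" by simp
      have "combination (H (Suc 0)) ` (vectors (length (H (Suc 0))) \<inter> homogeneous_vectors (j - (d + int 1)))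
          = {u \<in> vectors (length (H 0)) \<inter> homogeneous_vectors (j - (d + int 0)). combination (H 0) u = 0}"
        unfolding e by (rule exact)
      then show ?thesis unfolding free_component_linear by (simp only: linear_complex_def free_complex.simps One_nat_def)
    qed
    show "diff ?F (Suc i) ` free_component ?F (Suc (Suc i)) j = {u \<in> free_component ?F (Suc i) j. diff ?F i u = 0}" for i j
    proof -
      have e: "j - (d + int (Suc (Suc i))) = j - (d + int (Suc i)) - 1" by simp
      have "combination (H (Suc (Suc i))) ` (vectors (length (H (Suc (Suc i)))) \<inter> homogeneous_vectors (j - (d + int (Suc (Suc i)))))
          = {u \<in> vectors (length (H (Suc i))) \<inter> homogeneous_vectors (j - (d + int (Suc i))). combination (H (Suc i)) u = 0}"
        unfolding e by (rule exact)
      then show ?thesis unfolding free_component_linear by (simp only: linear_complex_def free_complex.simps)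
    qed
  qed
qed

text \<open>
  Comparison with the linear complex leaves \<open>d + i\<close> as the only possible degree in the \<open>i\<close>-th Tor group. The element
  \<open>f\<close> of degree \<open>d\<close> ensures that degree \<open>d\<close> does occur for \<open>i = 0\<close>.
\<close>

lemma regularity_of_linear_complex:
  fixes H :: "nat \<Rightarrow> ('n::finite, 'k::field) mvec list"
  assumes H0: "set (H 0) \<subseteq> homogeneous_vectors d" "vec.span (set (H 0)) = single 0 ` J"
    and HS: "\<And>i. set (H (Suc i)) \<subseteq> homogeneous_vectors 1" "\<And>i. vec.span (set (H (Suc i))) = syzygies (H i)"
    and f: "f \<in> J" "f \<in> homogeneous_part d" "f \<noteq> 0"
  shows "has_linear_resolution (*) (ideal_components J) \<and> reg (*) (ideal_components J) = ereal (of_int d)"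
proof -
  let ?M = "ideal_components J"
  let ?G = "linear_complex d H"
  have G: "graded_free_resolution (*) ?M ?G" by (rule linear_complex_resolution[OF H0 HS])
  define F where "F = (SOME F. graded_free_resolution (*) ?M F)"
  have F: "graded_free_resolution (*) ?M F" unfolding F_def by (rule someI[where P = "graded_free_resolution (*) ?M", OF G])
  have f_M: "f \<in> ?M d" using f by (simp add: ideal_components_def)
  have low: "?M j = {0}" if "j < d" for j
  proof (intro equalityI subsetI)
    fix p assume "p \<in> ?M j"
    then obtain u where u: "u \<in> free_component ?G 0 j" "p = aug ?G u"
      unfolding resolutionD(3)[OF G, symmetric] by blast
    have "lookup u k \<in> homogeneous_part (j - d)" for k
      using u(1) by (simp add: free_component_linear homogeneous_vectors_def)
    then have "lookup u k \<in> {0}" for k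
      using that by (subst homogeneous_part_neg[symmetric, of "j - d"]) simp_all
    then have "lookup u k = lookup 0 k" for k by simp
    then have "u = 0" by (rule poly_mapping_eqI)
    then show "p \<in> {0}" using u(2) by (simp add: linear_complex_def)
  next
    fix p :: "('n, 'k) mpol" assume "p \<in> {0}"
    moreover have "aug ?G 0 \<in> aug ?G ` free_component ?G 0 j"
      by (intro imageI free_component_zero)
    ultimately show "p \<in> ?M j"
      unfolding resolutionD(3)[OF G] by (simp add: linear_complex_def)
  qed
  have only: "j = d + int i" if "Tor_nonzero (*) ?M i j" for j i
  proof (rule ccontr)
    assume "j \<noteq> d + int i"
    then have "is_singleton (homology F i j)"
      by (intro homology_trivial_of_resolution[OF F G]) (simp add: linear_complex_def)
    then show False using that by (simp add: Tor_nonzero_def Tor_def F_def)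
  qed
  have T0: "Tor_nonzero (*) ?M 0 d"
    using homology_initial_nontrivial[OF F low f_M f(3)] by (simp add: Tor_nonzero_def Tor_def F_def)
  have "{j. Tor_nonzero (*) ?M 0 j} = {d}"
  proof (intro equalityI subsetI)
    fix j assume "j \<in> {j. Tor_nonzero (*) ?M 0 j}"
    then have "j = d + int 0" by (intro only) (rule CollectD)
    then show "j \<in> {d}" by simp
  qed (use T0 in simp)
  then have t0: "t_inv (*) ?M 0 = ereal (of_int d)" by (simp add: t_inv_def)
  have ti: "t_inv (*) ?M i \<le> ereal (of_int d + real i)" for i
    unfolding t_inv_def
  proof (rule SUP_least)
    fix j assume "j \<in> {j. Tor_nonzero (*) ?M i j}"
    then have "j = d + int i" by (intro only) simp
    then show "ereal (of_int j) \<le> ereal (of_int d + real i)" by simp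
  qed
  have reg: "reg (*) ?M = ereal (of_int d)"
    unfolding reg_def
  proof (rule antisym)
    show "(SUP i. t_inv (*) ?M i - ereal (real i)) \<le> ereal (of_int d)"
    proof (rule SUP_least)
      fix i
      have "t_inv (*) ?M i - ereal (real i) \<le> ereal (of_int d + real i) - ereal (real i)"
        by (intro ereal_minus_mono ti order_refl)
      then show "t_inv (*) ?M i - ereal (real i) \<le> ereal (of_int d)" by simp
    qed
    show "ereal (of_int d) \<le> (SUP i. t_inv (*) ?M i - ereal (real i))"
      using t0 by (intro SUP_upper2[of 0]) simp_all
  qed
  have ne: "?M d \<noteq> {0}" using f_M f(3) by blast
  have "initial_degree ?M = d"
    unfolding initial_degree_def
  proof (rule Least_equality)
    show "?M d \<noteq> {0}" by (rule ne)
    show "d \<le> j" if "?M j \<noteq> {0}" for j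
      using that low[of j] by (meson not_le)
  qed
  then show ?thesis
    using reg ne unfolding has_linear_resolution_def by auto
qed

section \<open>Products of ideals of linear forms\<close>

lemma ideal_product_generators:
  assumes "finite A" "\<And>i. i \<in> A \<Longrightarrow> I i = ideal_generated (L i)"
  shows "ideal_product A I = ring.span {\<Prod>i\<in>A. l i | l. \<forall>i\<in>A. l i \<in> L i}"
proof -
  let ?P = "{\<Prod>i\<in>A. l i | l. \<forall>i\<in>A. l i \<in> L i}"
  have "{\<Prod>i\<in>A. a i | a. \<forall>i\<in>A. a i \<in> I i} \<subseteq> ring.span ?P"
  proof
    fix x assume "x \<in> {\<Prod>i\<in>A. a i | a. \<forall>i\<in>A. a i \<in> I i}"
    then obtain a where a: "x = (\<Prod>i\<in>A. a i)" "\<forall>i\<in>A. a i \<in> I i" by blast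
    have "a i \<in> ring.span (L i)" if "i \<in> A" for i
      using bspec[OF a(2) that] assms(2)[OF that] by (simp add: ideal_generated_def)
    then show "x \<in> ring.span ?P"
      unfolding a(1) by (rule prod_mem_span[OF assms(1)])
  qed
  then have "ideal_product A I \<subseteq> ring.span ?P"
    unfolding ideal_product_def ideal_generated_def by (intro ring.span_minimal ring.subspace_span)
  moreover have "?P \<subseteq> {\<Prod>i\<in>A. a i | a. \<forall>i\<in>A. a i \<in> I i}"
  proof
    fix x assume "x \<in> ?P"
    then obtain l where l: "x = (\<Prod>i\<in>A. l i)" "\<forall>i\<in>A. l i \<in> L i" by blast
    have "l i \<in> I i" if "i \<in> A" for i
      using bspec[OF l(2) that] assms(2)[OF that] by (simp add: ideal_generated_def ring.span_base)
    then show "x \<in> {\<Prod>i\<in>A. a i | a. \<forall>i\<in>A. a i \<in> I i}" using l(1) by blast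
  qed
  then have "ring.span ?P \<subseteq> ideal_product A I"
    unfolding ideal_product_def ideal_generated_def by (rule ring.span_mono)
  ultimately show ?thesis by (rule subset_antisym)
qed

lemma mpol_prod_nonzero:
  fixes p :: "'i \<Rightarrow> ('n::finite, 'k::field) mpol"
  shows "finite A \<Longrightarrow> (\<And>i. i \<in> A \<Longrightarrow> p i \<noteq> 0) \<Longrightarrow> (\<Prod>i\<in>A. p i) \<noteq> 0"
proof (induction A rule: finite_induct)
  case (insert i A)
  then have "p i \<noteq> 0" "(\<Prod>i\<in>A. p i) \<noteq> 0" by simp_all
  then show ?case
    using mpol_no_zero_divisors[of "p i" "\<Prod>i\<in>A. p i"] insert.hyps by auto
qed simp

theorem theorem3p1:
  fixes d :: nat
    and I :: "nat \<Rightarrow> ('n::finite, 'k::field) mpol set"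
  assumes "d \<ge> 1"
    and "\<And>i. i \<in> {1..d} \<Longrightarrow> \<exists>L. L \<subseteq> linear_forms \<and> I i = ideal_generated L"
    and "\<And>i. i \<in> {1..d} \<Longrightarrow> I i \<noteq> {0}"
  shows "has_linear_resolution (*) (ideal_components (ideal_product {1..d} I))
    \<and> reg (*) (ideal_components (ideal_product {1..d} I)) = ereal (real d)"
proof -
  let ?A = "{1..d}"
  have "\<exists>L. \<forall>i\<in>?A. L i \<subseteq> linear_forms \<and> I i = ideal_generated (L i)"
    using assms(2) by (intro bchoice) blast
  then obtain L where L0: "\<forall>i\<in>?A. L i \<subseteq> linear_forms \<and> I i = ideal_generated (L i)" by (rule exE)
  then have L: "L i \<subseteq> linear_forms" "I i = ideal_generated (L i)" if "i \<in> ?A" for i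
    using that by simp_all
  have A: "finite ?A" "?A \<noteq> {}" using assms(1) by simp_all
  have J: "ideal_product ?A I = ring.span {\<Prod>i\<in>?A. l i | l. \<forall>i\<in>?A. l i \<in> L i}"
    by (rule ideal_product_generators[OF A(1)]) (rule L(2))
  have "\<exists>l. l \<in> L i \<and> l \<noteq> 0" if i: "i \<in> ?A" for i
  proof (rule ccontr)
    assume "\<not> (\<exists>l. l \<in> L i \<and> l \<noteq> 0)"
    then have "ring.span (L i) \<subseteq> {0}"
      by (intro ring.span_minimal) (auto simp: ring.subspace_def)
    then have "I i = {0}"
      unfolding L(2)[OF i] ideal_generated_def using ring.span_zero by blast
    then show False using assms(3)[OF i] by contradiction
  qed
  then have "\<exists>l. \<forall>i\<in>?A. l i \<in> L i \<and> l i \<noteq> 0" by (intro bchoice) blast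
  then obtain l where l: "\<forall>i\<in>?A. l i \<in> L i \<and> l i \<noteq> 0" by (rule exE)
  let ?f = "\<Prod>i\<in>?A. l i"
  have "?f \<noteq> 0" using l by (intro mpol_prod_nonzero) simp_all
  moreover have "?f \<in> ideal_product ?A I"
    unfolding J using l by (intro ring.span_base) blast
  moreover have "?f \<in> homogeneous_part (int (card ?A))"
    using l L(1) by (intro homogeneous_part_prod) blast
  moreover obtain H :: "nat \<Rightarrow> ('n, 'k) mvec list" where H: "set (H 0) \<subseteq> homogeneous_vectors (int (card ?A))"
    "vec.span (set (H 0)) = single 0 ` ideal_product ?A I"
    "\<forall>i. set (H (Suc i)) \<subseteq> homogeneous_vectors 1 \<and> vec.span (set (H (Suc i))) = syzygies (H i)"
    using field_extension.exists_linear_syzygy_sequence[OF field_extension_fract infinite_fract A L(1)]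
    unfolding J by iprover
  ultimately have "has_linear_resolution (*) (ideal_components (ideal_product ?A I))
    \<and> reg (*) (ideal_components (ideal_product ?A I)) = ereal (of_int (int (card ?A)))"
    using regularity_of_linear_complex[of H "int (card ?A)" "ideal_product ?A I" ?f] H by simp
  then show ?thesis by simp
qed

end
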